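(* Let $N\ge1$ be an integer. For $\beta>0$, $\theta\in\mathbb{R}$ let $Z[\beta,\theta]$ be the partition function of ultra-local lattice Maxwell theory with $\theta$-term in the modified Villain formulation on $(\mathbb{Z}/N\mathbb{Z})^4$ (defined in the context), and let $\tau=\frac{\theta}{2\pi}+2\pi i\beta$. Then there is a constant $C>0$ depending only on $N$ such that for all $\beta>0$, $\theta\in\mathbb{R}$, $$Z[\beta,\theta]=\frac{C}{\sqrt{\beta}^{\,3(N^4-1)}}\left(\left|\vartheta\begin{bmatrix}0\\0\end{bmatrix}(0,2\tau)\right|^2+\left|\vartheta\begin{bmatrix}1/2\\0\end{bmatrix}(0,2\tau)\right|^2\right)^3 .$$
   Context: Theta function with characteristics: for $\alpha_1,\alpha_2\in\mathbb{R}$, $q\in\mathbb{C}$, $\mathrm{Im}\,\tau>0$, $$\vartheta\begin{bmatrix}\alpha_1\\\alpha_2\end{bmatrix}(q,\tau)=\sum_{n\in\mathbb{Z}}\exp\big(i\pi(n+\alpha_1)^2\tau+2\pi i(n+\alpha_1)(q+\alpha_2)\big).$$ Lattice: $\Lambda=(\mathbb{Z}/N\mathbb{Z})^4$, with unit vectors $\hat\mu$, $\mu=1,\dots,4$. An $r$-form $\alpha$ assigns a value $\alpha_{x,\mu_1\cdots\mu_r}$ to each site $x$ and indices $\mu_i\in\{1,2,3,4\}$, antisymmetric in the indices. Exterior derivative of an $r$-form: $(d\alpha)_{x,\mu_1\cdots\mu_{r+1}}=\sum_{j=1}^{r+1}(-1)^{j+1}[\alpha_{x+\hat\mu_j,\mu_1\cdots\mathring{\mu}_j\cdots\mu_{r+1}}-\alpha_{x,\mu_1\cdots\mathring{\mu}_j\cdots\mu_{r+1}}]$,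 where $\mathring{\mu}_j$ means the index is omitted. Fields: a real 1-form $A^e$ with $A^e_{x,\mu}\in[-\pi,\pi)$ and an integer-valued 2-form $n$. Field strength: $F^e=dA^e+2\pi n$. Topological charge: $$Q_0[F^e]=\frac{1}{8\pi^2}\sum_x\sum_{\mu<\nu,\ \rho<\sigma}\epsilon_{\mu\nu\rho\sigma}F^e_{x,\mu\nu}F^e_{x+\hat\mu+\hat\nu,\rho\sigma},$$ with $\epsilon$ the Levi-Civita symbol. Partition function: $$Z[\beta,\theta]=\int DA^e\sum_{\{n\}}\exp\Big(-\frac{\beta}{2}\sum_x\sum_{\mu<\nu}(F^e_{x,\mu\nu})^2-i\theta Q_0[F^e]\Big)\prod_x\prod_{\mu<\nu<\rho}\delta_{(dn)_{x,\mu\nu\rho},0},$$ where $\int DA^e=\prod_{x,\mu}\int_{-\pi}^{\pi}\frac{dA^e_{x,\mu}}{2\pi}$ and the sum is over all integer-valued 2-forms $n$ (each $n_{x,\mu\nu}$, $\mu<\nu$, independently over $\mathbb{Z}$). *)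

theory Defs
  imports "HOL-Analysis.Analysis" "HOL-Combinatorics.Permutations"
begin

definition theta_char :: "real \<Rightarrow> real \<Rightarrow> complex \<Rightarrow> complex \<Rightarrow> complex" where
  "theta_char \<alpha>\<^sub>1 \<alpha>\<^sub>2 q \<tau> =
     (\<Sum>\<^sub>\<infinity>n\<in>(UNIV :: int set).
        exp (\<i> * of_real pi * (of_int n + of_real \<alpha>\<^sub>1)\<^sup>2 * \<tau>
             + 2 * of_real pi * \<i> * (of_int n + of_real \<alpha>\<^sub>1) * (q + of_real \<alpha>\<^sub>2)))"

(* A site of (Z/NZ)^4 is given by its four coordinates, taken in {0, ..., N - 1}. *)
type_synonym site = "nat \<Rightarrow> nat"

definition sites :: "nat \<Rightarrow> site set" where
  "sites N = {1..4} \<rightarrow>\<^sub>E {..<N}"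

definition shift :: "nat \<Rightarrow> site \<Rightarrow> nat \<Rightarrow> site" where
  "shift N x \<mu> = x(\<mu> := (x \<mu> + 1) mod N)"

(* The component of an r-form \<alpha> at site x with indices \<mu>_1, ..., \<mu>_r is
   \<alpha> (x, [\<mu>_1, ..., \<mu>_r]). *)
type_synonym 'a lattice_form = "site \<times> nat list \<Rightarrow> 'a"

definition cells :: "nat \<Rightarrow> nat \<Rightarrow> (site \<times> nat list) set" where
  "cells N r = sites N \<times> {\<mu>s. length \<mu>s = r \<and> set \<mu>s \<subseteq> {1..4}}"

definition increasing_indices :: "nat \<Rightarrow> nat list set" where
  "increasing_indices r = {\<mu>s. length \<mu>s = r \<and> set \<mu>s \<subseteq> {1..4} \<and> sorted_wrt (<) \<mu>s}"

(* Extensionality gives each r-form a unique representative, so that sums over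
   forms do not overcount. *)
definition forms :: "nat \<Rightarrow> nat \<Rightarrow> 'a::comm_ring_1 lattice_form set" where
  "forms N r = {\<alpha> \<in> extensional (cells N r).
     \<forall>(x, \<mu>s) \<in> cells N r. \<forall>i<r. \<forall>j<r. i \<noteq> j \<longrightarrow>
       \<alpha> (x, \<mu>s[i := \<mu>s ! j, j := \<mu>s ! i]) = - \<alpha> (x, \<mu>s)}"

definition omit :: "nat \<Rightarrow> 'a list \<Rightarrow> 'a list" where
  "omit j xs = take j xs @ drop (Suc j) xs"

(* List positions start at 0, hence the sign (-1)^j in place of (-1)^(j+1). *)
definition ext_deriv :: "nat \<Rightarrow> 'a::comm_ring_1 lattice_form \<Rightarrow> 'a lattice_form" where
  "ext_deriv N \<alpha> = (\<lambda>(x, \<mu>s). \<Sum>j<length \<mu>s.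
     (-1) ^ j * (\<alpha> (shift N x (\<mu>s ! j), omit j \<mu>s) - \<alpha> (x, omit j \<mu>s)))"

definition levi_civita :: "nat list \<Rightarrow> int" where
  "levi_civita \<mu>s =
     (let p = (\<lambda>i. if i \<in> {1..length \<mu>s} then \<mu>s ! (i - 1) else i)
      in if p permutes {1..length \<mu>s} then sign p else 0)"

definition field_strength :: "nat \<Rightarrow> real lattice_form \<Rightarrow> int lattice_form \<Rightarrow> real lattice_form" where
  "field_strength N A n = (\<lambda>c. ext_deriv N A c + 2 * pi * of_int (n c))"

definition top_charge :: "nat \<Rightarrow> real lattice_form \<Rightarrow> real" where
  "top_charge N F = 1 / (8 * pi\<^sup>2) *
     (\<Sum>x\<in>sites N. \<Sum>\<mu>s\<in>increasing_indices 2. \<Sum>\<rho>s\<in>increasing_indices 2.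
        of_int (levi_civita (\<mu>s @ \<rho>s)) * F (x, \<mu>s) *
        F (shift N (shift N x (\<mu>s ! 0)) (\<mu>s ! 1), \<rho>s))"

(* The probability measure on [-pi, pi) is da / (2 pi). *)
definition gauge_measure :: "nat \<Rightarrow> real lattice_form measure" where
  "gauge_measure N = (\<Pi>\<^sub>M c\<in>cells N 1. uniform_measure lborel {-pi..<pi})"

definition partition_function :: "nat \<Rightarrow> real \<Rightarrow> real \<Rightarrow> complex" where
  "partition_function N \<beta> \<theta> =
     (LINT A|gauge_measure N. (\<Sum>\<^sub>\<infinity>n\<in>forms N 2.
        (let F = field_strength N A n in
         exp (- of_real (\<beta> / 2 * (\<Sum>x\<in>sites N. \<Sum>\<mu>s\<in>increasing_indices 2. (F (x, \<mu>s))\<^sup>2))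
              - \<i> * of_real \<theta> * of_real (top_charge N F))) *
        (\<Prod>x\<in>sites N. \<Prod>\<mu>s\<in>increasing_indices 3. of_bool (ext_deriv N n (x, \<mu>s) = 0))))"

end

theory Submission
  imports Defs "HOL-Probability.Infinite_Product_Measure" "HOL-Probability.Distributions"
begin

text \<open>
  A closed integer 2-form on the periodic lattice is, in exactly one way, the exterior derivative of
  an integer 1-form living on the links outside an axial gauge set plus a form carrying six integer
  fluxes through the coordinate planes. The sum over the integer 1-form unfolds the integrals over
  the circle on these 3 (N^4 - 1) links to integrals over the real line. There the gauge field on
  the remaining links, and the deviation of the flux part from a constant form, are exact and
  disappear by a translation. What is left of the action is a positive definite quadratic form,
  whose Gaussian integral scales with a power of sqrt beta, plus a function of the fluxes alone;
  the topological charge is a function of the fluxes alone, because the curl part integrates to zero.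
  The flux sum is the cube of a double sum over (a, b), which splits by the parity of a + b
  into the two squared theta constants.
\<close>

section \<open>Homotopy operators on the lattice torus\<close>

text \<open>The curl has a kernel, so neither the integer 1-form nor an unfolded real field is
  determined by its field strength, and an integral over all unfolded links would diverge. One
  choice of fixed links cures both: fields vanishing there are recovered from their curl by explicit
  partial sums. These use only ring operations, so they give the bijection over the integers and,
  over the reals, the bound that makes the quadratic form coercive. There remain 4 N^4 - (N^4 + 3) =
  3 (N^4 - 1) Gaussian variables; each fixed link keeps its probability measure and contributes 1. A
  constant form is orthogonal to every exact one, so with it energy and charge split without cross
  terms; but the constant form of integer flux takes values in 2 pi / N^2 times the integers. Hence
  integer forms are counted with the flux concentrated on corner plaquettes, and only over the reals
  is it spread out. The phase depends on the fluxes alone, so the unfolding takes place in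
  nonnegative integrals, and absolute convergence reduces to the flux sum.\<close>

lemma sites_update: "x \<in> sites N \<Longrightarrow> k \<in> {1..4} \<Longrightarrow> t < N \<Longrightarrow> x(k := t) \<in> sites N"
  unfolding sites_def by (auto simp: PiE_iff extensional_def)

lemma sites_less: "x \<in> sites N \<Longrightarrow> k \<in> {1..4} \<Longrightarrow> x k < N"
  unfolding sites_def by (auto simp: PiE_iff)

lemma shift_in_sites: "x \<in> sites N \<Longrightarrow> k \<in> {1..4} \<Longrightarrow> shift N x k \<in> sites N"
  unfolding shift_def using sites_less[of x N k] by (intro sites_update) auto

lemma finite_sites: "finite (sites N)"
  unfolding sites_def by (intro finite_PiE) auto

lemma card_sites: "card (sites N) = N ^ 4"
  unfolding sites_def by (subst card_PiE) auto

lemma shift_commute: "shift N (shift N x \<mu>) \<nu> = shift N (shift N x \<nu>) \<mu>"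
  by (auto simp: shift_def fun_eq_iff)

lemma bij_betw_shift:
  assumes "k \<in> {1..4}"
  shows "bij_betw (\<lambda>x. shift N x k) (sites N) (sites N)"
proof -
  have "inj_on (\<lambda>x. shift N x k) (sites N)"
  proof (rule inj_onI)
    fix x y assume xy: "x \<in> sites N" "y \<in> sites N" "shift N x k = shift N y k"
    have "(x k + 1) mod N = (y k + 1) mod N"
      using fun_cong[OF xy(3), of k] by (simp add: shift_def)
    moreover have "x k < N" "y k < N" using sites_less xy assms by auto
    ultimately have "x k = y k"
      by (simp add: mod_Suc split: if_splits)
    moreover have "x i = y i" if "i \<noteq> k" for i
      using fun_cong[OF xy(3), of i] that by (simp add: shift_def)
    ultimately have "x i = y i" for i by (cases "i = k") auto
    then show "x = y" by (rule ext)
  qed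
  moreover have "(\<lambda>x. shift N x k) ` sites N \<subseteq> sites N" using shift_in_sites assms by auto
  ultimately show ?thesis using endo_inj_surj[OF finite_sites] by (auto simp: bij_betw_def)
qed

lemma sum_sites_shift:
  "k \<in> {1..4} \<Longrightarrow> (\<Sum>x\<in>sites N. g (shift N x k)) = (\<Sum>x\<in>sites N. g x)"
  by (rule sum.reindex_bij_betw[OF bij_betw_shift])

section \<open>Differences and partial sums along one direction\<close>

definition fwd_diff :: "nat \<Rightarrow> nat \<Rightarrow> (site \<Rightarrow> 'a::comm_ring_1) \<Rightarrow> site \<Rightarrow> 'a" where
  "fwd_diff N \<mu> g x = g (shift N x \<mu>) - g x"

text \<open>The primitive along direction \<open>k\<close> normalised to vanish at coordinate 0. It
  is in general not periodic, and its jump at coordinate \<open>N - 1\<close> is where the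
  cohomology of the torus enters.\<close>

definition axial_sum :: "nat \<Rightarrow> (site \<Rightarrow> 'a::comm_ring_1) \<Rightarrow> site \<Rightarrow> 'a" where
  "axial_sum k g x = (\<Sum>t<x k. g (x(k := t)))"

lemma sum_fwd_diff: "k \<in> {1..4} \<Longrightarrow> (\<Sum>x\<in>sites N. fwd_diff N k g x) = 0"
  unfolding fwd_diff_def sum_subtractf by (simp add: sum_sites_shift)

text \<open>At \<open>N - 1\<close> the shift wraps to coordinate 0, where the partial sum is empty;
  what remains is minus the sum over the other points of the circle.\<close>

lemma fwd_diff_axial_sum:
  assumes "x k < N"
  shows "fwd_diff N k (axial_sum k g) x =
    g x - (if x k = N - 1 then \<Sum>t<N. g (x(k := t)) else 0)"
proof (cases "x k = N - 1")
  case True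
  then have "N = Suc (x k)" using assms by simp
  then show ?thesis by (simp add: fwd_diff_def axial_sum_def shift_def)
next
  case False
  then have "(x k + 1) mod N = Suc (x k)" using assms by simp
  with False show ?thesis by (simp add: fwd_diff_def axial_sum_def shift_def)
qed

lemma axial_sum_fwd_diff:
  assumes "x k < N"
  shows "axial_sum k (fwd_diff N k g) x = g x - g (x(k := 0))"
proof -
  have "axial_sum k (fwd_diff N k g) x = (\<Sum>t<x k. g (x(k := Suc t)) - g (x(k := t)))"
    unfolding axial_sum_def fwd_diff_def shift_def using assms by (intro sum.cong) auto
  also have "\<dots> = g (x(k := x k)) - g (x(k := 0))"
    by (rule sum_lessThan_telescope[of "\<lambda>t. g (x(k := t))"])
  finally show ?thesis by simp
qed

lemma fwd_diff_update_other:
  "\<mu> \<noteq> k \<Longrightarrow> fwd_diff N \<mu> g (x(k := t)) = fwd_diff N \<mu> (\<lambda>x. g (x(k := t))) x"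
  by (simp add: fwd_diff_def shift_def fun_upd_twist)

lemma fwd_diff_axial_sum_other:
  assumes "\<mu> \<noteq> k"
  shows "fwd_diff N \<mu> (axial_sum k g) x = axial_sum k (fwd_diff N \<mu> g) x"
proof -
  have "shift N x \<mu> k = x k" using assms by (simp add: shift_def)
  then show ?thesis
    using assms by (simp add: fwd_diff_def axial_sum_def sum_subtractf shift_def fun_upd_twist)
qed

lemma sum_cyclic_fwd_diff:
  assumes "N \<ge> 1"
  shows "(\<Sum>t<N. fwd_diff N k g (x(k := t))) = 0"
proof -
  obtain M where N: "N = Suc M" using assms by (cases N) auto
  have "(\<Sum>t<N. g (x(k := Suc t mod N))) = (\<Sum>t<M. g (x(k := Suc t))) + g (x(k := 0))"
    unfolding N sum.lessThan_Suc by simp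
  also have "\<dots> = (\<Sum>t<N. g (x(k := t)))"
    unfolding N by (subst sum.lessThan_Suc_shift) (simp add: add.commute)
  finally show ?thesis by (simp add: fwd_diff_def shift_def sum_subtractf)
qed

text \<open>
  From here on forms are given by components: a 1-form as \<open>a \<mu> x\<close>, a 2-form as \<open>f \<mu> \<nu> x\<close>.
\<close>

definition curl :: "nat \<Rightarrow> (nat \<Rightarrow> site \<Rightarrow> 'a::comm_ring_1) \<Rightarrow> nat \<Rightarrow> nat \<Rightarrow> site \<Rightarrow> 'a" where
  "curl N a \<mu> \<nu> x = fwd_diff N \<mu> (a \<nu>) x - fwd_diff N \<nu> (a \<mu>) x"

text \<open>Alternation is included because the cocycle identity does not imply it, and the zero
  diagonal because \<open>'a\<close> may have characteristic 2. All conditions are restricted to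
  actual sites and directions, as lattice forms are arbitrary elsewhere.\<close>

definition closed2 :: "nat \<Rightarrow> (nat \<Rightarrow> nat \<Rightarrow> site \<Rightarrow> 'a::comm_ring_1) \<Rightarrow> bool" where
  "closed2 N f \<longleftrightarrow> (\<forall>x\<in>sites N. \<forall>\<mu>\<in>{1..4}. \<forall>\<nu>\<in>{1..4}. f \<mu> \<mu> x = 0 \<and> f \<mu> \<nu> x = - f \<nu> \<mu> x \<and>
    (\<forall>\<rho>\<in>{1..4}. fwd_diff N \<mu> (f \<nu> \<rho>) x - fwd_diff N \<nu> (f \<mu> \<rho>) x + fwd_diff N \<rho> (f \<mu> \<nu>) x = 0))"

lemma closed2D:
  assumes "closed2 N f" "x \<in> sites N" "\<mu> \<in> {1..4}" "\<nu> \<in> {1..4}"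
  shows closed2_diag: "f \<mu> \<mu> x = 0"
    and closed2_antisym: "f \<mu> \<nu> x = - f \<nu> \<mu> x"
    and closed2_cocycle: "\<rho> \<in> {1..4} \<Longrightarrow>
      fwd_diff N \<mu> (f \<nu> \<rho>) x - fwd_diff N \<nu> (f \<mu> \<rho>) x + fwd_diff N \<rho> (f \<mu> \<nu>) x = 0"
  using assms(1)[unfolded closed2_def, rule_format, OF assms(2-4)] by blast+

lemma closed2I:
  assumes "\<And>x \<mu>. x \<in> sites N \<Longrightarrow> \<mu> \<in> {1..4} \<Longrightarrow> f \<mu> \<mu> x = 0"
    and "\<And>x \<mu> \<nu>. x \<in> sites N \<Longrightarrow> \<mu> \<in> {1..4} \<Longrightarrow> \<nu> \<in> {1..4} \<Longrightarrow> f \<mu> \<nu> x = - f \<nu> \<mu> x"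
    and "\<And>x \<mu> \<nu> \<rho>. x \<in> sites N \<Longrightarrow> \<mu> \<in> {1..4} \<Longrightarrow> \<nu> \<in> {1..4} \<Longrightarrow> \<rho> \<in> {1..4} \<Longrightarrow>
      fwd_diff N \<mu> (f \<nu> \<rho>) x - fwd_diff N \<nu> (f \<mu> \<rho>) x + fwd_diff N \<rho> (f \<mu> \<nu>) x = 0"
  shows "closed2 N f"
  unfolding closed2_def using assms by blast

lemma closed2_cong:
  assumes f: "closed2 N f"
    and eq: "\<And>x \<mu> \<nu>. x \<in> sites N \<Longrightarrow> \<mu> \<in> {1..4} \<Longrightarrow> \<nu> \<in> {1..4} \<Longrightarrow> f \<mu> \<nu> x = g \<mu> \<nu> x"
  shows "closed2 N g"
proof (rule closed2I)
  fix x :: site and \<mu> \<nu> \<rho> :: nat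
  assume x: "x \<in> sites N" and m: "\<mu> \<in> {1..4}"
  show "g \<mu> \<mu> x = 0" using closed2_diag[OF f x m m] eq[OF x m m] by simp
  assume n: "\<nu> \<in> {1..4}"
  show "g \<mu> \<nu> x = - g \<nu> \<mu> x"
    using closed2_antisym[OF f x m n] unfolding eq[OF x m n] eq[OF x n m] .
  assume r: "\<rho> \<in> {1..4}"
  have d: "fwd_diff N i (g j k) x = fwd_diff N i (f j k) x"
    if "i \<in> {1..4}" "j \<in> {1..4}" "k \<in> {1..4}" for i j k
    unfolding fwd_diff_def using eq[OF x that(2,3)] eq[OF shift_in_sites[OF x that(1)] that(2,3)] by simp
  show "fwd_diff N \<mu> (g \<nu> \<rho>) x - fwd_diff N \<nu> (g \<mu> \<rho>) x + fwd_diff N \<rho> (g \<mu> \<nu>) x = 0"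
    using closed2_cocycle[OF f x m n r] unfolding d[OF m n r] d[OF n m r] d[OF r m n] .
qed

lemma closed2_curl: "closed2 N (curl N a)"
proof -
  have "fwd_diff N \<mu> (curl N a \<nu> \<rho>) x - fwd_diff N \<nu> (curl N a \<mu> \<rho>) x +
      fwd_diff N \<rho> (curl N a \<mu> \<nu>) x = 0" for \<mu> \<nu> \<rho> x
    unfolding curl_def fwd_diff_def shift_commute[of N x \<nu> \<mu>] shift_commute[of N x \<rho> \<mu>]
      shift_commute[of N x \<rho> \<nu>] by (simp add: algebra_simps)
  then show ?thesis unfolding closed2_def by (simp add: curl_def)
qed

lemma closed2_diff:
  assumes "closed2 N f" "closed2 N g"
  shows "closed2 N (\<lambda>\<mu> \<nu> x. f \<mu> \<nu> x - g \<mu> \<nu> x)"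
proof -
  have eq: "fwd_diff N \<mu> (\<lambda>x. f \<nu> \<rho> x - g \<nu> \<rho> x) x = fwd_diff N \<mu> (f \<nu> \<rho>) x - fwd_diff N \<mu> (g \<nu> \<rho>) x"
    for \<mu> \<nu> \<rho> x by (simp add: fwd_diff_def)
  show ?thesis
  proof (rule closed2I, unfold eq)
    fix x :: site and \<mu> \<nu> \<rho> :: nat
    assume x: "x \<in> sites N" and m: "\<mu> \<in> {1..4}"
    show "f \<mu> \<mu> x - g \<mu> \<mu> x = 0"
      using closed2_diag[OF assms(1) x m m] closed2_diag[OF assms(2) x m m] by simp
    assume n: "\<nu> \<in> {1..4}"
    show "f \<mu> \<nu> x - g \<mu> \<nu> x = - (f \<nu> \<mu> x - g \<nu> \<mu> x)"
      unfolding closed2_antisym[OF assms(1) x m n] closed2_antisym[OF assms(2) x m n] by simp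
    assume r: "\<rho> \<in> {1..4}"
    have "fwd_diff N \<mu> (f \<nu> \<rho>) x - fwd_diff N \<mu> (g \<nu> \<rho>) x -
        (fwd_diff N \<nu> (f \<mu> \<rho>) x - fwd_diff N \<nu> (g \<mu> \<rho>) x) +
        (fwd_diff N \<rho> (f \<mu> \<nu>) x - fwd_diff N \<rho> (g \<mu> \<nu>) x) =
      (fwd_diff N \<mu> (f \<nu> \<rho>) x - fwd_diff N \<nu> (f \<mu> \<rho>) x + fwd_diff N \<rho> (f \<mu> \<nu>) x) -
      (fwd_diff N \<mu> (g \<nu> \<rho>) x - fwd_diff N \<nu> (g \<mu> \<rho>) x + fwd_diff N \<rho> (g \<mu> \<nu>) x)"
      by (simp add: algebra_simps)
    then show "fwd_diff N \<mu> (f \<nu> \<rho>) x - fwd_diff N \<mu> (g \<nu> \<rho>) x -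
        (fwd_diff N \<nu> (f \<mu> \<rho>) x - fwd_diff N \<nu> (g \<mu> \<rho>) x) +
        (fwd_diff N \<rho> (f \<mu> \<nu>) x - fwd_diff N \<rho> (g \<mu> \<nu>) x) = 0"
      by (simp only: closed2_cocycle[OF assms(1) x m n r] closed2_cocycle[OF assms(2) x m n r] diff_self)
  qed
qed

text \<open>
  The contraction in direction \<open>k\<close> is a cochain homotopy from the identity to the collapse, which
  makes a form constant along \<open>k\<close> in its components without \<open>k\<close> and, in the components with \<open>k\<close>,
  moves the sum over the whole circle to its last link.
\<close>

definition contract :: "nat \<Rightarrow> (nat \<Rightarrow> nat \<Rightarrow> site \<Rightarrow> 'a::comm_ring_1) \<Rightarrow> nat \<Rightarrow> site \<Rightarrow> 'a" where
  "contract k f \<nu> = axial_sum k (f k \<nu>)"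

definition collapse2 ::
  "nat \<Rightarrow> nat \<Rightarrow> (nat \<Rightarrow> nat \<Rightarrow> site \<Rightarrow> 'a::comm_ring_1) \<Rightarrow> nat \<Rightarrow> nat \<Rightarrow> site \<Rightarrow> 'a" where
  "collapse2 N k f \<mu> \<nu> x = (if \<mu> = k \<or> \<nu> = k
     then (if x k = N - 1 then \<Sum>t<N. f \<mu> \<nu> (x(k := t)) else 0) else f \<mu> \<nu> (x(k := 0)))"

definition collapse1 :: "nat \<Rightarrow> nat \<Rightarrow> (nat \<Rightarrow> site \<Rightarrow> 'a::comm_ring_1) \<Rightarrow> nat \<Rightarrow> site \<Rightarrow> 'a" where
  "collapse1 N k a \<nu> x = (if \<nu> = k
     then (if x k = N - 1 then \<Sum>t<N. a k (x(k := t)) else 0) else a \<nu> (x(k := 0)))"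

text \<open>The general homotopy formula has a further term, the contraction of the exterior
  derivative, which closedness removes. If neither index is \<open>k\<close>, the cocycle identity
  turns the curl of the contraction into a telescoping sum along \<open>k\<close>; if exactly one
  is, \<open>fwd_diff_axial_sum\<close> produces the circle sum.\<close>

lemma homotopy2:
  assumes f: "closed2 N f" and x: "x \<in> sites N" and i: "k \<in> {1..4}" "\<mu> \<in> {1..4}" "\<nu> \<in> {1..4}"
  shows "f \<mu> \<nu> x = curl N (contract k f) \<mu> \<nu> x + collapse2 N k f \<mu> \<nu> x"
proof -
  have xk: "x k < N" using x i(1) by (rule sites_less)
  have upd: "x(k := t) \<in> sites N" if "t < x k" for t using that xk x i by (intro sites_update) auto
  have updN: "x(k := t) \<in> sites N" if "t < N" for t using that x i by (intro sites_update) auto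
  have kk: "contract k f k y = 0" if "y \<in> sites N" for y
    using that i f sites_less[OF that i(1)] unfolding contract_def axial_sum_def
    by (intro sum.neutral ballI closed2_diag[OF f sites_update _ i(1)]) auto
  have kk': "fwd_diff N \<rho> (contract k f k) x = 0" if "\<rho> \<in> {1..4}" for \<rho>
    using kk x shift_in_sites[OF x that] by (simp add: fwd_diff_def)
  consider "\<mu> = k" "\<nu> = k" | "\<mu> = k" "\<nu> \<noteq> k" | "\<mu> \<noteq> k" "\<nu> = k" | "\<mu> \<noteq> k" "\<nu> \<noteq> k" by blast
  then show ?thesis
  proof cases
    case 1
    then show ?thesis using closed2_diag[OF f x i(1,1)] closed2_diag[OF f updN i(1,1)]
      by (simp add: curl_def collapse2_def)
  next
    case 2
    then show ?thesis using kk'[OF i(3)] fwd_diff_axial_sum[of x k N "f k \<nu>", OF xk]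
      by (auto simp: curl_def collapse2_def contract_def)
  next
    case 3
    have "f \<mu> k y = - f k \<mu> y" if "y \<in> sites N" for y using closed2_antisym[OF f that i(2) i(1)] .
    then have "(\<Sum>t<N. f \<mu> k (x(k := t))) = - (\<Sum>t<N. f k \<mu> (x(k := t)))" "f \<mu> k x = - f k \<mu> x"
      using x updN by (simp_all add: sum_negf[symmetric])
    then show ?thesis using 3 kk'[OF i(2)] fwd_diff_axial_sum[of x k N "f k \<mu>", OF xk]
      by (simp add: curl_def collapse2_def contract_def)
  next
    case 4
    have "fwd_diff N \<mu> (contract k f \<nu>) x - fwd_diff N \<nu> (contract k f \<mu>) x =
        (\<Sum>t<x k. fwd_diff N \<mu> (f k \<nu>) (x(k := t)) - fwd_diff N \<nu> (f k \<mu>) (x(k := t)))"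
      using 4 by (simp add: contract_def fwd_diff_axial_sum_other axial_sum_def sum_subtractf)
    also have "\<dots> = (\<Sum>t<x k. fwd_diff N k (f \<mu> \<nu>) (x(k := t)))"
    proof (rule sum.cong[OF refl])
      fix t assume "t \<in> {..<x k}"
      from closed2_cocycle[OF f upd i(1-3), of t] this
      show "fwd_diff N \<mu> (f k \<nu>) (x(k := t)) - fwd_diff N \<nu> (f k \<mu>) (x(k := t)) =
         fwd_diff N k (f \<mu> \<nu>) (x(k := t))" by (simp add: algebra_simps)
    qed
    also have "\<dots> = f \<mu> \<nu> x - f \<mu> \<nu> (x(k := 0))"
      using axial_sum_fwd_diff[of x k N "f \<mu> \<nu>", OF xk] by (simp add: axial_sum_def)
    finally show ?thesis using 4 by (simp add: curl_def collapse2_def)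
  qed
qed

text \<open>The homotopy exhibits the collapse as \<open>f\<close> minus a curl, which spares a
  check of the cocycle identity at the wrap-around.\<close>

lemma closed2_collapse2:
  assumes f: "closed2 N f" and k: "k \<in> {1..4}"
  shows "closed2 N (collapse2 N k f)"
  by (rule closed2_cong[OF closed2_diff[OF f closed2_curl[of N "contract k f"]]])
    (use homotopy2[OF f _ k] in \<open>simp add: algebra_simps\<close>)

text \<open>The same homotopy one degree lower. The first term is a pure gauge, the second sees
  \<open>a\<close> only through its curl.\<close>

lemma homotopy1:
  assumes x: "x k < N"
  shows "a \<nu> x = fwd_diff N \<nu> (axial_sum k (a k)) x + contract k (curl N a) \<nu> x + collapse1 N k a \<nu> x"
proof (cases "\<nu> = k")
  case True
  then show ?thesis using fwd_diff_axial_sum[of x k N "a k", OF x]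
    by (auto simp: contract_def curl_def collapse1_def axial_sum_def)
next
  case False
  then show ?thesis
    using axial_sum_fwd_diff[of x k N "a \<nu>", OF x] fwd_diff_axial_sum_other[OF False, of N "a k" x]
    by (simp add: contract_def curl_def collapse1_def axial_sum_def sum_subtractf)
qed

text \<open>The collapse is a chain map because circle sums of differences along \<open>k\<close>
  vanish. This keeps the iterated homotopies for 1-forms in step with those for 2-forms.\<close>

lemma curl_collapse1:
  assumes "N \<ge> 1"
  shows "curl N (collapse1 N k a) = collapse2 N k (curl N a)"
proof (intro ext)
  fix \<mu> \<nu> x
  have *: "fwd_diff N k (\<lambda>x. a \<rho> (x(k := 0))) x = 0" for \<rho>
    by (simp add: fwd_diff_def shift_def)
  have **: "fwd_diff N \<rho> (\<lambda>x. if x k = N - 1 then \<Sum>t<N. a k (x(k := t)) else 0) x =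
    (if x k = N - 1 then \<Sum>t<N. fwd_diff N \<rho> (a k) (x(k := t)) else 0)" if "\<rho> \<noteq> k" for \<rho>
    using that by (simp add: fwd_diff_def shift_def fun_upd_twist sum_subtractf)
  have c1: "collapse1 N k a k = (\<lambda>x. if x k = N - 1 then \<Sum>t<N. a k (x(k := t)) else 0)"
    by (auto simp: collapse1_def fun_eq_iff)
  have c2: "collapse1 N k a \<rho> = (\<lambda>x. a \<rho> (x(k := 0)))" if "\<rho> \<noteq> k" for \<rho>
    using that by (auto simp: collapse1_def fun_eq_iff)
  have s: "(\<Sum>t<N. fwd_diff N k (a \<rho>) (x(k := t))) = 0" for \<rho> using assms by (rule sum_cyclic_fwd_diff)
  consider "\<mu> = \<nu>" | "\<mu> = k" "\<nu> \<noteq> k" | "\<mu> \<noteq> k" "\<nu> = k" | "\<mu> \<noteq> k" "\<nu> \<noteq> k" by blast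
  then show "curl N (collapse1 N k a) \<mu> \<nu> x = collapse2 N k (curl N a) \<mu> \<nu> x"
  proof cases
    case 1 then show ?thesis by (simp add: curl_def collapse2_def)
  next
    case 2
    then show ?thesis using *[of \<nu>] **[of \<nu>] s[of \<nu>]
      by (simp add: curl_def collapse2_def c1 c2 sum_subtractf)
  next
    case 3
    then show ?thesis using *[of \<mu>] **[of \<mu>] s[of \<mu>]
      by (simp add: curl_def collapse2_def c1 c2 sum_subtractf)
  next
    case 4
    then show ?thesis by (simp add: curl_def collapse2_def c2 fwd_diff_update_other)
  qed
qed

text \<open>Direction 4 is contracted first, and each later contraction acts on the form already
  collapsed in the higher directions; \<open>axial_fixed\<close> below mirrors this order.\<close>

definition axial_potential ::
  "nat \<Rightarrow> (nat \<Rightarrow> nat \<Rightarrow> site \<Rightarrow> 'a::comm_ring_1) \<Rightarrow> nat \<Rightarrow> site \<Rightarrow> 'a" where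
  "axial_potential N f \<nu> x =
     contract 4 f \<nu> x + contract 3 (collapse2 N 4 f) \<nu> x +
     contract 2 (collapse2 N 3 (collapse2 N 4 f)) \<nu> x +
     contract 1 (collapse2 N 2 (collapse2 N 3 (collapse2 N 4 f))) \<nu> x"

definition torus_collapse ::
  "nat \<Rightarrow> (nat \<Rightarrow> nat \<Rightarrow> site \<Rightarrow> 'a::comm_ring_1) \<Rightarrow> nat \<Rightarrow> nat \<Rightarrow> site \<Rightarrow> 'a" where
  "torus_collapse N f = collapse2 N 1 (collapse2 N 2 (collapse2 N 3 (collapse2 N 4 f)))"

lemma curl_add: "curl N (\<lambda>\<nu> x. a \<nu> x + b \<nu> x) \<mu> \<nu> x = curl N a \<mu> \<nu> x + curl N b \<mu> \<nu> x"
  by (simp add: curl_def fwd_diff_def)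

lemma curl_scale: "curl N (\<lambda>\<nu> x. c * a \<nu> x) \<mu> \<nu> x = c * curl N a \<mu> \<nu> x"
  by (simp add: curl_def fwd_diff_def algebra_simps)

lemma curl_axial_potential:
  assumes f: "closed2 N f" and x: "x \<in> sites N" and i: "\<mu> \<in> {1..4}" "\<nu> \<in> {1..4}"
  shows "f \<mu> \<nu> x = curl N (axial_potential N f) \<mu> \<nu> x + torus_collapse N f \<mu> \<nu> x"
proof -
  have n: "4 \<in> {1..4::nat}" "3 \<in> {1..4::nat}" "2 \<in> {1..4::nat}" "1 \<in> {1..4::nat}" by auto
  have f4: "closed2 N (collapse2 N 4 f)" using f n by (simp add: closed2_collapse2)
  have f3: "closed2 N (collapse2 N 3 (collapse2 N 4 f))" using f4 n by (simp add: closed2_collapse2)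
  have f2: "closed2 N (collapse2 N 2 (collapse2 N 3 (collapse2 N 4 f)))"
    using f3 n by (simp add: closed2_collapse2)
  have "f \<mu> \<nu> x = curl N (contract 4 f) \<mu> \<nu> x + collapse2 N 4 f \<mu> \<nu> x"
    by (rule homotopy2[OF f x n(1) i])
  also note homotopy2[OF f4 x n(2) i]
  also note homotopy2[OF f3 x n(3) i]
  also note homotopy2[OF f2 x n(4) i]
  finally show ?thesis
    by (simp add: curl_def axial_potential_def torus_collapse_def fwd_diff_def)
qed

section \<open>The cohomology class that survives all four collapses\<close>

lemma sites_update_all:
  assumes "x \<in> sites N" "y \<in> sites N"
  shows "x(1 := a, 2 := b, 3 := c, 4 := d) = y(1 := a, 2 := b, 3 := c, 4 := d)"
proof
  fix i :: nat
  have "x i = y i" if "i \<notin> {1..4}" using assms that by (simp add: sites_def PiE_iff extensional_def)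
  moreover have "i = 1 \<or> i = 2 \<or> i = 3 \<or> i = 4" if "i \<in> {1..4}" using that by auto
  ultimately show "(x(1 := a, 2 := b, 3 := c, 4 := d)) i = (y(1 := a, 2 := b, 3 := c, 4 := d)) i"
    by auto
qed

lemma index_cases: "i \<in> {1..4::nat} \<longleftrightarrow> i = 1 \<or> i = 2 \<or> i = 3 \<or> i = 4" by auto

text \<open>Collapsing along \<open>\<mu>\<close> and \<open>\<nu>\<close> concentrates the
  component on the last slice, and the other collapses freeze their coordinate at 0. After all four
  no coordinate is left free, so the nonzero value is a single constant.\<close>

lemma torus_collapse_eq:
  fixes f :: "nat \<Rightarrow> nat \<Rightarrow> site \<Rightarrow> 'a::comm_ring_1"
  assumes i: "\<mu> \<in> {1..4}" "\<nu> \<in> {1..4}"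
  shows "\<exists>c. \<forall>x\<in>sites N. torus_collapse N f \<mu> \<nu> x = (if x \<mu> = N - 1 \<and> x \<nu> = N - 1 then c else 0)"
proof (cases "\<exists>y\<in>sites N. y \<mu> = N - 1 \<and> y \<nu> = N - 1")
  case True
  then obtain y where y: "y \<in> sites N" "y \<mu> = N - 1" "y \<nu> = N - 1" by blast
  show ?thesis
  proof (intro exI ballI)
    fix x assume x: "x \<in> sites N"
    show "torus_collapse N f \<mu> \<nu> x =
        (if x \<mu> = N - 1 \<and> x \<nu> = N - 1 then torus_collapse N f \<mu> \<nu> y else 0)"
      using i y(2,3) unfolding index_cases
      by (elim disjE) (simp_all add: torus_collapse_def collapse2_def sites_update_all[OF x y(1), unfolded One_nat_def])
  qed
next
  case False
  show ?thesis
  proof (intro exI ballI)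
    fix x assume x: "x \<in> sites N"
    then have "\<not> (x \<mu> = N - 1 \<and> x \<nu> = N - 1)" using False by blast
    then show "torus_collapse N f \<mu> \<nu> x = (if x \<mu> = N - 1 \<and> x \<nu> = N - 1 then 0 else 0)"
      using i unfolding index_cases
      by (elim disjE) (auto simp: torus_collapse_def collapse2_def)
  qed
qed

lemma card_corner:
  assumes "N \<ge> 1" "\<mu> \<in> {1..4}" "\<nu> \<in> {1..4}" "\<mu> \<noteq> \<nu>"
  shows "card {x \<in> sites N. x \<mu> = N - 1 \<and> x \<nu> = N - 1} = N ^ 2"
proof -
  have "{x \<in> sites N. x \<mu> = N - 1 \<and> x \<nu> = N - 1} =
      (\<Pi>\<^sub>E i\<in>{1..4}. if i = \<mu> \<or> i = \<nu> then {N - 1} else {..<N})"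
    using assms unfolding sites_def
    by (auto simp: PiE_iff extensional_def split: if_splits)
  also have "card \<dots> = (\<Prod>i\<in>{1..4}. card (if i = \<mu> \<or> i = \<nu> then {N - 1} else {..<N}))"
    by (rule card_PiE) simp
  also have "\<dots> = N ^ 2"
  proof -
    have s: "{1..4::nat} = {1,2,3,4}" by auto
    show ?thesis using assms(2-4) unfolding index_cases unfolding s
      by (elim disjE) (simp_all add: power2_eq_square)
  qed
  finally show ?thesis .
qed

lemma sum_curl:
  assumes "\<mu> \<in> {1..4}" "\<nu> \<in> {1..4}"
  shows "(\<Sum>x\<in>sites N. curl N a \<mu> \<nu> x) = 0"
  unfolding curl_def sum_subtractf using assms by (simp add: sum_fwd_diff)

section \<open>Decomposition of closed 2-forms\<close>

text \<open>The integral normal form of a class: on each slice parallel to the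
  \<open>\<mu>\<close>-\<open>\<nu>\<close> plane the whole flux sits on one plaquette, since an
  integer flux cannot in general be divided among \<open>N\<^sup>2\<close> of them.\<close>

definition corner :: "nat \<Rightarrow> (nat \<Rightarrow> nat \<Rightarrow> 'a::comm_ring_1) \<Rightarrow> nat \<Rightarrow> nat \<Rightarrow> site \<Rightarrow> 'a" where
  "corner N c \<mu> \<nu> x = (if x \<mu> = N - 1 \<and> x \<nu> = N - 1 then c \<mu> \<nu> else 0)"

lemma sum_corner:
  assumes "N \<ge> 1" "\<mu> \<in> {1..4}" "\<nu> \<in> {1..4}" "\<mu> \<noteq> \<nu>"
  shows "(\<Sum>x\<in>sites N. corner N c \<mu> \<nu> x) = of_nat (N\<^sup>2) * c \<mu> \<nu>"
proof -
  have "(\<Sum>x\<in>sites N. corner N c \<mu> \<nu> x) =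
      (\<Sum>x\<in>{x \<in> sites N. x \<mu> = N - 1 \<and> x \<nu> = N - 1}. c \<mu> \<nu>)"
    unfolding corner_def by (rule sum.inter_filter[symmetric]) (rule finite_sites)
  then show ?thesis by (simp only: sum_constant card_corner[OF assms])
qed

lemma closed2_decompose:
  assumes N: "N \<ge> 1" and f: "closed2 N f"
  obtains c where "\<And>\<mu>. \<mu> \<in> {1..4} \<Longrightarrow> c \<mu> \<mu> = 0"
    and "\<And>\<mu> \<nu>. \<mu> \<in> {1..4} \<Longrightarrow> \<nu> \<in> {1..4} \<Longrightarrow> c \<mu> \<nu> = - c \<nu> \<mu>"
    and "\<And>x \<mu> \<nu>. x \<in> sites N \<Longrightarrow> \<mu> \<in> {1..4} \<Longrightarrow> \<nu> \<in> {1..4} \<Longrightarrow>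
      f \<mu> \<nu> x = curl N (axial_potential N f) \<mu> \<nu> x + corner N c \<mu> \<nu> x"
proof -
  \<comment> \<open>At the far corner the support condition of \<open>torus_collapse_eq\<close>
    holds for every pair of indices, so all coefficients can be read off there.\<close>
  define e where "e = restrict (\<lambda>_. N - 1) {1..4::nat}"
  have e: "e \<in> sites N" "\<And>i. i \<in> {1..4} \<Longrightarrow> e i = N - 1" using N by (auto simp: e_def sites_def)
  define c where "c \<mu> \<nu> = torus_collapse N f \<mu> \<nu> e" for \<mu> \<nu>
  have tc: "torus_collapse N f \<mu> \<nu> x = corner N c \<mu> \<nu> x"
    if x: "x \<in> sites N" and i: "\<mu> \<in> {1..4}" "\<nu> \<in> {1..4}" for x \<mu> \<nu>
  proof -
    obtain d where d: "\<forall>x\<in>sites N. torus_collapse N f \<mu> \<nu> x = (if x \<mu> = N - 1 \<and> x \<nu> = N - 1 then d else 0)"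
      using torus_collapse_eq[OF i] by blast
    have "c \<mu> \<nu> = d" unfolding c_def using d e i by auto
    then show ?thesis using d x by (auto simp: corner_def)
  qed
  have cl: "closed2 N (torus_collapse N f)"
    unfolding torus_collapse_def by (intro closed2_collapse2 f) auto
  show ?thesis
  proof (rule that[of c])
    fix \<mu> assume m: "\<mu> \<in> {1..4::nat}"
    show "c \<mu> \<mu> = 0" unfolding c_def by (rule closed2_diag[OF cl e(1) m m])
  next
    fix \<mu> \<nu> assume m: "\<mu> \<in> {1..4::nat}" "\<nu> \<in> {1..4::nat}"
    show "c \<mu> \<nu> = - c \<nu> \<mu>" unfolding c_def by (rule closed2_antisym[OF cl e(1) m])
  next
    fix x \<mu> \<nu> assume x: "x \<in> sites N" "\<mu> \<in> {1..4::nat}" "\<nu> \<in> {1..4::nat}"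
    show "f \<mu> \<nu> x = curl N (axial_potential N f) \<mu> \<nu> x + corner N c \<mu> \<nu> x"
      using curl_axial_potential[OF f x] tc[OF x] by simp
  qed
qed

text \<open>The sum over the lattice detects the class: curls sum to 0 and a corner component to
  \<open>N\<^sup>2\<close> times its coefficient, which the reals allow to cancel.\<close>

lemma closed2_exact:
  fixes f :: "nat \<Rightarrow> nat \<Rightarrow> site \<Rightarrow> real"
  assumes N: "N \<ge> 1" and f: "closed2 N f"
    and z: "\<And>\<mu> \<nu>. \<mu> \<in> {1..4} \<Longrightarrow> \<nu> \<in> {1..4} \<Longrightarrow> (\<Sum>x\<in>sites N. f \<mu> \<nu> x) = 0"
    and x: "x \<in> sites N" "\<mu> \<in> {1..4}" "\<nu> \<in> {1..4}"
  shows "f \<mu> \<nu> x = curl N (axial_potential N f) \<mu> \<nu> x"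
proof -
  obtain c where c: "\<And>\<mu>. \<mu> \<in> {1..4} \<Longrightarrow> c \<mu> \<mu> = 0"
    "\<And>x \<mu> \<nu>. x \<in> sites N \<Longrightarrow> \<mu> \<in> {1..4} \<Longrightarrow> \<nu> \<in> {1..4} \<Longrightarrow>
      f \<mu> \<nu> x = curl N (axial_potential N f) \<mu> \<nu> x + corner N c \<mu> \<nu> x"
    using closed2_decompose[OF N f] by metis
  have "c \<mu> \<nu> = 0"
  proof (cases "\<mu> = \<nu>")
    case True then show ?thesis using c x by simp
  next
    case False
    have "0 = (\<Sum>x\<in>sites N. curl N (axial_potential N f) \<mu> \<nu> x + corner N c \<mu> \<nu> x)"
      unfolding z[OF x(2,3), symmetric] by (rule sum.cong[OF refl c(2)[OF _ x(2,3)]])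
    also have "\<dots> = of_nat (N\<^sup>2) * c \<mu> \<nu>"
      unfolding sum.distrib using x False N by (simp add: sum_curl sum_corner)
    finally show ?thesis using N by simp
  qed
  then show ?thesis using c(2)[OF x] by (simp add: corner_def)
qed

text \<open>
  The fixed links are a spanning tree (the links with \<open>x \<mu> \<noteq> N - 1\<close>) and, for each direction,
  one link closing a loop around the torus.
\<close>

definition axial_fixed :: "nat \<Rightarrow> nat \<Rightarrow> site \<Rightarrow> bool" where
  "axial_fixed N \<mu> x \<longleftrightarrow> (\<forall>\<nu>\<in>{1..4}. \<mu> < \<nu> \<longrightarrow> x \<nu> = 0) \<and>
     (x \<mu> \<noteq> N - 1 \<or> (\<forall>\<nu>\<in>{1..4}. \<nu> < \<mu> \<longrightarrow> x \<nu> = 0))"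

section \<open>Fields in axial gauge\<close>

lemma set_indices: "{1..4::nat} = {1,2,3,4}" by auto

text \<open>For a link in direction \<open>\<mu>\<close>, contractions along higher directions are
  empty sums at coordinate 0, and the contraction along \<open>\<mu>\<close> meets a diagonal
  component. Those along lower directions see a form already concentrated on
  \<open>x \<mu> = N - 1\<close>, or else are empty sums as well.\<close>

lemma axial_potential_fixed:
  assumes f: "closed2 N f" and x: "x \<in> sites N" and m: "\<mu> \<in> {1..4}" and a: "axial_fixed N \<mu> x"
  shows "axial_potential N f \<mu> x = 0"
proof -
  have diag: "contract k g k x = 0" if g: "closed2 N g" and k: "k \<in> {1..4}" for k and g :: "nat \<Rightarrow> nat \<Rightarrow> site \<Rightarrow> 'a"
    using sites_less[OF x k] unfolding contract_def axial_sum_def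
    by (intro sum.neutral ballI closed2_diag[OF g sites_update[OF x k] k k]) auto
  have c4: "closed2 N (collapse2 N 4 f)" by (rule closed2_collapse2[OF f]) simp
  have c3: "closed2 N (collapse2 N 3 (collapse2 N 4 f))" by (rule closed2_collapse2[OF c4]) simp
  have c2: "closed2 N (collapse2 N 2 (collapse2 N 3 (collapse2 N 4 f)))" by (rule closed2_collapse2[OF c3]) simp
  show ?thesis
    using m[unfolded index_cases] a[unfolded axial_fixed_def set_indices]
      diag[OF f, of 4] diag[OF c4, of 3] diag[OF c3, of 2] diag[OF c2, of 1]
    by (elim disjE) (auto simp: axial_potential_def contract_def axial_sum_def collapse2_def)
qed

text \<open>Iterates \<open>homotopy1\<close>. The gauge functions \<open>axial_sum k\<close> only
  sum over links with coordinate below \<open>N - 1\<close>, which are tree links here, so they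
  vanish; the last collapse vanishes because the closing links are fixed too.\<close>

lemma axial_potential_curl:
  assumes N: "N \<ge> 1" and x: "x \<in> sites N" and m: "\<mu> \<in> {1..4}"
    and a: "\<And>y \<nu>. y \<in> sites N \<Longrightarrow> \<nu> \<in> {1..4} \<Longrightarrow> axial_fixed N \<nu> y \<Longrightarrow> a \<nu> y = 0"
  shows "axial_potential N (curl N a) \<mu> x = a \<mu> x"
proof -
  define a4 where "a4 = collapse1 N 4 a"
  define a3 where "a3 = collapse1 N 3 a4"
  define a2 where "a2 = collapse1 N 2 a3"
  define a1 where "a1 = collapse1 N 1 a2"
  note d = a1_def a2_def a3_def a4_def
  have u: "y(k := t) \<in> sites N" if "y \<in> sites N" "t < N" "k \<in> {1,2,3,4}" for y k t
    using that by (intro sites_update) auto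
  have z: "a \<nu> y = 0" if "y \<in> sites N" "\<nu> \<in> {1,2,3,4}" "axial_fixed N \<nu> y" for y \<nu>
    using a that by (auto simp: set_indices)
  have lt: "y 1 < N" "y 2 < N" "y 3 < N" "y 4 < N" if "y \<in> sites N" for y
    using sites_less[OF that] by auto
  have s4: "axial_sum 4 (a 4) y = 0" if "y \<in> sites N" for y
    unfolding axial_sum_def using lt[OF that] that
    by (intro sum.neutral ballI z u) (auto simp: axial_fixed_def)
  have s3: "axial_sum 3 (a4 3) y = 0" if "y \<in> sites N" for y
    unfolding axial_sum_def a4_def collapse1_def using lt[OF that] that N
    by (auto intro!: sum.neutral z u) (auto simp: axial_fixed_def set_indices)
  have s2: "axial_sum 2 (a3 2) y = 0" if "y \<in> sites N" for y
    unfolding axial_sum_def a3_def a4_def collapse1_def using lt[OF that] that N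
    by (auto intro!: sum.neutral z u) (auto simp: axial_fixed_def set_indices)
  have s1: "axial_sum 1 (a2 1) y = 0" if "y \<in> sites N" for y
    unfolding axial_sum_def a2_def a3_def a4_def collapse1_def using lt[OF that] that N
    by (auto intro!: sum.neutral z u) (auto simp: axial_fixed_def set_indices)
  \<comment> \<open>The full collapse is the holonomy along the loop through the origin. All its
    \<open>N\<close> links are fixed, the last one by the second alternative in
    \<open>axial_fixed\<close>.\<close>
  have s0: "a1 \<mu> x = 0"
    using m unfolding index_cases
    apply (elim disjE)
    apply (simp_all add: d collapse1_def)
    apply ((intro impI sum.neutral ballI z u x; use N lt[OF x] in \<open>force simp: axial_fixed_def set_indices\<close>)+)
    done
  have fd: "fwd_diff N \<mu> (axial_sum k g) x = 0" if "\<And>y. y \<in> sites N \<Longrightarrow> axial_sum k g y = 0"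
    for k and g :: "site \<Rightarrow> 'a"
    using that x shift_in_sites[OF x m] by (simp add: fwd_diff_def)
  have "a \<mu> x = contract 4 (curl N a) \<mu> x + a4 \<mu> x"
    using homotopy1[of x 4 N a \<mu>] lt[OF x] fd[OF s4] by (simp add: a4_def)
  moreover have "a4 \<mu> x = contract 3 (curl N a4) \<mu> x + a3 \<mu> x"
    using homotopy1[of x 3 N a4 \<mu>] lt[OF x] fd[OF s3] by (simp add: a3_def)
  moreover have "a3 \<mu> x = contract 2 (curl N a3) \<mu> x + a2 \<mu> x"
    using homotopy1[of x 2 N a3 \<mu>] lt[OF x] fd[OF s2] by (simp add: a2_def)
  moreover have "a2 \<mu> x = contract 1 (curl N a2) \<mu> x + a1 \<mu> x"
    using homotopy1[of x 1 N a2 \<mu>] lt[OF x] fd[OF s1] by (simp add: a1_def)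
  ultimately show ?thesis
    using s0 by (simp add: axial_potential_def d curl_collapse1[OF N] algebra_simps)
qed

text \<open>Every collapse and every contraction sums at most \<open>N\<close> terms, and each of
  the four summands involves at most three collapses and one contraction.\<close>

lemma axial_potential_bound:
  fixes f :: "nat \<Rightarrow> nat \<Rightarrow> site \<Rightarrow> real"
  assumes N: "N \<ge> 1" and x: "x \<in> sites N" and m: "\<mu> \<in> {1..4}"
    and f: "\<And>x \<mu> \<nu>. x \<in> sites N \<Longrightarrow> \<mu> \<in> {1..4} \<Longrightarrow> \<nu> \<in> {1..4} \<Longrightarrow> \<bar>f \<mu> \<nu> x\<bar> \<le> e"
  shows "\<bar>axial_potential N f \<mu> x\<bar> \<le> 4 * real N ^ 4 * e"
proof -
  have e0: "0 \<le> e" using f[OF x m m] by linarith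
  define bd where "bd g i \<longleftrightarrow> (\<forall>x\<in>sites N. \<forall>\<mu>\<in>{1..4}. \<forall>\<nu>\<in>{1..4}. \<bar>g \<mu> \<nu> x\<bar> \<le> real N ^ i * e)"
    for g :: "nat \<Rightarrow> nat \<Rightarrow> site \<Rightarrow> real" and i
  have bdD: "\<bar>g \<mu> \<nu> x\<bar> \<le> real N ^ i * e"
    if "bd g i" "x \<in> sites N" "\<mu> \<in> {1..4}" "\<nu> \<in> {1..4}" for g i x \<mu> \<nu>
    using that unfolding bd_def by blast
  have con: "\<bar>contract k g \<mu> x\<bar> \<le> real N ^ Suc i * e"
    if k: "k \<in> {1..4}" and g: "bd g i"
    for k g i
  proof -
    have "\<bar>contract k g \<mu> x\<bar> \<le> (\<Sum>t<x k. real N ^ i * e)"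
      unfolding contract_def axial_sum_def
      using sites_less[OF x k] by (intro order.trans[OF sum_abs] sum_mono bdD[OF g] sites_update x m k) auto
    also have "\<dots> \<le> real N * (real N ^ i * e)"
      using sites_less[OF x k] e0 by (simp add: mult_right_mono)
    finally show ?thesis by (simp add: mult.assoc)
  qed
  have col: "bd (collapse2 N k g) (Suc i)"
    if k: "k \<in> {1..4}" and g: "bd g i" for k g i
    unfolding bd_def
  proof (intro ballI)
    fix x \<mu> \<nu> assume x: "x \<in> sites N" and m: "\<mu> \<in> {1..4::nat}" and n: "\<nu> \<in> {1..4::nat}"
    have "\<bar>\<Sum>t<N. g \<mu> \<nu> (x(k := t))\<bar> \<le> (\<Sum>t<N. real N ^ i * e)"
      by (intro order.trans[OF sum_abs] sum_mono bdD[OF g] sites_update x m n k) auto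
    also have "\<dots> = real N ^ Suc i * e" by simp
    finally have 1: "\<bar>\<Sum>t<N. g \<mu> \<nu> (x(k := t))\<bar> \<le> real N ^ Suc i * e" .
    have "\<bar>g \<mu> \<nu> (x(k := 0))\<bar> \<le> real N ^ i * e" using N by (intro bdD[OF g] sites_update x m n k) auto
    also have "\<dots> \<le> real N ^ Suc i * e" using N e0 by (intro mult_right_mono power_increasing) auto
    finally have 2: "\<bar>g \<mu> \<nu> (x(k := 0))\<bar> \<le> real N ^ Suc i * e" .
    have 3: "0 \<le> real N ^ Suc i * e" using e0 by simp
    show "\<bar>collapse2 N k g \<mu> \<nu> x\<bar> \<le> real N ^ Suc i * e" unfolding collapse2_def using 1 2 3 by auto
  qed
  have f0: "bd f 0" unfolding bd_def using f by simp
  have k: "4 \<in> {1..4::nat}" "3 \<in> {1..4::nat}" "2 \<in> {1..4::nat}" "1 \<in> {1..4::nat}" by auto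
  note f1 = col[OF k(1) f0]
  note f2 = col[OF k(2) f1]
  note f3 = col[OF k(3) f2]
  have p: "real N ^ Suc i * e \<le> real N ^ 4 * e" if "i < 4" for i
    using N e0 that by (intro mult_right_mono power_increasing) auto
  have "\<bar>contract 4 f \<mu> x\<bar> \<le> real N ^ 4 * e"
    using con[OF k(1) f0] p[of 0] by (rule order.trans) simp
  moreover have "\<bar>contract 3 (collapse2 N 4 f) \<mu> x\<bar> \<le> real N ^ 4 * e"
    using con[OF k(2) f1] p[of "Suc 0"] by (rule order.trans) simp
  moreover have "\<bar>contract 2 (collapse2 N 3 (collapse2 N 4 f)) \<mu> x\<bar> \<le> real N ^ 4 * e"
    using con[OF k(3) f2] p[of "Suc (Suc 0)"] by (rule order.trans) simp
  moreover have "\<bar>contract 1 (collapse2 N 2 (collapse2 N 3 (collapse2 N 4 f))) \<mu> x\<bar> \<le> real N ^ 4 * e"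
    using con[OF k(4) f3] p[of "Suc (Suc (Suc 0))"] by (rule order.trans) simp
  ultimately show ?thesis unfolding axial_potential_def mult.assoc by linarith
qed

text \<open>With \<open>x \<mu> < N - 1\<close> the coordinates below \<open>\<mu>\<close> are free
  and those above are 0; the extra 1 is the link closing the loop through the origin. Over the four
  directions the products add up to \<open>N ^ 4 - 1\<close>, the size of a spanning tree.\<close>

lemma card_axial_fixed:
  assumes N: "N \<ge> 1" and m: "\<mu> \<in> {1..4}"
  shows "card {x \<in> sites N. axial_fixed N \<mu> x} = (N - 1) * N ^ (\<mu> - 1) + 1"
proof -
  let ?A = "\<Pi>\<^sub>E i\<in>{1..4}. if i < \<mu> then {..<N} else if i = \<mu> then {..<N - 1} else {0::nat}"
  let ?p = "restrict (\<lambda>i. if i = \<mu> then N - 1 else 0) {1..4}"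
  have "{x \<in> sites N. axial_fixed N \<mu> x} = insert ?p ?A" (is "?L = ?R")
  proof (intro equalityI subsetI)
    fix x assume "x \<in> ?L"
    then have x: "x \<in> sites N" "axial_fixed N \<mu> x" by auto
    show "x \<in> ?R"
    proof (cases "x \<mu> = N - 1")
      case True
      have "x i = ?p i" for i
      proof (cases "i \<in> {1..4}")
        case i: True
        then have "i = \<mu> \<or> i < \<mu> \<or> \<mu> < i" by auto
        then show ?thesis using x(2) i True unfolding axial_fixed_def by auto
      next
        case False
        then show ?thesis using x(1) by (auto simp: sites_def PiE_iff extensional_def)
      qed
      then show ?thesis by blast
    next
      case False
      have "x \<in> ?A"
      proof (rule PiE_I)
        fix i assume i: "i \<in> {1..4::nat}"
        then have "x i < N" using x(1) sites_less by auto
        then show "x i \<in> (if i < \<mu> then {..<N} else if i = \<mu> then {..<N - 1} else {0})"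
          using x(2) i False unfolding axial_fixed_def by auto
      next
        fix i assume "i \<notin> {1..4::nat}"
        then show "x i = undefined" using x(1) by (auto simp: sites_def PiE_iff extensional_def)
      qed
      then show ?thesis by blast
    qed
  next
    fix x assume "x \<in> ?R"
    then consider "x = ?p" | "x \<in> ?A" by blast
    then show "x \<in> ?L"
    proof cases
      case 1
      then show ?thesis using N m by (auto simp: sites_def axial_fixed_def)
    next
      case 2
      have "x i < N" if "i \<in> {1..4}" for i
        using PiE_mem[OF 2 that] N by (auto split: if_splits)
      moreover have "x \<in> extensional {1..4}" using 2 by (simp add: PiE_iff)
      ultimately have "x \<in> sites N" by (simp add: sites_def PiE_iff)
      moreover have "x \<mu> < N - 1" using PiE_mem[OF 2 m] by auto
      moreover have "x \<nu> = 0" if "\<nu> \<in> {1..4}" "\<mu> < \<nu>" for \<nu>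
        using PiE_mem[OF 2 that(1)] that by auto
      ultimately show ?thesis by (auto simp: axial_fixed_def)
    qed
  qed
  moreover have "?p \<notin> ?A"
  proof
    assume "?p \<in> ?A"
    from PiE_mem[OF this m] show False using m by auto
  qed
  moreover have "finite ?A" by (intro finite_PiE) auto
  moreover have "card ?A = (N - 1) * N ^ (\<mu> - 1)"
    using m unfolding index_cases by (subst card_PiE, simp, unfold set_indices)
      (elim disjE; simp add: power2_eq_square power3_eq_cube)
  ultimately show ?thesis by simp
qed

section \<open>Topological charge and plaquette energy\<close>

lemma increasing_indices_2:
  "increasing_indices 2 = {[1,2],[1,3],[1,4],[2,3],[2,4],[3,4]}"
proof -
  have "\<mu>s \<in> increasing_indices 2 \<longleftrightarrow> \<mu>s \<in> {[1,2],[1,3],[1,4],[2,3],[2,4],[3,4]}" for \<mu>s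
  proof
    assume "\<mu>s \<in> increasing_indices 2"
    then obtain a b where "\<mu>s = [a, b]" "a \<in> {1..4}" "b \<in> {1..4}" "a < b"
      by (auto simp: increasing_indices_def numeral_2_eq_2 length_Suc_conv)
    then show "\<mu>s \<in> {[1,2],[1,3],[1,4],[2,3],[2,4],[3,4]}" unfolding index_cases by auto
  qed (auto simp: increasing_indices_def)
  then show ?thesis by blast
qed

lemma increasing_indices_3:
  "increasing_indices 3 = {[1,2,3],[1,2,4],[1,3,4],[2,3,4]}"
proof -
  have "\<mu>s \<in> increasing_indices 3 \<longleftrightarrow> \<mu>s \<in> {[1,2,3],[1,2,4],[1,3,4],[2,3,4]}" for \<mu>s
  proof
    assume "\<mu>s \<in> increasing_indices 3"
    then obtain a b c where "\<mu>s = [a, b, c]" "a \<in> {1..4}" "b \<in> {1..4}" "c \<in> {1..4}" "a < b" "b < c"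
      by (auto simp: increasing_indices_def numeral_3_eq_3 length_Suc_conv)
    moreover from this have "a = 1 \<and> b = 2 \<and> c = 3 \<or> a = 1 \<and> b = 2 \<and> c = 4 \<or>
        a = 1 \<and> b = 3 \<and> c = 4 \<or> a = 2 \<and> b = 3 \<and> c = 4"
      unfolding atLeastAtMost_iff by arith
    ultimately show "\<mu>s \<in> {[1,2,3],[1,2,4],[1,3,4],[2,3,4]}" by auto
  qed (auto simp: increasing_indices_def)
  then show ?thesis by blast
qed

lemma ext_deriv_1:
  "ext_deriv N A (x, [\<mu>, \<nu>]) = curl N (\<lambda>\<mu> x. A (x, [\<mu>])) \<mu> \<nu> x"
  by (simp add: ext_deriv_def curl_def fwd_diff_def omit_def)

lemma ext_deriv_2:
  "ext_deriv N n (x, [\<mu>, \<nu>, \<rho>]) = fwd_diff N \<mu> (\<lambda>x. n (x, [\<nu>, \<rho>])) x -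
     fwd_diff N \<nu> (\<lambda>x. n (x, [\<mu>, \<rho>])) x + fwd_diff N \<rho> (\<lambda>x. n (x, [\<mu>, \<nu>])) x"
  by (simp add: ext_deriv_def fwd_diff_def omit_def numeral_3_eq_3)

lemma levi_civita_not_distinct:
  assumes "\<not> distinct \<mu>s"
  shows "levi_civita \<mu>s = 0"
proof -
  obtain i j where ij: "i < length \<mu>s" "j < length \<mu>s" "i \<noteq> j" "\<mu>s ! i = \<mu>s ! j"
    using assms by (auto simp: distinct_conv_nth)
  let ?p = "\<lambda>i. if i \<in> {1..length \<mu>s} then \<mu>s ! (i - 1) else i"
  have "\<not> ?p permutes {1..length \<mu>s}"
  proof
    assume "?p permutes {1..length \<mu>s}"
    then have "inj ?p" by (rule permutes_inj)
    from injD[OF this, of "Suc i" "Suc j"] ij show False by auto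
  qed
  then show ?thesis by (simp add: levi_civita_def Let_def)
qed

lemma levi_civita_sign:
  assumes "q permutes {1..length \<mu>s}" "\<And>i. i < length \<mu>s \<Longrightarrow> q (Suc i) = \<mu>s ! i"
  shows "levi_civita \<mu>s = sign q"
proof -
  have "(\<lambda>i. if i \<in> {1..length \<mu>s} then \<mu>s ! (i - 1) else i) = q"
  proof
    fix i
    show "(if i \<in> {1..length \<mu>s} then \<mu>s ! (i - 1) else i) = q i"
      using assms(2)[of "i - 1"] permutes_not_in[OF assms(1), of i] by auto
  qed
  then show ?thesis using assms(1) by (simp add: levi_civita_def Let_def)
qed

lemma levi_civita_4:
  "levi_civita [1,2,3,4] = 1" "levi_civita [1,3,2,4] = -1" "levi_civita [1,4,2,3] = 1"
  "levi_civita [2,3,1,4] = 1" "levi_civita [2,4,1,3] = -1" "levi_civita [3,4,1,2] = 1"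
proof -
  note s = permutes_id permutes_compose permutes_swap_id sign_compose sign_swap_id permutation_swap_id
    Transposition.transpose_def less_Suc_eq permutation_compose
  have "levi_civita [1,2,3,4] = sign (id :: nat \<Rightarrow> nat)"
    by (rule levi_civita_sign) (auto simp: s)
  then show "levi_civita [1,2,3,4] = 1" by simp
  have "levi_civita [1,3,2,4] = sign (Transposition.transpose 2 (3::nat))"
    by (rule levi_civita_sign) (auto simp: s)
  then show "levi_civita [1,3,2,4] = -1" by (simp add: sign_swap_id)
  have "levi_civita [1,4,2,3] = sign (Transposition.transpose 2 4 \<circ> Transposition.transpose 3 (4::nat))"
    by (rule levi_civita_sign) (auto intro!: permutes_compose simp: s)
  then show "levi_civita [1,4,2,3] = 1" by (simp add: sign_compose permutation_swap_id sign_swap_id)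
  have "levi_civita [2,3,1,4] = sign (Transposition.transpose 1 2 \<circ> Transposition.transpose 2 (3::nat))"
    by (rule levi_civita_sign) (auto intro!: permutes_compose simp: s)
  then show "levi_civita [2,3,1,4] = 1" by (simp add: sign_compose permutation_swap_id sign_swap_id)
  have "levi_civita [2,4,1,3] = sign (Transposition.transpose 1 2 \<circ> (Transposition.transpose 2 4 \<circ> Transposition.transpose 3 (4::nat)))"
    by (rule levi_civita_sign) (auto intro!: permutes_compose simp: s)
  then show "levi_civita [2,4,1,3] = -1"
    by (simp add: sign_compose permutation_swap_id sign_swap_id permutation_compose)
  have "levi_civita [3,4,1,2] = sign (Transposition.transpose 1 3 \<circ> Transposition.transpose 2 (4::nat))"
    by (rule levi_civita_sign) (auto intro!: permutes_compose simp: s)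
  then show "levi_civita [3,4,1,2] = 1" by (simp add: sign_compose permutation_swap_id sign_swap_id)
qed

text \<open>Of the 36 pairs of planes only complementary ones survive; each splitting of the
  directions occurs in both orders, with different displacements of the second factor.\<close>

lemma top_charge_eq:
  "top_charge N F = 1 / (8 * pi\<^sup>2) *
    ((\<Sum>x\<in>sites N. F (x, [1,2]) * F (shift N (shift N x 1) 2, [3,4]))
   - (\<Sum>x\<in>sites N. F (x, [1,3]) * F (shift N (shift N x 1) 3, [2,4]))
   + (\<Sum>x\<in>sites N. F (x, [1,4]) * F (shift N (shift N x 1) 4, [2,3]))
   + (\<Sum>x\<in>sites N. F (x, [2,3]) * F (shift N (shift N x 2) 3, [1,4]))
   - (\<Sum>x\<in>sites N. F (x, [2,4]) * F (shift N (shift N x 2) 4, [1,3]))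
   + (\<Sum>x\<in>sites N. F (x, [3,4]) * F (shift N (shift N x 3) 4, [1,2])))"
  unfolding top_charge_def increasing_indices_2
  by (simp add: levi_civita_not_distinct levi_civita_4 sum.distrib sum_subtractf sum_negf
      algebra_simps flip: One_nat_def)

text \<open>Translations permute the sites. The displacement by both \<open>\<mu>\<close> and
  \<open>\<nu>\<close> is what makes each link of \<open>a\<close> pair with a difference of
  \<open>g\<close> based at the far end of that link, as the cancellation in
  \<open>top_wedge_curl\<close> requires.\<close>

lemma sum_by_parts:
  assumes "\<mu> \<in> {1..4}" "\<nu> \<in> {1..4}"
  shows "(\<Sum>x\<in>sites N. curl N a \<mu> \<nu> x * g (shift N (shift N x \<mu>) \<nu>)) =
    (\<Sum>x\<in>sites N. a \<mu> x * fwd_diff N \<nu> g (shift N x \<mu>)) -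
    (\<Sum>x\<in>sites N. a \<nu> x * fwd_diff N \<mu> g (shift N x \<nu>))"
proof -
  have 1: "(\<Sum>x\<in>sites N. a \<nu> (shift N x \<mu>) * g (shift N (shift N x \<mu>) \<nu>)) =
      (\<Sum>x\<in>sites N. a \<nu> x * g (shift N x \<nu>))"
    using sum_sites_shift[OF assms(1), of "\<lambda>x. a \<nu> x * g (shift N x \<nu>)"] .
  have 2: "(\<Sum>x\<in>sites N. a \<mu> (shift N x \<nu>) * g (shift N (shift N x \<mu>) \<nu>)) =
      (\<Sum>x\<in>sites N. a \<mu> x * g (shift N x \<mu>))"
    using sum_sites_shift[OF assms(2), of "\<lambda>x. a \<mu> x * g (shift N x \<mu>)"]
    by (simp add: shift_commute[of _ _ \<mu> \<nu>])
  show ?thesis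
    unfolding curl_def fwd_diff_def left_diff_distrib right_diff_distrib sum_subtractf 1 2
    by (simp add: shift_commute[of _ _ \<mu> \<nu>])
qed

text \<open>The lattice cup square of a 2-form evaluated on the torus, without the normalisation of
  \<open>top_charge\<close>.\<close>

definition top_wedge :: "nat \<Rightarrow> (nat \<Rightarrow> nat \<Rightarrow> site \<Rightarrow> real) \<Rightarrow> real" where
  "top_wedge N f =
    (\<Sum>x\<in>sites N. f 1 2 x * f 3 4 (shift N (shift N x 1) 2))
   - (\<Sum>x\<in>sites N. f 1 3 x * f 2 4 (shift N (shift N x 1) 3))
   + (\<Sum>x\<in>sites N. f 1 4 x * f 2 3 (shift N (shift N x 1) 4))
   + (\<Sum>x\<in>sites N. f 2 3 x * f 1 4 (shift N (shift N x 2) 3))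
   - (\<Sum>x\<in>sites N. f 2 4 x * f 1 3 (shift N (shift N x 2) 4))
   + (\<Sum>x\<in>sites N. f 3 4 x * f 1 2 (shift N (shift N x 3) 4))"

text \<open>
  Summation by parts collects, for each component of \<open>a\<close>, one cocycle sum of the closed form
  \<open>curl N a\<close>: this is the Leibniz rule for the lattice cup product.
\<close>

lemma top_wedge_curl: "top_wedge N (curl N a) = 0"
proof -
  let ?f = "curl N a"
  let ?S = "\<lambda>\<mu> h. \<Sum>x\<in>sites N. a \<mu> x * h (shift N x \<mu>)"
  have n: "4 \<in> {1..4::nat}" "3 \<in> {1..4::nat}" "2 \<in> {1..4::nat}" "1 \<in> {1..4::nat}" by auto
  have z: "?S i (fwd_diff N \<mu> (?f \<nu> \<rho>)) - ?S i (fwd_diff N \<nu> (?f \<mu> \<rho>)) + ?S i (fwd_diff N \<rho> (?f \<mu> \<nu>)) = 0"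
    if "i \<in> {1..4}" "\<mu> \<in> {1..4}" "\<nu> \<in> {1..4}" "\<rho> \<in> {1..4}" for i \<mu> \<nu> \<rho>
    unfolding sum_subtractf[symmetric] sum.distrib[symmetric] right_diff_distrib[symmetric] distrib_left[symmetric]
    by (rule sum.neutral) (simp add: closed2_cocycle[OF closed2_curl shift_in_sites[OF _ that(1)] that(2-4)])
  show ?thesis
    unfolding top_wedge_def sum_by_parts[OF n(4) n(3)] sum_by_parts[OF n(4) n(2)] sum_by_parts[OF n(4) n(1)]
      sum_by_parts[OF n(3) n(2)] sum_by_parts[OF n(3) n(1)] sum_by_parts[OF n(2) n(1)]
    using z[OF n(4) n(3) n(2) n(1)] z[OF n(3) n(4) n(2) n(1)] z[OF n(2) n(4) n(3) n(1)] z[OF n(1) n(4) n(3) n(2)]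
    by linarith
qed

text \<open>Cross terms are a constant times a lattice sum of a curl, hence 0. The factor 2 counts
  the two orders of each pair of complementary planes.\<close>

lemma top_wedge_curl_const:
  fixes c :: "nat \<Rightarrow> nat \<Rightarrow> real"
  assumes f: "\<And>x \<mu> \<nu>. x \<in> sites N \<Longrightarrow> \<mu> \<in> {1..4} \<Longrightarrow> \<nu> \<in> {1..4} \<Longrightarrow> f \<mu> \<nu> x = curl N a \<mu> \<nu> x + c \<mu> \<nu>"
  shows "top_wedge N f = real N ^ 4 * (2 * (c 1 2 * c 3 4 - c 1 3 * c 2 4 + c 1 4 * c 2 3))"
proof -
  have n: "4 \<in> {1..4::nat}" "3 \<in> {1..4::nat}" "2 \<in> {1..4::nat}" "1 \<in> {1..4::nat}" by auto
  have e: "(\<Sum>x\<in>sites N. f \<mu> \<nu> x * f \<rho> \<sigma> (shift N (shift N x \<mu>) \<nu>)) =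
      (\<Sum>x\<in>sites N. curl N a \<mu> \<nu> x * curl N a \<rho> \<sigma> (shift N (shift N x \<mu>) \<nu>)) + real N ^ 4 * (c \<mu> \<nu> * c \<rho> \<sigma>)"
    if i: "\<mu> \<in> {1..4}" "\<nu> \<in> {1..4}" "\<rho> \<in> {1..4}" "\<sigma> \<in> {1..4}" for \<mu> \<nu> \<rho> \<sigma>
  proof -
    have "(\<Sum>x\<in>sites N. f \<mu> \<nu> x * f \<rho> \<sigma> (shift N (shift N x \<mu>) \<nu>)) =
       (\<Sum>x\<in>sites N. curl N a \<mu> \<nu> x * curl N a \<rho> \<sigma> (shift N (shift N x \<mu>) \<nu>)
          + c \<rho> \<sigma> * curl N a \<mu> \<nu> x
          + c \<mu> \<nu> * curl N a \<rho> \<sigma> (shift N (shift N x \<mu>) \<nu>) + c \<mu> \<nu> * c \<rho> \<sigma>)"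
      using i by (intro sum.cong) (auto simp: f shift_in_sites algebra_simps)
    also have "(\<Sum>x\<in>sites N. c \<rho> \<sigma> * curl N a \<mu> \<nu> x) = 0"
      using i by (simp add: sum_curl flip: sum_distrib_left)
    moreover have "(\<Sum>x\<in>sites N. curl N a \<rho> \<sigma> (shift N (shift N x \<mu>) \<nu>)) = 0"
      using sum_sites_shift[OF i(1), of "\<lambda>x. curl N a \<rho> \<sigma> (shift N x \<nu>)"]
        sum_sites_shift[OF i(2), of "curl N a \<rho> \<sigma>"] i by (simp add: sum_curl)
    ultimately show ?thesis
      by (simp add: sum.distrib sum_distrib_left[symmetric] card_sites sum_curl i)
  qed
  show ?thesis
    using top_wedge_curl[of N a] unfolding top_wedge_def
    unfolding e[OF n(4) n(3) n(2) n(1)] e[OF n(4) n(2) n(3) n(1)] e[OF n(4) n(1) n(3) n(2)]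
      e[OF n(3) n(2) n(4) n(1)] e[OF n(3) n(1) n(4) n(2)] e[OF n(2) n(1) n(4) n(3)]
    by (simp add: algebra_simps)
qed

definition plaquette_energy :: "nat \<Rightarrow> (nat \<Rightarrow> nat \<Rightarrow> site \<Rightarrow> real) \<Rightarrow> real" where
  "plaquette_energy N f = (\<Sum>x\<in>sites N. \<Sum>\<mu>s\<in>increasing_indices 2. (f (\<mu>s ! 0) (\<mu>s ! 1) x)\<^sup>2)"

lemma plaquette_energy_curl_const:
  assumes f: "\<And>x \<mu> \<nu>. x \<in> sites N \<Longrightarrow> \<mu> \<in> {1..4} \<Longrightarrow> \<nu> \<in> {1..4} \<Longrightarrow> f \<mu> \<nu> x = curl N a \<mu> \<nu> x + c \<mu> \<nu>"
  shows "plaquette_energy N f = plaquette_energy N (curl N a) +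
    real N ^ 4 * ((c 1 2)\<^sup>2 + (c 1 3)\<^sup>2 + (c 1 4)\<^sup>2 + (c 2 3)\<^sup>2 + (c 2 4)\<^sup>2 + (c 3 4)\<^sup>2)"
proof -
  have e: "(\<Sum>x\<in>sites N. (f \<mu> \<nu> x)\<^sup>2) = (\<Sum>x\<in>sites N. (curl N a \<mu> \<nu> x)\<^sup>2) + real N ^ 4 * (c \<mu> \<nu>)\<^sup>2"
    if i: "\<mu> \<in> {1..4}" "\<nu> \<in> {1..4}" for \<mu> \<nu>
  proof -
    have "(\<Sum>x\<in>sites N. (f \<mu> \<nu> x)\<^sup>2) =
       (\<Sum>x\<in>sites N. (curl N a \<mu> \<nu> x)\<^sup>2 + (2 * c \<mu> \<nu>) * curl N a \<mu> \<nu> x + (c \<mu> \<nu>)\<^sup>2)"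
      using i by (intro sum.cong) (auto simp: f power2_eq_square algebra_simps)
    then show ?thesis
      by (simp only: sum.distrib sum_distrib_left[symmetric] card_sites sum_curl[OF i] sum_constant mult_zero_right of_nat_power)
  qed
  have n: "4 \<in> {1..4::nat}" "3 \<in> {1..4::nat}" "2 \<in> {1..4::nat}" "1 \<in> {1..4::nat}" by auto
  have exp: "plaquette_energy N g = (\<Sum>x\<in>sites N. (g 1 2 x)\<^sup>2) + (\<Sum>x\<in>sites N. (g 1 3 x)\<^sup>2) +
      (\<Sum>x\<in>sites N. (g 1 4 x)\<^sup>2) + (\<Sum>x\<in>sites N. (g 2 3 x)\<^sup>2) + (\<Sum>x\<in>sites N. (g 2 4 x)\<^sup>2) +
      (\<Sum>x\<in>sites N. (g 3 4 x)\<^sup>2)" for g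
    by (simp add: plaquette_energy_def increasing_indices_2 sum.distrib)
  show ?thesis
    unfolding exp e[OF n(4) n(3)] e[OF n(4) n(2)] e[OF n(4) n(1)] e[OF n(3) n(2)] e[OF n(3) n(1)] e[OF n(2) n(1)]
    by (simp add: algebra_simps)
qed

text \<open>Grouped by complementary planes (12, 34), (13, 24), (14, 23), the only ones that the
  charge couples; the flux sum then factors into three equal double sums.\<close>

type_synonym flux6 = "(int \<times> int) \<times> (int \<times> int) \<times> (int \<times> int)"

definition plane :: "nat \<Rightarrow> nat \<Rightarrow> nat \<Rightarrow> nat \<Rightarrow> int" where
  "plane i j \<mu> \<nu> = of_bool (\<mu> = i \<and> \<nu> = j) - of_bool (\<mu> = j \<and> \<nu> = i)"

text \<open>The sign of \<open>b\<close> makes the charge a sum of three products without signs.\<close>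

fun flux :: "flux6 \<Rightarrow> nat \<Rightarrow> nat \<Rightarrow> int" where
  "flux ((a, a'), (b, b'), (c, c')) \<mu> \<nu> =
    a * plane 1 2 \<mu> \<nu> + a' * plane 3 4 \<mu> \<nu> - b * plane 1 3 \<mu> \<nu> + b' * plane 2 4 \<mu> \<nu> +
    c * plane 1 4 \<mu> \<nu> + c' * plane 2 3 \<mu> \<nu>"

fun flux_norm2 :: "flux6 \<Rightarrow> int" where
  "flux_norm2 ((a, a'), (b, b'), (c, c')) = (a\<^sup>2 + a'\<^sup>2) + (b\<^sup>2 + b'\<^sup>2) + (c\<^sup>2 + c'\<^sup>2)"

fun flux_charge :: "flux6 \<Rightarrow> int" where
  "flux_charge ((a, a'), (b, b'), (c, c')) = a * a' + b * b' + c * c'"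

lemma plane_antisym: "plane i j \<mu> \<nu> = - plane i j \<nu> \<mu>"
  by (simp add: plane_def conj_commute)

lemma flux_antisym: "flux p \<mu> \<nu> = - flux p \<nu> \<mu>"
proof (cases p rule: flux_norm2.cases)
  case (1 a a' b b' c c')
  show ?thesis
    unfolding 1 flux.simps plane_antisym[of _ _ \<mu> \<nu>] by simp
qed

lemma flux_diag: "flux p \<mu> \<mu> = 0"
  using flux_antisym[of p \<mu> \<mu>] by simp

lemma flux_eqI:
  assumes "\<And>\<mu> \<nu>. \<mu> \<in> {1..4} \<Longrightarrow> \<nu> \<in> {1..4} \<Longrightarrow> \<mu> \<noteq> \<nu> \<Longrightarrow> flux p \<mu> \<nu> = flux q \<mu> \<nu>"
  shows "p = q"
proof -
  obtain a a' b b' c c' where p: "p = ((a, a'), (b, b'), (c, c'))" by (cases p rule: flux_norm2.cases)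
  obtain d d' e e' g g' where q: "q = ((d, d'), (e, e'), (g, g'))" by (cases q rule: flux_norm2.cases)
  show ?thesis
    using assms[of 1 2] assms[of 3 4] assms[of 1 3] assms[of 2 4] assms[of 1 4] assms[of 2 3]
    unfolding p q by (simp add: plane_def)
qed

lemma flux_surj:
  assumes "\<And>\<mu>. \<mu> \<in> {1..4} \<Longrightarrow> c \<mu> \<mu> = 0"
    and "\<And>\<mu> \<nu>. \<mu> \<in> {1..4} \<Longrightarrow> \<nu> \<in> {1..4} \<Longrightarrow> c \<mu> \<nu> = - c \<nu> \<mu>"
  shows "\<exists>p. \<forall>\<mu>\<in>{1..4}. \<forall>\<nu>\<in>{1..4}. flux p \<mu> \<nu> = c \<mu> \<nu>"
proof (intro exI ballI)
  fix \<mu> \<nu> assume i: "\<mu> \<in> {1..4::nat}" "\<nu> \<in> {1..4::nat}"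
  have n: "4 \<in> {1..4::nat}" "3 \<in> {1..4::nat}" "2 \<in> {1..4::nat}" "1 \<in> {1..4::nat}" by auto
  note e = assms(1)[OF n(1)] assms(1)[OF n(2)] assms(1)[OF n(3)] assms(1)[OF n(4)]
    assms(2)[OF n(3) n(4)] assms(2)[OF n(2) n(4)] assms(2)[OF n(1) n(4)] assms(2)[OF n(2) n(3)]
    assms(2)[OF n(1) n(3)] assms(2)[OF n(1) n(2)]
  show "flux ((c 1 2, c 3 4), (- c 1 3, c 2 4), (c 1 4, c 2 3)) \<mu> \<nu> = c \<mu> \<nu>"
    using i e unfolding index_cases by (elim disjE) (simp_all add: plane_def)
qed

section \<open>Integer-valued closed forms and the field strength\<close>

definition gauge_links :: "nat \<Rightarrow> (site \<times> nat list) set" where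
  "gauge_links N = {(x, \<mu>s) \<in> cells N 1. \<not> axial_fixed N (hd \<mu>s) x}"

lemma finite_cells: "finite (cells N r)"
proof -
  have "{\<mu>s. length \<mu>s = r \<and> set \<mu>s \<subseteq> {1..4}} = {\<mu>s. set \<mu>s \<subseteq> {1..4::nat} \<and> length \<mu>s = r}" by auto
  then show ?thesis unfolding cells_def
    using finite_lists_length_eq[of "{1..4::nat}" r] finite_sites by auto
qed

lemma cells_1: "c \<in> cells N 1 \<longleftrightarrow> (\<exists>x \<mu>. c = (x, [\<mu>]) \<and> x \<in> sites N \<and> \<mu> \<in> {1..4})"
  by (cases c) (auto simp: cells_def length_Suc_conv)

lemma cells_2:
  "c \<in> cells N 2 \<longleftrightarrow> (\<exists>x \<mu> \<nu>. c = (x, [\<mu>, \<nu>]) \<and> x \<in> sites N \<and> \<mu> \<in> {1..4} \<and> \<nu> \<in> {1..4})"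
  by (cases c) (auto simp: cells_def length_Suc_conv numeral_2_eq_2)

lemma mem_gauge_links:
  "(x, [\<mu>]) \<in> gauge_links N \<longleftrightarrow> x \<in> sites N \<and> \<mu> \<in> {1..4} \<and> \<not> axial_fixed N \<mu> x"
  by (auto simp: gauge_links_def cells_1[unfolded One_nat_def])

lemma gauge_linksE:
  assumes "c \<in> gauge_links N"
  obtains x \<mu> where "c = (x, [\<mu>])" "x \<in> sites N" "\<mu> \<in> {1..4}" "\<not> axial_fixed N \<mu> x"
proof -
  have "c \<in> cells N 1" using assms by (auto simp: gauge_links_def)
  then obtain x \<mu> where "c = (x, [\<mu>])" unfolding cells_1 by blast
  then show ?thesis using that assms mem_gauge_links by blast
qed

lemma gauge_links_subset: "gauge_links N \<subseteq> cells N 1"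
  by (auto simp: gauge_links_def)

lemma finite_gauge_links: "finite (gauge_links N)"
  using finite_subset[OF gauge_links_subset finite_cells] .

lemma card_gauge_links:
  assumes N: "N \<ge> 1"
  shows "card (gauge_links N) = 3 * (N ^ 4 - 1)"
proof -
  have "gauge_links N = (\<lambda>(\<mu>, x). (x, [\<mu>])) ` (SIGMA \<mu>:{1..4}. {x \<in> sites N. \<not> axial_fixed N \<mu> x})"
    by (force simp: mem_gauge_links elim: gauge_linksE)
  moreover have "inj_on (\<lambda>(\<mu>, x). (x, [\<mu>])) (SIGMA \<mu>:{1..4::nat}. {x \<in> sites N. \<not> axial_fixed N \<mu> x})"
    by (auto simp: inj_on_def)
  ultimately have 1: "card (gauge_links N) = (\<Sum>\<mu>\<in>{1..4}. card {x \<in> sites N. \<not> axial_fixed N \<mu> x})"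
    by (simp add: card_image card_SigmaI finite_sites)
  have "card {x \<in> sites N. \<not> axial_fixed N \<mu> x} + ((N - 1) * N ^ (\<mu> - 1) + 1) = N ^ 4"
    if "\<mu> \<in> {1..4}" for \<mu>
  proof -
    have "card {x \<in> sites N. \<not> axial_fixed N \<mu> x} + card {x \<in> sites N. axial_fixed N \<mu> x}
        = card ({x \<in> sites N. \<not> axial_fixed N \<mu> x} \<union> {x \<in> sites N. axial_fixed N \<mu> x})"
      by (rule card_Un_disjoint[symmetric]) (auto simp: finite_sites)
    also have "{x \<in> sites N. \<not> axial_fixed N \<mu> x} \<union> {x \<in> sites N. axial_fixed N \<mu> x} = sites N" by blast
    finally show ?thesis by (simp only: card_axial_fixed[OF N that] card_sites)
  qed
  then have "card (gauge_links N) + (\<Sum>\<mu>\<in>{1..4}. (N - 1) * N ^ (\<mu> - 1) + 1) = (\<Sum>\<mu>\<in>{1..4::nat}. N ^ 4)"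
    unfolding 1 sum.distrib[symmetric] by (intro sum.cong) auto
  then have "card (gauge_links N) + ((N - 1) * (1 + N + N ^ 2 + N ^ 3) + 4) = 4 * N ^ 4"
    unfolding set_indices by (simp add: algebra_simps power2_eq_square power3_eq_cube)
  moreover have "(N - 1) * (1 + N + N ^ 2 + N ^ 3) + 1 = N ^ 4"
  proof -
    obtain M where "N = Suc M" using N by (cases N) auto
    then show ?thesis by (simp add: eval_nat_numeral algebra_simps)
  qed
  ultimately show ?thesis by simp
qed

text \<open>Extension by zero to the fixed links, so that \<open>axial_potential_curl\<close>
  applies.\<close>

definition free_field :: "nat \<Rightarrow> 'a::comm_ring_1 lattice_form \<Rightarrow> nat \<Rightarrow> site \<Rightarrow> 'a" where
  "free_field N y \<mu> x = (if (x, [\<mu>]) \<in> gauge_links N then y (x, [\<mu>]) else 0)"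

lemma free_field_fixed: "axial_fixed N \<mu> x \<Longrightarrow> free_field N y \<mu> x = 0"
  by (simp add: free_field_def mem_gauge_links)

lemma curl_cong:
  assumes "\<And>x \<mu>. x \<in> sites N \<Longrightarrow> \<mu> \<in> {1..4} \<Longrightarrow> a \<mu> x = b \<mu> x"
    and "x \<in> sites N" "\<mu> \<in> {1..4}" "\<nu> \<in> {1..4}"
  shows "curl N a \<mu> \<nu> x = curl N b \<mu> \<nu> x"
  unfolding curl_def fwd_diff_def using assms shift_in_sites by simp

section \<open>Parametrisation of the closed integer 2-forms\<close>

lemma closed2_const:
  assumes "\<And>\<mu> \<nu>. c \<mu> \<nu> = - c \<nu> \<mu>" "\<And>\<mu>. c \<mu> \<mu> = 0"
  shows "closed2 N (\<lambda>\<mu> \<nu> x. c \<mu> \<nu>)"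
proof (rule closed2I)
  show "c \<mu> \<nu> = - c \<nu> \<mu>" for \<mu> \<nu> by (rule assms(1))
qed (auto simp: assms(2) fwd_diff_def)

text \<open>The support of a corner component does not involve directions off its plane, so for
  three distinct indices each difference vanishes; repeated indices are settled by
  antisymmetry.\<close>

lemma closed2_corner:
  assumes c: "\<And>\<mu> \<nu>. c \<mu> \<nu> = - c \<nu> \<mu>" "\<And>\<mu>. c \<mu> \<mu> = 0"
  shows "closed2 N (corner N c)"
proof (rule closed2I)
  have a: "corner N c \<mu> \<nu> x = - corner N c \<nu> \<mu> x" for \<mu> \<nu> x
    unfolding corner_def c(1)[of \<mu> \<nu>] by auto
  have d: "corner N c \<mu> \<mu> x = 0" for \<mu> x by (simp add: corner_def c(2))
  fix x :: site and \<mu> \<nu> \<rho> :: nat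
  show "corner N c \<mu> \<mu> x = 0" by (rule d)
  show "corner N c \<mu> \<nu> x = - corner N c \<nu> \<mu> x" by (rule a)
  have o: "fwd_diff N i (corner N c j k) x = 0" if "i \<noteq> j" "i \<noteq> k" for i j k
    using that by (simp add: fwd_diff_def corner_def shift_def)
  have e: "fwd_diff N i (corner N c j j) x = 0" for i j by (simp add: fwd_diff_def d)
  have n: "fwd_diff N i (corner N c j k) x = - fwd_diff N i (corner N c k j) x" for i j k
    unfolding fwd_diff_def a[of j k] by simp
  consider "\<mu> = \<nu>" | "\<nu> = \<rho>" | "\<mu> = \<rho>" | "\<mu> \<noteq> \<nu>" "\<nu> \<noteq> \<rho>" "\<mu> \<noteq> \<rho>" by blast
  then show "fwd_diff N \<mu> (corner N c \<nu> \<rho>) x - fwd_diff N \<nu> (corner N c \<mu> \<rho>) x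
      + fwd_diff N \<rho> (corner N c \<mu> \<nu>) x = 0"
  proof cases
    case 3
    then show ?thesis using n[of \<rho> \<nu> \<rho>] e[of \<nu> \<rho>] by simp
  qed (simp_all add: o e)
qed

definition int_form :: "nat \<Rightarrow> int lattice_form \<Rightarrow> flux6 \<Rightarrow> int lattice_form" where
  "int_form N m p = restrict (\<lambda>(x, \<mu>s). curl N (free_field N m) (\<mu>s ! 0) (\<mu>s ! 1) x +
     corner N (flux p) (\<mu>s ! 0) (\<mu>s ! 1) x) (cells N 2)"

lemma int_form_eq:
  assumes "x \<in> sites N" "\<mu> \<in> {1..4}" "\<nu> \<in> {1..4}"
  shows "int_form N m p (x, [\<mu>, \<nu>]) = curl N (free_field N m) \<mu> \<nu> x + corner N (flux p) \<mu> \<nu> x"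
proof -
  have "(x, [\<mu>, \<nu>]) \<in> cells N 2" using assms cells_2 by blast
  then show ?thesis by (simp add: int_form_def)
qed

definition closed_forms :: "nat \<Rightarrow> int lattice_form set" where
  "closed_forms N = {n \<in> forms N 2. \<forall>x\<in>sites N. \<forall>\<mu>s\<in>increasing_indices 3. ext_deriv N n (x, \<mu>s) = 0}"

lemma forms_2_iff:
  "n \<in> forms N 2 \<longleftrightarrow> n \<in> extensional (cells N 2) \<and>
    (\<forall>x\<in>sites N. \<forall>\<mu>\<in>{1..4}. \<forall>\<nu>\<in>{1..4}. n (x, [\<nu>, \<mu>]) = - n (x, [\<mu>, \<nu>]))"
proof -
  have 2: "(\<forall>i<2. \<forall>j<2. P i j) \<longleftrightarrow> P 0 0 \<and> P 0 1 \<and> P 1 0 \<and> P (1::nat) (1::nat)" for P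
    by (auto simp: numeral_2_eq_2 less_Suc_eq)
  have "(\<forall>(x, \<mu>s)\<in>cells N 2. \<forall>i<2. \<forall>j<2. i \<noteq> j \<longrightarrow>
       n (x, \<mu>s[i := \<mu>s ! j, j := \<mu>s ! i]) = - n (x, \<mu>s)) \<longleftrightarrow>
    (\<forall>x\<in>sites N. \<forall>\<mu>\<in>{1..4}. \<forall>\<nu>\<in>{1..4}. n (x, [\<nu>, \<mu>]) = - n (x, [\<mu>, \<nu>]))" (is "?L \<longleftrightarrow> ?R")
  proof
    assume L: ?L
    show ?R
    proof (intro ballI)
      fix x \<mu> \<nu> assume "x \<in> sites N" "\<mu> \<in> {1..4::nat}" "\<nu> \<in> {1..4::nat}"
      then have "(x, [\<mu>, \<nu>]) \<in> cells N 2" using cells_2 by blast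
      from bspec[OF L this] show "n (x, [\<nu>, \<mu>]) = - n (x, [\<mu>, \<nu>])" unfolding 2 by simp
    qed
  next
    assume R: ?R
    show ?L
    proof
      fix c assume "c \<in> cells N 2"
      then obtain x \<mu> \<nu> where c: "c = (x, [\<mu>, \<nu>])" "x \<in> sites N" "\<mu> \<in> {1..4}" "\<nu> \<in> {1..4}"
        unfolding cells_2 by blast
      have "n (x, [\<nu>, \<mu>]) = - n (x, [\<mu>, \<nu>])" using R c by blast
      then show "case c of (x, \<mu>s) \<Rightarrow> \<forall>i<2. \<forall>j<2. i \<noteq> j \<longrightarrow>
          n (x, \<mu>s[i := \<mu>s ! j, j := \<mu>s ! i]) = - n (x, \<mu>s)"
        unfolding c 2 by simp
    qed
  qed
  then show ?thesis unfolding forms_def by blast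
qed

lemma int_form_closed: "int_form N m p \<in> closed_forms N"
proof -
  have c: "closed2 N (\<lambda>\<mu> \<nu> x. curl N (free_field N m) \<mu> \<nu> x - - corner N (flux p) \<mu> \<nu> x)"
  proof (rule closed2_diff[OF closed2_curl])
    have "closed2 N (corner N (\<lambda>\<mu> \<nu>. - flux p \<mu> \<nu>))"
    proof (rule closed2_corner)
      show "- flux p \<mu> \<nu> = - (- flux p \<nu> \<mu>)" for \<mu> \<nu>
        using flux_antisym[of p \<mu> \<nu>] by linarith
    qed (simp add: flux_diag)
    then show "closed2 N (\<lambda>\<mu> \<nu> x. - corner N (flux p) \<mu> \<nu> x)"
      by (rule closed2_cong) (auto simp: corner_def)
  qed
  have cl: "closed2 N (\<lambda>\<mu> \<nu> x. int_form N m p (x, [\<mu>, \<nu>]))"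
    by (rule closed2_cong[OF c]) (simp add: int_form_eq)
  have "int_form N m p \<in> forms N 2"
    unfolding forms_2_iff
  proof (intro conjI ballI)
    show "int_form N m p \<in> extensional (cells N 2)" by (simp add: int_form_def)
    fix x \<mu> \<nu> assume *: "x \<in> sites N" "\<mu> \<in> {1..4::nat}" "\<nu> \<in> {1..4::nat}"
    show "int_form N m p (x, [\<nu>, \<mu>]) = - int_form N m p (x, [\<mu>, \<nu>])"
      by (rule closed2_antisym[OF cl *(1,3,2)])
  qed
  moreover have "ext_deriv N (int_form N m p) (x, \<mu>s) = 0"
    if x: "x \<in> sites N" and i: "\<mu>s \<in> increasing_indices 3" for x \<mu>s
  proof -
    obtain \<mu> \<nu> \<rho> where "\<mu>s = [\<mu>, \<nu>, \<rho>]" "\<mu> \<in> {1..4}" "\<nu> \<in> {1..4}" "\<rho> \<in> {1..4}"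
      using i by (auto simp: increasing_indices_def numeral_3_eq_3 length_Suc_conv)
    then show ?thesis using closed2_cocycle[OF cl x] by (simp add: ext_deriv_2)
  qed
  ultimately show ?thesis by (simp add: closed_forms_def)
qed

text \<open>The delta constraints cover increasing triples only. The cocycle expression
  \<open>J\<close> changes sign under transpositions of its indices, which extends them to all
  triples, and a repeated index gives \<open>J = - J\<close> in the integers.\<close>

lemma closed2_of_closed_form:
  assumes n: "n \<in> closed_forms N"
  shows "closed2 N (\<lambda>\<mu> \<nu> x. n (x, [\<mu>, \<nu>]))"
proof (rule closed2I)
  have a: "n (x, [\<mu>, \<nu>]) = - n (x, [\<nu>, \<mu>])"
    if "x \<in> sites N" "\<mu> \<in> {1..4}" "\<nu> \<in> {1..4}" for x \<mu> \<nu>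
    using n that unfolding closed_forms_def forms_2_iff by blast
  fix x :: site and \<mu> \<nu> \<rho> :: nat
  assume x: "x \<in> sites N" and m: "\<mu> \<in> {1..4}"
  show "n (x, [\<mu>, \<mu>]) = 0" using a[OF x m m] by simp
  assume u: "\<nu> \<in> {1..4}"
  show "n (x, [\<mu>, \<nu>]) = - n (x, [\<nu>, \<mu>])" by (rule a[OF x m u])
  assume r: "\<rho> \<in> {1..4}"
  define J where "J i j k = fwd_diff N i (\<lambda>x. n (x, [j, k])) x - fwd_diff N j (\<lambda>x. n (x, [i, k])) x
    + fwd_diff N k (\<lambda>x. n (x, [i, j])) x" for i j k
  have f: "fwd_diff N i (\<lambda>x. n (x, [j, k])) x = - fwd_diff N i (\<lambda>x. n (x, [k, j])) x"
    if "i \<in> {1..4}" "j \<in> {1..4}" "k \<in> {1..4}" for i j k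
    unfolding fwd_diff_def using a[OF x that(2,3)] a[OF shift_in_sites[OF x that(1)] that(2,3)] by simp
  have s12: "J i j k = - J j i k" and s23: "J i j k = - J i k j"
    if "i \<in> {1..4}" "j \<in> {1..4}" "k \<in> {1..4}" for i j k
    unfolding J_def using f[of k i j] f[of i j k] that by simp_all
  have sorted: "J i j k = 0" if "i \<in> {1..4}" "k \<in> {1..4}" "i < j" "j < k" for i j k
  proof -
    have "[i, j, k] \<in> increasing_indices 3" using that by (auto simp: increasing_indices_def)
    then have "ext_deriv N n (x, [i, j, k]) = 0" using n x by (auto simp: closed_forms_def)
    then show ?thesis by (simp add: ext_deriv_2 J_def)
  qed
  have le: "J i j k = 0" if "i \<in> {1..4}" "j \<in> {1..4}" "k \<in> {1..4}" "i \<le> j" "j \<le> k" for i j k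
    using sorted[of i k j] s12[of i i k] s23[of i j j] that by (cases "i = j"; cases "j = k") auto
  have "J \<mu> \<nu> \<rho> = 0"
  proof -
    consider "\<mu> \<le> \<nu>" "\<nu> \<le> \<rho>" | "\<mu> \<le> \<rho>" "\<rho> \<le> \<nu>" | "\<nu> \<le> \<mu>" "\<mu> \<le> \<rho>" | "\<nu> \<le> \<rho>" "\<rho> \<le> \<mu>"
      | "\<rho> \<le> \<mu>" "\<mu> \<le> \<nu>" | "\<rho> \<le> \<nu>" "\<nu> \<le> \<mu>" by linarith
    then show ?thesis
    proof cases
      case 1 then show ?thesis using le m u r by blast
    next
      case 2 then show ?thesis using le[OF m r u] s23[OF m u r] by simp
    next
      case 3 then show ?thesis using le[OF u m r] s12[OF m u r] by simp
    next
      case 4 then show ?thesis using le[OF u r m] s12[OF m u r] s23[OF u m r] by simp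
    next
      case 5 then show ?thesis using le[OF r m u] s23[OF m u r] s12[OF m r u] by simp
    next
      case 6 then show ?thesis using le[OF r u m] s12[OF m u r] s23[OF u m r] s12[OF u r m] by simp
    qed
  qed
  then show "fwd_diff N \<mu> (\<lambda>x. n (x, [\<nu>, \<rho>])) x - fwd_diff N \<nu> (\<lambda>x. n (x, [\<mu>, \<rho>])) x
      + fwd_diff N \<rho> (\<lambda>x. n (x, [\<mu>, \<nu>])) x = 0" by (simp add: J_def)
qed

text \<open>In axial gauge the curl controls the field. With \<open>e = 0\<close> this is the
  injectivity behind \<open>bij_betw_int_form\<close>, with \<open>e\<close> the square root of the
  action the coercivity of the Gaussian.\<close>

lemma axial_gauge_bound:
  fixes a :: "nat \<Rightarrow> site \<Rightarrow> real"
  assumes N: "N \<ge> 1" and x: "x \<in> sites N" "\<mu> \<in> {1..4}"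
    and a: "\<And>y \<nu>. y \<in> sites N \<Longrightarrow> \<nu> \<in> {1..4} \<Longrightarrow> axial_fixed N \<nu> y \<Longrightarrow> a \<nu> y = 0"
    and c: "\<And>x \<mu> \<nu>. x \<in> sites N \<Longrightarrow> \<mu> \<in> {1..4} \<Longrightarrow> \<nu> \<in> {1..4} \<Longrightarrow> \<bar>curl N a \<mu> \<nu> x\<bar> \<le> e"
  shows "\<bar>a \<mu> x\<bar> \<le> 4 * real N ^ 4 * e"
proof -
  have "\<bar>axial_potential N (curl N a) \<mu> x\<bar> \<le> 4 * real N ^ 4 * e"
    by (rule axial_potential_bound[OF N x]) (rule c)
  moreover have "axial_potential N (curl N a) \<mu> x = a \<mu> x"
    by (rule axial_potential_curl[OF N x]) (rule a)
  ultimately show ?thesis by simp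
qed

text \<open>Lattice sums isolate the fluxes, and what is left determines the 1-form by its curl.
  Surjectivity is \<open>closed2_decompose\<close> over the integers, whose potential lives on the
  free links by \<open>axial_potential_fixed\<close>.\<close>

lemma bij_betw_int_form:
  assumes N: "N \<ge> 1"
  shows "bij_betw (\<lambda>(m, p). int_form N m p) ((gauge_links N \<rightarrow>\<^sub>E UNIV) \<times> UNIV) (closed_forms N)"
  unfolding bij_betw_def
proof
  show "inj_on (\<lambda>(m, p). int_form N m p) ((gauge_links N \<rightarrow>\<^sub>E UNIV) \<times> UNIV)"
  proof (rule inj_onI, clarify)
    fix m m' p p'
    assume m: "m \<in> gauge_links N \<rightarrow>\<^sub>E UNIV" "m' \<in> gauge_links N \<rightarrow>\<^sub>E (UNIV :: int set)"
      and eq: "int_form N m p = int_form N m' p'"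
    have e: "curl N (free_field N m) \<mu> \<nu> x + corner N (flux p) \<mu> \<nu> x =
        curl N (free_field N m') \<mu> \<nu> x + corner N (flux p') \<mu> \<nu> x"
      if "x \<in> sites N" "\<mu> \<in> {1..4}" "\<nu> \<in> {1..4}" for x \<mu> \<nu>
      using int_form_eq[OF that, of m p] int_form_eq[OF that, of m' p'] eq by simp
    have pp: "p = p'"
    proof (rule flux_eqI)
      fix \<mu> \<nu> assume i: "\<mu> \<in> {1..4::nat}" "\<nu> \<in> {1..4::nat}" "\<mu> \<noteq> \<nu>"
      have "(\<Sum>x\<in>sites N. curl N (free_field N m) \<mu> \<nu> x + corner N (flux p) \<mu> \<nu> x) =
          (\<Sum>x\<in>sites N. curl N (free_field N m') \<mu> \<nu> x + corner N (flux p') \<mu> \<nu> x)"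
        by (rule sum.cong[OF refl e]) (use i in auto)
      then show "flux p \<mu> \<nu> = flux p' \<mu> \<nu>"
        unfolding sum.distrib sum_curl[OF i(1,2)] sum_corner[OF N i] using N by simp
    qed
    \<comment> \<open>The difference is cast to the reals, where \<open>axial_gauge_bound\<close> is
      stated.\<close>
    let ?a = "\<lambda>\<mu> x. real_of_int (free_field N m \<mu> x - free_field N m' \<mu> x)"
    have z: "curl N ?a \<mu> \<nu> x = 0" if "x \<in> sites N" "\<mu> \<in> {1..4}" "\<nu> \<in> {1..4}" for x \<mu> \<nu>
    proof -
      have "curl N ?a \<mu> \<nu> x = real_of_int (curl N (free_field N m) \<mu> \<nu> x - curl N (free_field N m') \<mu> \<nu> x)"
        by (simp add: curl_def fwd_diff_def)
      then show ?thesis using e[OF that] pp by simp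
    qed
    have "m c = m' c" if "c \<in> gauge_links N" for c
    proof -
      obtain x \<mu> where c: "c = (x, [\<mu>])" "x \<in> sites N" "\<mu> \<in> {1..4}" using gauge_linksE[OF \<open>c \<in> gauge_links N\<close>] by metis
      have "\<bar>?a \<mu> x\<bar> \<le> 4 * real N ^ 4 * 0"
        by (rule axial_gauge_bound[OF N c(2,3)]) (simp add: free_field_fixed, simp only: z abs_zero order_refl)
      then show ?thesis using that by (simp add: free_field_def c)
    qed
    then have "m = m'" using m by (intro PiE_ext) auto
    then show "m = m' \<and> p = p'" using pp by simp
  qed
next
  show "(\<lambda>(m, p). int_form N m p) ` ((gauge_links N \<rightarrow>\<^sub>E UNIV) \<times> UNIV) = closed_forms N"
  proof (intro equalityI subsetI)
    fix n assume "n \<in> (\<lambda>(m, p). int_form N m p) ` ((gauge_links N \<rightarrow>\<^sub>E UNIV) \<times> UNIV)"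
    then show "n \<in> closed_forms N" using int_form_closed by auto
  next
    fix n assume n: "n \<in> closed_forms N"
    define f where "f = (\<lambda>\<mu> \<nu> x. n (x, [\<mu>, \<nu>]))"
    have f: "closed2 N f" unfolding f_def by (rule closed2_of_closed_form[OF n])
    obtain c where c: "\<And>\<mu>. \<mu> \<in> {1..4} \<Longrightarrow> c \<mu> \<mu> = 0"
      "\<And>\<mu> \<nu>. \<mu> \<in> {1..4} \<Longrightarrow> \<nu> \<in> {1..4} \<Longrightarrow> c \<mu> \<nu> = - c \<nu> \<mu>"
      "\<And>x \<mu> \<nu>. x \<in> sites N \<Longrightarrow> \<mu> \<in> {1..4} \<Longrightarrow> \<nu> \<in> {1..4} \<Longrightarrow>
        f \<mu> \<nu> x = curl N (axial_potential N f) \<mu> \<nu> x + corner N c \<mu> \<nu> x"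
      using closed2_decompose[OF N f] by blast
    obtain p where p: "\<And>\<mu> \<nu>. \<mu> \<in> {1..4} \<Longrightarrow> \<nu> \<in> {1..4} \<Longrightarrow> flux p \<mu> \<nu> = c \<mu> \<nu>"
      using flux_surj[of c, OF c(1) c(2)] by blast
    define m where "m = restrict (\<lambda>(x, \<mu>s). axial_potential N f (hd \<mu>s) x) (gauge_links N)"
    have m: "free_field N m \<mu> x = axial_potential N f \<mu> x" if "x \<in> sites N" "\<mu> \<in> {1..4}" for x \<mu>
      using that axial_potential_fixed[OF f that] by (auto simp: free_field_def m_def mem_gauge_links)
    have "n d = int_form N m p d" for d
    proof (cases "d \<in> cells N 2")
      case True
      then obtain x \<mu> \<nu> where d: "d = (x, [\<mu>, \<nu>])" "x \<in> sites N" "\<mu> \<in> {1..4}" "\<nu> \<in> {1..4}"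
        unfolding cells_2 by blast
      have "n d = f \<mu> \<nu> x" by (simp add: f_def d)
      also have "\<dots> = curl N (free_field N m) \<mu> \<nu> x + corner N (flux p) \<mu> \<nu> x"
        using c(3)[OF d(2-4)] p[OF d(3,4)]
          curl_cong[of N "free_field N m" "axial_potential N f", OF m d(2-4)]
        by (simp add: corner_def)
      finally show ?thesis using int_form_eq d by simp
    next
      case False
      have "n \<in> extensional (cells N 2)" using n by (auto simp: closed_forms_def forms_def)
      from extensional_arb[OF this False] show ?thesis using False by (simp add: int_form_def)
    qed
    then have "n = int_form N m p" by blast
    moreover have "m \<in> gauge_links N \<rightarrow>\<^sub>E UNIV" by (simp add: m_def)
    ultimately show "n \<in> (\<lambda>(m, p). int_form N m p) ` ((gauge_links N \<rightarrow>\<^sub>E UNIV) \<times> UNIV)" by auto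
  qed
qed

definition fixed_field :: "nat \<Rightarrow> real lattice_form \<Rightarrow> nat \<Rightarrow> site \<Rightarrow> real" where
  "fixed_field N A \<mu> x = (if axial_fixed N \<mu> x then A (x, [\<mu>]) else 0)"

definition flux_fluctuation :: "nat \<Rightarrow> flux6 \<Rightarrow> nat \<Rightarrow> nat \<Rightarrow> site \<Rightarrow> real" where
  "flux_fluctuation N p \<mu> \<nu> x =
     corner N (\<lambda>\<mu> \<nu>. 2 * pi * of_int (flux p \<mu> \<nu>)) \<mu> \<nu> x - 2 * pi * of_int (flux p \<mu> \<nu>) / N\<^sup>2"

text \<open>
  The translation of the free links that absorbs the fixed links and the difference between the
  corner form and its mean value.
\<close>

definition gauge_shift :: "nat \<Rightarrow> real lattice_form \<Rightarrow> flux6 \<Rightarrow> real lattice_form" where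
  "gauge_shift N A p = (\<lambda>(x, \<mu>s). axial_potential N (curl N (fixed_field N A)) (hd \<mu>s) x +
     axial_potential N (flux_fluctuation N p) (hd \<mu>s) x)"

section \<open>The field strength as a curl plus a constant form\<close>

lemma closed2_flux_fluctuation: "closed2 N (flux_fluctuation N p)"
proof -
  have n: "of_int (flux p \<mu> \<nu>) = - (of_int (flux p \<nu> \<mu>) :: real)" for \<mu> \<nu>
    using flux_antisym[of p \<mu> \<nu>] by linarith
  show ?thesis
    unfolding flux_fluctuation_def
  proof (rule closed2_diff)
    show "closed2 N (corner N (\<lambda>\<mu> \<nu>. 2 * pi * real_of_int (flux p \<mu> \<nu>)))"
    proof (rule closed2_corner)
      show "2 * pi * real_of_int (flux p \<mu> \<nu>) = - (2 * pi * real_of_int (flux p \<nu> \<mu>))" for \<mu> \<nu>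
        unfolding n[of \<mu> \<nu>] by simp
    qed (simp add: flux_diag)
    show "closed2 N (\<lambda>\<mu> \<nu> x. 2 * pi * real_of_int (flux p \<mu> \<nu>) / real (N\<^sup>2))"
    proof (rule closed2_const)
      show "2 * pi * real_of_int (flux p \<mu> \<nu>) / real (N\<^sup>2) = - (2 * pi * real_of_int (flux p \<nu> \<mu>) / real (N\<^sup>2))" for \<mu> \<nu>
        unfolding n[of \<mu> \<nu>] by simp
    qed (simp add: flux_diag)
  qed
qed

text \<open>An off-diagonal corner component occupies \<open>N\<^sup>2\<close> of the
  \<open>N ^ 4\<close> sites, so subtracting its value divided by \<open>N\<^sup>2\<close> makes the
  lattice sum zero and the form exact over the reals.\<close>

lemma curl_flux_fluctuation:
  assumes N: "N \<ge> 1" and x: "x \<in> sites N" "\<mu> \<in> {1..4}" "\<nu> \<in> {1..4}"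
  shows "curl N (axial_potential N (flux_fluctuation N p)) \<mu> \<nu> x = flux_fluctuation N p \<mu> \<nu> x"
proof (rule closed2_exact[OF N closed2_flux_fluctuation _ x, symmetric])
  fix \<mu> \<nu> assume i: "\<mu> \<in> {1..4::nat}" "\<nu> \<in> {1..4::nat}"
  show "(\<Sum>x\<in>sites N. flux_fluctuation N p \<mu> \<nu> x) = 0"
  proof (cases "\<mu> = \<nu>")
    case True
    then show ?thesis by (simp add: flux_fluctuation_def flux_diag corner_def del: flux.simps cong: if_cong)
  next
    case False
    have "(\<Sum>x\<in>sites N. flux_fluctuation N p \<mu> \<nu> x) =
      of_nat (N\<^sup>2) * (2 * pi * of_int (flux p \<mu> \<nu>)) - real N ^ 4 * (2 * pi * of_int (flux p \<mu> \<nu>) / N\<^sup>2)"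
      unfolding flux_fluctuation_def sum_subtractf sum_corner[OF N i False] by (simp add: card_sites)
    also have "\<dots> = 0" using N by (simp add: field_simps eval_nat_numeral)
    finally show ?thesis .
  qed
qed

text \<open>The curl of the fixed-link field and the flux fluctuation both have axial potentials.
  These vanish on the fixed links, so they can be added to the free variables, and only a constant
  form is left outside the curl.\<close>

lemma field_strength_decompose:
  assumes N: "N \<ge> 1" and x: "x \<in> sites N" "\<mu> \<in> {1..4}" "\<nu> \<in> {1..4}"
  shows "field_strength N A (int_form N m p) (x, [\<mu>, \<nu>]) =
    curl N (free_field N (\<lambda>c. A c + 2 * pi * of_int (m c) + gauge_shift N A p c)) \<mu> \<nu> x +
    2 * pi * of_int (flux p \<mu> \<nu>) / N\<^sup>2"
proof -
  let ?ff = "curl N (fixed_field N A)"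
  let ?P = "axial_potential N ?ff"
  let ?H = "axial_potential N (flux_fluctuation N p)"
  let ?m = "\<lambda>\<mu> x. real_of_int (free_field N m \<mu> x)"
  have "curl N (free_field N (\<lambda>c. A c + 2 * pi * of_int (m c) + gauge_shift N A p c)) \<mu> \<nu> x =
      curl N (\<lambda>\<mu> x. (free_field N A \<mu> x + 2 * pi * ?m \<mu> x) + (?P \<mu> x + ?H \<mu> x)) \<mu> \<nu> x"
  proof (rule curl_cong[OF _ x])
    fix x \<mu> assume x: "x \<in> sites N" "\<mu> \<in> {1..4::nat}"
    show "free_field N (\<lambda>c. A c + 2 * pi * of_int (m c) + gauge_shift N A p c) \<mu> x =
        (free_field N A \<mu> x + 2 * pi * ?m \<mu> x) + (?P \<mu> x + ?H \<mu> x)"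
      using x axial_potential_fixed[OF closed2_curl x] axial_potential_fixed[OF closed2_flux_fluctuation x]
      by (auto simp: free_field_def gauge_shift_def mem_gauge_links)
  qed
  also have "\<dots> = curl N (free_field N A) \<mu> \<nu> x + 2 * pi * curl N ?m \<mu> \<nu> x +
      (curl N ?P \<mu> \<nu> x + curl N ?H \<mu> \<nu> x)"
    by (simp only: curl_add curl_scale)
  also have "curl N ?P \<mu> \<nu> x = ?ff \<mu> \<nu> x"
    by (rule closed2_exact[OF N closed2_curl sum_curl x, symmetric])
  also have "curl N ?H \<mu> \<nu> x = flux_fluctuation N p \<mu> \<nu> x" by (rule curl_flux_fluctuation[OF N x])
  also have "curl N ?m \<mu> \<nu> x = of_int (curl N (free_field N m) \<mu> \<nu> x)"
    by (simp add: curl_def fwd_diff_def)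
  finally have 1: "curl N (free_field N (\<lambda>c. A c + 2 * pi * of_int (m c) + gauge_shift N A p c)) \<mu> \<nu> x =
     curl N (free_field N A) \<mu> \<nu> x + 2 * pi * of_int (curl N (free_field N m) \<mu> \<nu> x) +
     (curl N (fixed_field N A) \<mu> \<nu> x + flux_fluctuation N p \<mu> \<nu> x)" .
  have "curl N (\<lambda>\<mu> x. A (x, [\<mu>])) \<mu> \<nu> x = curl N (\<lambda>\<mu> x. free_field N A \<mu> x + fixed_field N A \<mu> x) \<mu> \<nu> x"
    by (rule curl_cong[OF _ x]) (auto simp: free_field_def fixed_field_def mem_gauge_links)
  then have 2: "curl N (\<lambda>\<mu> x. A (x, [\<mu>])) \<mu> \<nu> x = curl N (free_field N A) \<mu> \<nu> x + curl N (fixed_field N A) \<mu> \<nu> x"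
    by (simp only: curl_add)
  have 3: "corner N (\<lambda>\<mu> \<nu>. 2 * pi * real_of_int (flux p \<mu> \<nu>)) \<mu> \<nu> x = 2 * pi * of_int (corner N (flux p) \<mu> \<nu> x)"
    by (simp add: corner_def)
  show ?thesis
    unfolding field_strength_def ext_deriv_1 int_form_eq[OF x] 1 2 flux_fluctuation_def 3
    by (simp add: algebra_simps)
qed

lemma flux_components:
  fixes p :: flux6
  defines "c \<equiv> \<lambda>\<mu> \<nu>. real_of_int (flux p \<mu> \<nu>)"
  shows "(c 1 2)\<^sup>2 + (c 1 3)\<^sup>2 + (c 1 4)\<^sup>2 + (c 2 3)\<^sup>2 + (c 2 4)\<^sup>2 + (c 3 4)\<^sup>2 = of_int (flux_norm2 p)"
    and "c 1 2 * c 3 4 - c 1 3 * c 2 4 + c 1 4 * c 2 3 = of_int (flux_charge p)"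
  unfolding c_def by (cases p rule: flux_norm2.cases; simp add: plane_def)+

text \<open>The \<open>N ^ 4\<close> sites cancel the squared flux density, so the flux energy is
  independent of \<open>N\<close>.\<close>

lemma plaquette_energy_field_strength:
  assumes N: "N \<ge> 1"
  shows "(\<Sum>x\<in>sites N. \<Sum>\<mu>s\<in>increasing_indices 2. (field_strength N A (int_form N m p) (x, \<mu>s))\<^sup>2) =
    plaquette_energy N (curl N (free_field N (\<lambda>c. A c + 2 * pi * of_int (m c) + gauge_shift N A p c))) +
    4 * pi\<^sup>2 * of_int (flux_norm2 p)"
proof -
  let ?c = "\<lambda>\<mu> \<nu>. 2 * pi * of_int (flux p \<mu> \<nu>) / N\<^sup>2"
  let ?F = "field_strength N A (int_form N m p)"
  have "(\<Sum>x\<in>sites N. \<Sum>\<mu>s\<in>increasing_indices 2. (?F (x, \<mu>s))\<^sup>2) =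
      plaquette_energy N (\<lambda>\<mu> \<nu> x. ?F (x, [\<mu>, \<nu>]))"
    unfolding plaquette_energy_def increasing_indices_2 by simp
  also have "\<dots> = plaquette_energy N (curl N (free_field N (\<lambda>c. A c + 2 * pi * of_int (m c) + gauge_shift N A p c))) +
      real N ^ 4 * ((?c 1 2)\<^sup>2 + (?c 1 3)\<^sup>2 + (?c 1 4)\<^sup>2 + (?c 2 3)\<^sup>2 + (?c 2 4)\<^sup>2 + (?c 3 4)\<^sup>2)"
    by (rule plaquette_energy_curl_const[where c = ?c]) (rule field_strength_decompose[OF N])
  also have "real N ^ 4 * ((?c 1 2)\<^sup>2 + (?c 1 3)\<^sup>2 + (?c 1 4)\<^sup>2 + (?c 2 3)\<^sup>2 + (?c 2 4)\<^sup>2 + (?c 3 4)\<^sup>2) =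
      4 * pi\<^sup>2 * of_int (flux_norm2 p)"
    unfolding flux_components(1)[symmetric] using N
    by (simp add: power_mult_distrib power_divide field_simps)
  finally show ?thesis .
qed

text \<open>Two factors \<open>2 * pi\<close> and the 2 from \<open>top_wedge_curl_const\<close>
  cancel \<open>8 * pi\<^sup>2\<close>, leaving an integer that depends neither on \<open>A\<close>
  nor on \<open>m\<close>.\<close>

lemma top_charge_field_strength:
  assumes N: "N \<ge> 1"
  shows "top_charge N (field_strength N A (int_form N m p)) = of_int (flux_charge p)"
proof -
  let ?c = "\<lambda>\<mu> \<nu>. 2 * pi * of_int (flux p \<mu> \<nu>) / N\<^sup>2"
  let ?F = "field_strength N A (int_form N m p)"
  have "top_charge N ?F = 1 / (8 * pi\<^sup>2) * top_wedge N (\<lambda>\<mu> \<nu> x. ?F (x, [\<mu>, \<nu>]))"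
    unfolding top_charge_eq top_wedge_def ..
  also have "top_wedge N (\<lambda>\<mu> \<nu> x. ?F (x, [\<mu>, \<nu>])) =
      real N ^ 4 * (2 * (?c 1 2 * ?c 3 4 - ?c 1 3 * ?c 2 4 + ?c 1 4 * ?c 2 3))"
    by (rule top_wedge_curl_const[where c = ?c]) (rule field_strength_decompose[OF N])
  also have "1 / (8 * pi\<^sup>2) * (real N ^ 4 * (2 * (?c 1 2 * ?c 3 4 - ?c 1 3 * ?c 2 4 + ?c 1 4 * ?c 2 3))) =
      of_int (flux_charge p)"
    unfolding flux_components(2)[symmetric] using N
    by (simp add: power_divide field_simps power2_eq_square eval_nat_numeral)
  finally show ?thesis .
qed

section \<open>Unfolding the circle integrals\<close>

abbreviation circle :: "real measure" where
  "circle \<equiv> uniform_measure lborel {-pi..<pi}"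

lemma prob_space_circle: "prob_space circle"
  by (rule prob_space_uniform_measure) auto

lemma nn_integral_circle:
  assumes [measurable]: "f \<in> borel_measurable borel"
  shows "ennreal (2 * pi) * (\<integral>\<^sup>+a. f a \<partial>circle) = (\<integral>\<^sup>+a. f a * indicator {-pi..<pi} a \<partial>lborel)"
proof -
  have "(\<integral>\<^sup>+a. f a \<partial>circle) = (\<integral>\<^sup>+a. f a * indicator {-pi..<pi} a \<partial>lborel) / ennreal (2 * pi)"
    by (subst nn_integral_uniform_measure) auto
  then show ?thesis
    by (simp add: ennreal_times_divide mult.commute[of "ennreal (2 * pi)"] ennreal_mult_divide_eq)
qed

text \<open>Every real number lies in exactly one translate of the half-open interval, whatever the
  offset \<open>c\<close>. The factor \<open>2 * pi\<close> undoes the normalisation of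
  \<open>circle\<close>.\<close>

lemma circle_tiling:
  assumes [measurable]: "A \<in> sets borel"
  shows "ennreal (2 * pi) * (\<integral>\<^sup>+k. \<integral>\<^sup>+a. indicator A (a + 2 * pi * of_int k + c) \<partial>circle \<partial>count_space UNIV)
    = emeasure lborel A"
proof -
  have one: "(\<integral>\<^sup>+k. indicator {-pi..<pi} (b - 2 * pi * of_int k - c) \<partial>count_space UNIV) = (1::ennreal)" for b
  proof -
    define k0 where "k0 = \<lfloor>(b - c + pi) / (2 * pi)\<rfloor>"
    have "-pi \<le> b - 2 * pi * of_int k - c \<and> b - 2 * pi * of_int k - c < pi \<longleftrightarrow> k = k0" for k
      unfolding k0_def eq_commute[of k] floor_eq_iff by (simp add: field_simps)
    then have "indicator {-pi..<pi} (b - 2 * pi * of_int k - c) = (indicator {k0} k :: ennreal)" for k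
      by (simp add: indicator_def)
    then show ?thesis by simp
  qed
  have "ennreal (2 * pi) * (\<integral>\<^sup>+k. \<integral>\<^sup>+a. indicator A (a + 2 * pi * of_int k + c) \<partial>circle \<partial>count_space UNIV) =
      (\<integral>\<^sup>+k. ennreal (2 * pi) * (\<integral>\<^sup>+a. indicator A (a + 2 * pi * of_int k + c) \<partial>circle) \<partial>count_space (UNIV::int set))"
    by (rule nn_integral_cmult[symmetric]) simp
  also have "\<dots> = (\<integral>\<^sup>+k. \<integral>\<^sup>+b. indicator A b * indicator {-pi..<pi} (b - 2 * pi * of_int k - c) \<partial>lborel \<partial>count_space (UNIV::int set))"
  proof (rule nn_integral_cong)
    fix k :: int
    have "(\<integral>\<^sup>+b. indicator A b * indicator {-pi..<pi} (b - 2 * pi * of_int k - c) \<partial>lborel) =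
      (\<integral>\<^sup>+a. indicator A (a + 2 * pi * of_int k + c) * indicator {-pi..<pi} a \<partial>lborel)"
      by (subst nn_integral_real_affine[where c = 1 and t = "2 * pi * of_int k + c"]) (auto simp: algebra_simps)
    then show "ennreal (2 * pi) * (\<integral>\<^sup>+a. indicator A (a + 2 * pi * of_int k + c) \<partial>circle) =
        (\<integral>\<^sup>+b. indicator A b * indicator {-pi..<pi} (b - 2 * pi * of_int k - c) \<partial>lborel)"
      by (subst nn_integral_circle) simp_all
  qed
  also have "\<dots> = (\<integral>\<^sup>+b. \<integral>\<^sup>+k. indicator A b * indicator {-pi..<pi} (b - 2 * pi * of_int k - c)
      \<partial>count_space (UNIV::int set) \<partial>lborel)"
    by (rule nn_integral_count_space_nn_integral[symmetric]) auto
  also have "\<dots> = (\<integral>\<^sup>+b. indicator A b \<partial>lborel)"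
    by (simp add: nn_integral_cmult one)
  finally show ?thesis by simp
qed

text \<open>The scaled image of counting measure times circle measure is identified with Lebesgue
  measure by its values on boxes, where everything factors into \<open>circle_tiling\<close>;
  equality of measures then covers integrands that are not products.\<close>

lemma PiM_circle_tiling:
  fixes T :: "'i set" and v :: "'i \<Rightarrow> real"
  assumes T: "finite T" and f[measurable]: "f \<in> borel_measurable (\<Pi>\<^sub>M i\<in>T. (lborel :: real measure))"
  shows "ennreal (2 * pi) ^ card T * (\<integral>\<^sup>+m. \<integral>\<^sup>+y. f (\<lambda>i\<in>T. y i + 2 * pi * of_int (m i) + v i)
      \<partial>(\<Pi>\<^sub>M i\<in>T. circle) \<partial>count_space (T \<rightarrow>\<^sub>E (UNIV :: int set))) = (\<integral>\<^sup>+y. f y \<partial>(\<Pi>\<^sub>M i\<in>T. lborel))"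
proof -
  interpret L: product_sigma_finite "\<lambda>i::'i. lborel :: real measure"
    by standard
  interpret U: product_prob_space "\<lambda>i::'i. circle"
    using prob_space_circle by (simp add: product_prob_space_def product_prob_space_axioms_def
      product_sigma_finite_def prob_space_imp_sigma_finite)
  interpret Z: product_sigma_finite "\<lambda>i::'i. count_space (UNIV :: int set)"
    by (simp add: product_sigma_finite_def sigma_finite_measure_count_space)
  let ?Z = "\<Pi>\<^sub>M i\<in>T. count_space (UNIV :: int set)" and ?U = "\<Pi>\<^sub>M i\<in>T. circle"
  let ?L = "\<Pi>\<^sub>M i\<in>T. (lborel :: real measure)"
  have Z: "?Z = count_space (T \<rightarrow>\<^sub>E UNIV)" using T by (rule count_space_PiM_finite) simp
  interpret PU: prob_space ?U by (rule prob_space_PiM) (rule prob_space_circle)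
  let ?g = "\<lambda>(m, y). \<lambda>i\<in>T. y i + 2 * pi * of_int (m i) + v i"
  have U_borel: "borel_measurable ?U = measurable ?U circle" by (rule measurable_cong_sets) simp_all
  have [measurable]: "(\<lambda>y. y i) \<in> borel_measurable ?U" if "i \<in> T" for i
    unfolding U_borel using that by (rule measurable_component_singleton)
  have g[measurable]: "?g \<in> measurable (?Z \<Otimes>\<^sub>M ?U) ?L"
    unfolding case_prod_beta
  proof (rule measurable_restrict)
    fix i assume i: "i \<in> T"
    have "(\<lambda>m. real_of_int (m i)) \<in> borel_measurable ?Z"
      using measurable_compose[OF measurable_component_singleton[OF i, of "\<lambda>_. count_space UNIV"],
        of real_of_int borel] by simp
    then have [measurable]: "(\<lambda>z. real_of_int (fst z i)) \<in> borel_measurable (?Z \<Otimes>\<^sub>M ?U)"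
      by (rule measurable_compose[OF measurable_fst])
    have [measurable]: "(\<lambda>z. snd z i) \<in> borel_measurable (?Z \<Otimes>\<^sub>M ?U)"
      using i by (intro measurable_compose[OF measurable_snd]) simp
    show "(\<lambda>z. snd z i + 2 * pi * real_of_int (fst z i) + v i) \<in> measurable (?Z \<Otimes>\<^sub>M ?U) lborel"
      by simp
  qed
  let ?D = "scale_measure (ennreal (2 * pi) ^ card T) (distr (?Z \<Otimes>\<^sub>M ?U) ?L ?g)"
  have fst: "(\<integral>\<^sup>+z. h (?g z) \<partial>(?Z \<Otimes>\<^sub>M ?U)) =
      (\<integral>\<^sup>+m. \<integral>\<^sup>+y. h (\<lambda>i\<in>T. y i + 2 * pi * of_int (m i) + v i) \<partial>?U \<partial>?Z)"
    if [measurable]: "h \<in> borel_measurable ?L" for h :: "_ \<Rightarrow> ennreal"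
  proof -
    have "(\<integral>\<^sup>+m. \<integral>\<^sup>+y. h (?g (m, y)) \<partial>?U \<partial>?Z) = (\<integral>\<^sup>+z. h (?g z) \<partial>(?Z \<Otimes>\<^sub>M ?U))"
      by (rule PU.nn_integral_fst) (rule measurable_compose[OF g that])
    then show ?thesis by simp
  qed
  have "?D = ?L"
  proof (rule L.PiM_eqI[OF T])
    show "sets ?D = sets ?L" by simp
    fix A :: "'i \<Rightarrow> real set" assume A: "\<And>i. i \<in> T \<Longrightarrow> A i \<in> sets lborel"
    have sA: "Pi\<^sub>E T A \<in> sets ?L" using A T by (intro sets_PiM_I_finite) auto
    have ind: "indicator (Pi\<^sub>E T A) (\<lambda>i\<in>T. w i) = (\<Prod>i\<in>T. indicator (A i) (w i) :: ennreal)" for w :: "'i \<Rightarrow> real"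
      using T by (auto simp: indicator_def PiE_iff split: if_splits intro!: prod.neutral[symmetric])
    have mA: "(\<lambda>a. indicator (A i) (a + s)) \<in> borel_measurable circle" if "i \<in> T" for i s
    proof -
      have [measurable]: "A i \<in> sets borel" using A[OF that] by simp
      show ?thesis by (subst measurable_cong_sets[of _ borel]) (simp_all, measurable)
    qed
    have "emeasure (distr (?Z \<Otimes>\<^sub>M ?U) ?L ?g) (Pi\<^sub>E T A) =
        (\<integral>\<^sup>+w. indicator (Pi\<^sub>E T A) w \<partial>distr (?Z \<Otimes>\<^sub>M ?U) ?L ?g)"
      using sA by simp
    also have "\<dots> = (\<integral>\<^sup>+z. indicator (Pi\<^sub>E T A) (?g z) \<partial>(?Z \<Otimes>\<^sub>M ?U))"
      using sA by (intro nn_integral_distr[OF g]) simp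
    also have "\<dots> = (\<integral>\<^sup>+m. \<integral>\<^sup>+y. (\<Prod>i\<in>T. indicator (A i) (y i + 2 * pi * of_int (m i) + v i)) \<partial>?U \<partial>?Z)"
      using sA by (subst fst) (simp_all only: ind borel_measurable_indicator)
    also have "\<dots> = (\<integral>\<^sup>+m. (\<Prod>i\<in>T. \<integral>\<^sup>+a. indicator (A i) (a + 2 * pi * of_int (m i) + v i) \<partial>circle) \<partial>?Z)"
    proof (rule nn_integral_cong)
      fix m :: "'i \<Rightarrow> int"
      show "(\<integral>\<^sup>+y. (\<Prod>i\<in>T. indicator (A i) (y i + 2 * pi * of_int (m i) + v i)) \<partial>?U) =
         (\<Prod>i\<in>T. \<integral>\<^sup>+a. indicator (A i) (a + 2 * pi * of_int (m i) + v i) \<partial>circle)"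
        by (rule U.product_nn_integral_prod[OF T, of "\<lambda>i a. indicator (A i) (a + 2 * pi * of_int (m i) + v i)"])
          (simp only: add.assoc mA)
    qed
    also have "\<dots> = (\<Prod>i\<in>T. \<integral>\<^sup>+k. \<integral>\<^sup>+a. indicator (A i) (a + 2 * pi * of_int k + v i) \<partial>circle \<partial>count_space UNIV)"
      by (rule Z.product_nn_integral_prod[OF T, of "\<lambda>i k. \<integral>\<^sup>+a. indicator (A i) (a + 2 * pi * of_int k + v i) \<partial>circle"])
        simp
    finally have "emeasure ?D (Pi\<^sub>E T A) = (\<Prod>i\<in>T. ennreal (2 * pi) *
        (\<integral>\<^sup>+k. \<integral>\<^sup>+a. indicator (A i) (a + 2 * pi * of_int k + v i) \<partial>circle \<partial>count_space UNIV))"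
      by (simp add: prod.distrib)
    also have "\<dots> = (\<Prod>i\<in>T. emeasure lborel (A i))"
      using A by (intro prod.cong refl circle_tiling) simp
    finally show "emeasure ?D (Pi\<^sub>E T A) = (\<Prod>i\<in>T. emeasure lborel (A i))" .
  qed
  then have "(\<integral>\<^sup>+y. f y \<partial>?L) = (\<integral>\<^sup>+y. f y \<partial>?D)" by simp
  also have "\<dots> = ennreal (2 * pi) ^ card T * (\<integral>\<^sup>+z. f (?g z) \<partial>(?Z \<Otimes>\<^sub>M ?U))"
    by (subst nn_integral_scale_measure) (simp_all add: nn_integral_distr[OF g])
  also have "(\<integral>\<^sup>+z. f (?g z) \<partial>(?Z \<Otimes>\<^sub>M ?U)) =
      (\<integral>\<^sup>+m. \<integral>\<^sup>+y. f (\<lambda>i\<in>T. y i + 2 * pi * of_int (m i) + v i) \<partial>?U \<partial>?Z)"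
    by (rule fst[OF f])
  finally show ?thesis unfolding Z by simp
qed

lemma PiM_lborel_scale:
  fixes T :: "'i set" and c :: real
  assumes T: "finite T" and c: "c > 0"
    and f[measurable]: "f \<in> borel_measurable (\<Pi>\<^sub>M i\<in>T. (lborel :: real measure))"
  shows "ennreal c ^ card T * (\<integral>\<^sup>+y. f (\<lambda>i\<in>T. c * y i) \<partial>(\<Pi>\<^sub>M i\<in>T. lborel)) = (\<integral>\<^sup>+y. f y \<partial>(\<Pi>\<^sub>M i\<in>T. lborel))"
proof -
  interpret L: product_sigma_finite "\<lambda>i::'i. lborel :: real measure"
    by standard
  let ?L = "\<Pi>\<^sub>M i\<in>T. (lborel :: real measure)"
  let ?g = "\<lambda>y. \<lambda>i\<in>T. c * y i"
  have g[measurable]: "?g \<in> measurable ?L ?L"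
  proof (rule measurable_restrict)
    fix i assume i: "i \<in> T"
    have "(\<lambda>y. y i) \<in> measurable ?L lborel" by (rule measurable_component_singleton[OF i])
    then show "(\<lambda>y. c * y i) \<in> measurable ?L lborel" by simp
  qed
  let ?D = "scale_measure (ennreal c ^ card T) (distr ?L ?L ?g)"
  have "?D = ?L"
  proof (rule L.PiM_eqI[OF T])
    show "sets ?D = sets ?L" by simp
    fix A :: "'i \<Rightarrow> real set" assume A: "\<And>i. i \<in> T \<Longrightarrow> A i \<in> sets lborel"
    have sA: "Pi\<^sub>E T A \<in> sets ?L" using A T by (intro sets_PiM_I_finite) auto
    have ind: "indicator (Pi\<^sub>E T A) (\<lambda>i\<in>T. w i) = (\<Prod>i\<in>T. indicator (A i) (w i) :: ennreal)" for w :: "'i \<Rightarrow> real"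
      using T by (auto simp: indicator_def PiE_iff split: if_splits intro!: prod.neutral[symmetric])
    have "emeasure (distr ?L ?L ?g) (Pi\<^sub>E T A) = (\<integral>\<^sup>+w. indicator (Pi\<^sub>E T A) w \<partial>distr ?L ?L ?g)"
      using sA by simp
    also have "\<dots> = (\<integral>\<^sup>+z. indicator (Pi\<^sub>E T A) (?g z) \<partial>?L)"
      using sA by (intro nn_integral_distr[OF g]) simp
    also have "\<dots> = (\<Prod>i\<in>T. \<integral>\<^sup>+a. indicator (A i) (c * a) \<partial>lborel)"
      unfolding ind by (rule L.product_nn_integral_prod[OF T, of "\<lambda>i a. indicator (A i) (c * a)"]) (use A in simp)
    finally have "emeasure ?D (Pi\<^sub>E T A) = (\<Prod>i\<in>T. ennreal c * (\<integral>\<^sup>+a. indicator (A i) (c * a) \<partial>lborel))"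
      by (simp add: prod.distrib)
    also have "\<dots> = (\<Prod>i\<in>T. emeasure lborel (A i))"
    proof (rule prod.cong[OF refl])
      fix i assume "i \<in> T"
      then have "A i \<in> sets borel" using A by simp
      then show "ennreal c * (\<integral>\<^sup>+a. indicator (A i) (c * a) \<partial>lborel) = emeasure lborel (A i)"
        using nn_integral_real_affine[of "indicator (A i)" c 0] c by simp
    qed
    finally show "emeasure ?D (Pi\<^sub>E T A) = (\<Prod>i\<in>T. emeasure lborel (A i))" .
  qed
  then have "(\<integral>\<^sup>+y. f y \<partial>?L) = (\<integral>\<^sup>+y. f y \<partial>?D)" by simp
  also have "\<dots> = ennreal c ^ card T * (\<integral>\<^sup>+z. f (?g z) \<partial>?L)"
    by (subst nn_integral_scale_measure) (simp_all add: nn_integral_distr[OF g])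
  finally show ?thesis by simp
qed

section \<open>The Gaussian integral\<close>

definition gauge_action :: "nat \<Rightarrow> real lattice_form \<Rightarrow> real" where
  "gauge_action N y = plaquette_energy N (curl N (free_field N y))"

lemma gauge_action_cong:
  assumes "\<And>c. c \<in> gauge_links N \<Longrightarrow> y c = z c"
  shows "gauge_action N y = gauge_action N z"
proof -
  have "free_field N y = free_field N z" using assms by (auto simp: free_field_def fun_eq_iff)
  then show ?thesis by (simp add: gauge_action_def)
qed

lemma gauge_action_scale: "gauge_action N (\<lambda>c. k * y c) = k\<^sup>2 * gauge_action N y"
proof -
  have "curl N (free_field N (\<lambda>c. k * y c)) \<mu> \<nu> x = k * curl N (free_field N y) \<mu> \<nu> x" for \<mu> \<nu> x
  proof -
    have "free_field N (\<lambda>c. k * y c) = (\<lambda>\<nu> x. k * free_field N y \<nu> x)"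
      by (auto simp: free_field_def fun_eq_iff)
    then show ?thesis by (simp only: curl_scale)
  qed
  then show ?thesis
    by (simp add: gauge_action_def plaquette_energy_def power_mult_distrib sum_distrib_left)
qed

lemma measurable_gauge_action:
  assumes "\<And>c. c \<in> gauge_links N \<Longrightarrow> (\<lambda>z. h z c) \<in> borel_measurable M"
  shows "(\<lambda>z. gauge_action N (h z)) \<in> borel_measurable M"
proof -
  have [measurable]: "(\<lambda>z. free_field N (h z) \<mu> x) \<in> borel_measurable M" for \<mu> x
    using assms by (cases "(x, [\<mu>]) \<in> gauge_links N") (simp_all add: free_field_def)
  show ?thesis unfolding gauge_action_def plaquette_energy_def curl_def fwd_diff_def by measurable
qed

lemma gauge_action_nonneg: "gauge_action N y \<ge> 0"
  unfolding gauge_action_def plaquette_energy_def by (intro sum_nonneg) auto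

text \<open>Each plaquette is at most the square root of the action in absolute value, and
  \<open>axial_gauge_bound\<close> passes this on to the links; \<open>16 * real N ^ 8\<close> is
  the square of its constant.\<close>

lemma gauge_action_coercive:
  assumes N: "N \<ge> 1" and c: "c \<in> gauge_links N"
  shows "(y c)\<^sup>2 \<le> 16 * real N ^ 8 * gauge_action N y"
proof -
  let ?f = "curl N (free_field N y)"
  define e where "e = sqrt (gauge_action N y)"
  have e: "0 \<le> e" "e\<^sup>2 = gauge_action N y" using gauge_action_nonneg by (simp_all add: e_def)
  have lt: "\<bar>?f \<mu> \<nu> x\<bar> \<le> e" if x: "x \<in> sites N" and i: "\<mu> \<in> {1..4}" "\<nu> \<in> {1..4}" "\<mu> < \<nu>" for \<mu> \<nu> x
  proof -
    have "[\<mu>, \<nu>] \<in> increasing_indices 2" using i by (auto simp: increasing_indices_def)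
    moreover have "finite (increasing_indices 2)" by (simp add: increasing_indices_2)
    ultimately have "(?f \<mu> \<nu> x)\<^sup>2 \<le> (\<Sum>\<mu>s\<in>increasing_indices 2. (?f (\<mu>s ! 0) (\<mu>s ! 1) x)\<^sup>2)"
      using member_le_sum[of "[\<mu>, \<nu>]" "increasing_indices 2" "\<lambda>\<mu>s. (?f (\<mu>s ! 0) (\<mu>s ! 1) x)\<^sup>2"] by simp
    also have "\<dots> \<le> gauge_action N y"
      unfolding gauge_action_def plaquette_energy_def
      using x by (intro member_le_sum finite_sites sum_nonneg) auto
    finally have "(?f \<mu> \<nu> x)\<^sup>2 \<le> e\<^sup>2" by (simp add: e)
    then show ?thesis using abs_le_square_iff[of "?f \<mu> \<nu> x" e] e by simp
  qed
  have b: "\<bar>?f \<mu> \<nu> x\<bar> \<le> e" if x: "x \<in> sites N" and i: "\<mu> \<in> {1..4}" "\<nu> \<in> {1..4}" for \<mu> \<nu> x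
  proof -
    have "?f \<mu> \<nu> x = - ?f \<nu> \<mu> x" by (simp add: curl_def)
    moreover have "?f \<mu> \<mu> x = 0" by (simp add: curl_def)
    ultimately show ?thesis using lt[OF x i] lt[OF x i(2,1)] e by (cases \<mu> \<nu> rule: linorder_cases) auto
  qed
  obtain x \<mu> where x: "c = (x, [\<mu>])" "x \<in> sites N" "\<mu> \<in> {1..4}" using gauge_linksE[OF c] by metis
  have "\<bar>free_field N y \<mu> x\<bar> \<le> 4 * real N ^ 4 * e"
    by (rule axial_gauge_bound[OF N x(2,3)]) (simp add: free_field_fixed, rule b)
  then have "\<bar>y c\<bar> \<le> 4 * real N ^ 4 * e" using c x by (simp add: free_field_def)
  then have "(y c)\<^sup>2 \<le> (4 * real N ^ 4 * e)\<^sup>2" using abs_le_square_iff[of "y c" "4 * real N ^ 4 * e"] e by simp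
  also have "\<dots> = 16 * real N ^ 8 * gauge_action N y" by (simp add: power_mult_distrib e)
  finally show ?thesis .
qed

abbreviation link_lborel :: "nat \<Rightarrow> real lattice_form measure" where
  "link_lborel N \<equiv> \<Pi>\<^sub>M c\<in>gauge_links N. lborel"

abbreviation link_circle :: "nat \<Rightarrow> real lattice_form measure" where
  "link_circle N \<equiv> \<Pi>\<^sub>M c\<in>gauge_links N. circle"

lemma measurable_gauge_action_lborel [measurable]:
  "gauge_action N \<in> borel_measurable (link_lborel N)"
proof (rule measurable_gauge_action)
  fix c assume "c \<in> gauge_links N"
  then show "(\<lambda>y. y c) \<in> borel_measurable (link_lborel N)"
    using measurable_component_singleton[of c "gauge_links N" "\<lambda>_. lborel :: real measure"] by simp
qed

lemma nn_integral_gaussian_finite: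
  assumes "a > 0"
  shows "(\<integral>\<^sup>+x. ennreal (exp (- a * x\<^sup>2)) \<partial>lborel) < \<infinity>"
proof -
  define s where "s = sqrt (1 / (2 * a))"
  have s: "s > 0" "s\<^sup>2 = 1 / (2 * a)" using assms by (simp_all add: s_def)
  have eq: "exp (- a * x\<^sup>2) = sqrt (2 * pi * s\<^sup>2) * normal_density 0 s x" for x
    using s assms by (simp add: normal_density_def)
  have "integrable lborel (\<lambda>x. exp (- a * x\<^sup>2))"
    unfolding eq using s by (intro integrable_mult_right) simp
  then show ?thesis unfolding integrable_iff_bounded by simp
qed

text \<open>Coercivity dominates the integrand by a product of one-dimensional Gaussians.\<close>

lemma gauss_finite:
  assumes N: "N \<ge> 1"
  shows "(\<integral>\<^sup>+y. ennreal (exp (- (1 / 2) * gauge_action N y)) \<partial>link_lborel N) < \<infinity>"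
proof -
  interpret L: product_sigma_finite "\<lambda>c::site \<times> nat list. lborel :: real measure" by standard
  \<comment> \<open>The added 1 keeps \<open>K\<close> positive when there are no free links, which
    happens for \<open>N = 1\<close>.\<close>
  define K where "K = 16 * real N ^ 8 * (card (gauge_links N) + 1)"
  have K: "K > 0" using N by (simp add: K_def)
  have "(\<Sum>c\<in>gauge_links N. (y c)\<^sup>2) \<le> K * gauge_action N y" for y
  proof -
    have "(\<Sum>c\<in>gauge_links N. (y c)\<^sup>2) \<le> (\<Sum>c\<in>gauge_links N. 16 * real N ^ 8 * gauge_action N y)"
      by (intro sum_mono gauge_action_coercive N)
    also have "\<dots> \<le> K * gauge_action N y"
      using gauge_action_nonneg[of N y] by (simp add: K_def algebra_simps)
    finally show ?thesis .
  qed
  then have le: "exp (- (1 / 2) * gauge_action N y) \<le> (\<Prod>c\<in>gauge_links N. exp (- (1 / (2 * K)) * (y c)\<^sup>2))" for y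
    unfolding exp_sum[OF finite_gauge_links, symmetric] sum_distrib_left[symmetric]
    using K by (simp add: field_simps)
  have "(\<integral>\<^sup>+y. ennreal (exp (- (1 / 2) * gauge_action N y)) \<partial>link_lborel N) \<le>
      (\<integral>\<^sup>+y. (\<Prod>c\<in>gauge_links N. ennreal (exp (- (1 / (2 * K)) * (y c)\<^sup>2))) \<partial>link_lborel N)"
    using le by (intro nn_integral_mono) (simp add: prod_ennreal prod_nonneg)
  also have "\<dots> = (\<Prod>c\<in>gauge_links N. \<integral>\<^sup>+x. ennreal (exp (- (1 / (2 * K)) * x\<^sup>2)) \<partial>lborel)"
    by (rule L.product_nn_integral_prod[OF finite_gauge_links]) simp
  also have "\<dots> < \<infinity>"
    using nn_integral_gaussian_finite[of "1 / (2 * K)"] K by (simp add: power_less_top_ennreal)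
  finally show ?thesis .
qed

text \<open>The integrand is positive everywhere, so a zero integral would make the whole space a
  null set, but the unit cube has measure 1.\<close>

lemma gauss_positive:
  "(\<integral>\<^sup>+y. ennreal (exp (- (1 / 2) * gauge_action N y)) \<partial>link_lborel N) > 0"
proof -
  interpret L: product_sigma_finite "\<lambda>c::site \<times> nat list. lborel :: real measure" by standard
  let ?M = "link_lborel N"
  have m: "(\<lambda>y. ennreal (exp (- (1 / 2) * gauge_action N y))) \<in> borel_measurable ?M" by measurable
  have "\<not> (AE y in ?M. False)"
  proof
    assume "AE y in ?M. False"
    then have "emeasure ?M (space ?M) = 0" by (simp add: AE_iff_measurable[OF sets.top])
    moreover have "emeasure ?M (\<Pi>\<^sub>E c\<in>gauge_links N. {0..1}) = 1"
      by (subst L.emeasure_PiM[OF finite_gauge_links]) auto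
    moreover have "emeasure ?M (\<Pi>\<^sub>E c\<in>gauge_links N. {0..1}) \<le> emeasure ?M (space ?M)"
      by (rule emeasure_space)
    ultimately show False by simp
  qed
  then show ?thesis
    using nn_integral_0_iff_AE[OF m] by (simp add: zero_less_iff_neq_zero)
qed

definition gauss_const :: "nat \<Rightarrow> real" where
  "gauss_const N = enn2real (\<integral>\<^sup>+y. ennreal (exp (- (1 / 2) * gauge_action N y)) \<partial>link_lborel N)"

lemma gauss_const:
  assumes "N \<ge> 1"
  shows "gauss_const N > 0"
    and "(\<integral>\<^sup>+y. ennreal (exp (- (1 / 2) * gauge_action N y)) \<partial>link_lborel N) = ennreal (gauss_const N)"
  using gauss_finite[OF assms] gauss_positive[of N]
  by (simp_all add: gauss_const_def enn2real_positive_iff less_top[symmetric])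

lemma gauss_scaled:
  assumes N: "N \<ge> 1" and b: "\<beta> > 0"
  shows "(\<integral>\<^sup>+y. ennreal (exp (- (\<beta> / 2) * gauge_action N y)) \<partial>link_lborel N) =
    ennreal (gauss_const N / sqrt \<beta> ^ card (gauge_links N))" (is "?I = _")
proof -
  have "gauge_action N (\<lambda>i\<in>gauge_links N. sqrt \<beta> * y i) = \<beta> * gauge_action N y" for y
  proof -
    have "gauge_action N (\<lambda>i\<in>gauge_links N. sqrt \<beta> * y i) = gauge_action N (\<lambda>c. sqrt \<beta> * y c)"
      by (rule gauge_action_cong) simp
    then show ?thesis using b by (simp add: gauge_action_scale)
  qed
  then have "ennreal (sqrt \<beta>) ^ card (gauge_links N) * ?I = ennreal (gauss_const N)"
    using PiM_lborel_scale[of "gauge_links N" "sqrt \<beta>" "\<lambda>y. ennreal (exp (- (1 / 2) * gauge_action N y))"]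
      b gauss_const(2)[OF N] finite_gauge_links[of N] by (simp add: mult.assoc)
  moreover obtain r where r: "?I = ennreal r" "r \<ge> 0"
  proof (cases ?I)
    \<comment> \<open>An infinite integral times a positive power would be infinite, against the
      finite right-hand side.\<close>
    case top
    then show ?thesis using calculation b by (simp add: ennreal_mult_top ennreal_power)
  qed (use that in auto)
  ultimately have "ennreal (sqrt \<beta> ^ card (gauge_links N) * r) = ennreal (gauss_const N)"
    using b by (simp add: ennreal_power ennreal_mult)
  then have "sqrt \<beta> ^ card (gauge_links N) * r = gauss_const N"
    using r b gauss_const(1)[OF N] by (simp add: ennreal_inj)
  then have "r = gauss_const N / sqrt \<beta> ^ card (gauge_links N)" using b by (simp add: field_simps)
  then show ?thesis by (simp only: r(1))
qed

text \<open>Each free link contributes \<open>1 / (2 * pi)\<close> from the circle measure and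
  \<open>1 / sqrt \<beta>\<close> from the rescaling.\<close>

definition gauge_weight :: "nat \<Rightarrow> real \<Rightarrow> real" where
  "gauge_weight N \<beta> = gauss_const N / (2 * pi * sqrt \<beta>) ^ card (gauge_links N)"

lemma gauge_weight_positive: "N \<ge> 1 \<Longrightarrow> \<beta> > 0 \<Longrightarrow> gauge_weight N \<beta> > 0"
  using gauss_const(1) by (simp add: gauge_weight_def)

text \<open>After unfolding, the integral runs over the whole line and the translation
  \<open>v\<close> drops out; this is what allows \<open>v\<close> to depend on the fixed links and
  the fluxes.\<close>

lemma sum_link_circle:
  assumes N: "N \<ge> 1" and b: "\<beta> > 0"
  shows "(\<integral>\<^sup>+m. \<integral>\<^sup>+y. ennreal (exp (- (\<beta> / 2) * gauge_action N (\<lambda>c. y c + 2 * pi * of_int (m c) + v c)))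
     \<partial>link_circle N \<partial>count_space (gauge_links N \<rightarrow>\<^sub>E (UNIV :: int set))) = ennreal (gauge_weight N \<beta>)"
    (is "?I = _")
proof -
  have "gauge_action N (\<lambda>i\<in>gauge_links N. y i + 2 * pi * of_int (m i) + v i) =
     gauge_action N (\<lambda>c. y c + 2 * pi * of_int (m c) + v c)" for y and m :: "_ \<Rightarrow> int"
    by (rule gauge_action_cong) simp
  then have 1: "ennreal (2 * pi) ^ card (gauge_links N) * ?I = ennreal (gauss_const N / sqrt \<beta> ^ card (gauge_links N))"
    using PiM_circle_tiling[OF finite_gauge_links, of "\<lambda>y. ennreal (exp (- (\<beta> / 2) * gauge_action N y))" N v]
      gauss_scaled[OF N b] by simp
  obtain r where r: "?I = ennreal r" "r \<ge> 0"
  proof (cases ?I)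
    case top
    then show ?thesis using 1 by (simp add: ennreal_mult_top ennreal_power)
  qed (use that in auto)
  have p: "0 \<le> 2 * pi" by simp
  have "ennreal ((2 * pi) ^ card (gauge_links N) * r) = ennreal (gauss_const N / sqrt \<beta> ^ card (gauge_links N))"
    unfolding 1[symmetric] r(1) ennreal_power[OF p] by (rule ennreal_mult[OF zero_le_power[OF p] r(2)])
  then have "(2 * pi) ^ card (gauge_links N) * r = gauss_const N / sqrt \<beta> ^ card (gauge_links N)"
    using r b gauss_const(1)[OF N] by (subst (asm) ennreal_inj) auto
  then have "r = gauge_weight N \<beta>"
    using b by (simp add: gauge_weight_def power_mult_distrib field_simps)
  then show ?thesis using r by simp
qed

section \<open>Integrating out the gauge field at given fluxes\<close>

lemma measurable_gauge_component:
  assumes "c \<in> cells N 1"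
  shows "(\<lambda>A. A c) \<in> borel_measurable (gauge_measure N)"
proof -
  have "borel_measurable (gauge_measure N) = measurable (gauge_measure N) circle"
    by (rule measurable_cong_sets) simp_all
  then show ?thesis
    using measurable_component_singleton[OF assms, of "\<lambda>_. circle"] by (simp only: gauge_measure_def)
qed

definition shifted_action :: "nat \<Rightarrow> flux6 \<Rightarrow> int lattice_form \<Rightarrow> real lattice_form \<Rightarrow> real" where
  "shifted_action N p m A = gauge_action N (\<lambda>c. A c + 2 * pi * of_int (m c) + gauge_shift N A p c)"

text \<open>Read off from the field strengths, which are finite combinations of link variables,
  instead of from \<open>gauge_shift\<close>; the two forms of the action differ by a flux
  constant.\<close>

lemma measurable_shifted_action [measurable]:
  assumes N: "N \<ge> 1"
  shows "shifted_action N p m \<in> borel_measurable (gauge_measure N)"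
proof -
  have [measurable]: "(\<lambda>A. field_strength N A n (x, \<mu>s)) \<in> borel_measurable (gauge_measure N)"
    if x: "x \<in> sites N" and i: "\<mu>s \<in> increasing_indices 2" for x \<mu>s and n :: "int lattice_form"
  proof -
    obtain \<mu> \<nu> where m: "\<mu>s = [\<mu>, \<nu>]" "\<mu> \<in> {1..4}" "\<nu> \<in> {1..4}"
      using i by (auto simp: increasing_indices_def numeral_2_eq_2 length_Suc_conv)
    have [measurable]: "(\<lambda>A. A (y, [\<rho>])) \<in> borel_measurable (gauge_measure N)"
      if "y \<in> sites N" "\<rho> \<in> {1..4}" for y \<rho>
      using that by (intro measurable_gauge_component) (auto simp: cells_1[unfolded One_nat_def])
    note s = shift_in_sites[OF x]
    show ?thesis
      unfolding field_strength_def m(1) ext_deriv_1 curl_def fwd_diff_def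
      using x m(2,3) s[OF m(2)] s[OF m(3)] by measurable
  qed
  have "shifted_action N p m = (\<lambda>A. (\<Sum>x\<in>sites N. \<Sum>\<mu>s\<in>increasing_indices 2.
      (field_strength N A (int_form N m p) (x, \<mu>s))\<^sup>2) - 4 * pi\<^sup>2 * of_int (flux_norm2 p))"
    unfolding shifted_action_def gauge_action_def plaquette_energy_field_strength[OF N] by simp
  also have "\<dots> \<in> borel_measurable (gauge_measure N)"
    by (intro borel_measurable_diff borel_measurable_sum borel_measurable_power) measurable
  finally show ?thesis .
qed

text \<open>For given values \<open>u\<close> on the fixed links the gauge shift is a constant
  translation of the free links, so the inner sum has the same value for every \<open>u\<close>, and
  averaging over \<open>u\<close> changes nothing.\<close>

lemma sum_gauge_measure:
  assumes N: "N \<ge> 1" and b: "\<beta> > 0"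
  shows "(\<integral>\<^sup>+m. \<integral>\<^sup>+A. ennreal (exp (- (\<beta> / 2) * shifted_action N p m A))
     \<partial>gauge_measure N \<partial>count_space (gauge_links N \<rightarrow>\<^sub>E (UNIV :: int set))) = ennreal (gauge_weight N \<beta>)"
proof -
  interpret U: product_prob_space "\<lambda>c::site \<times> nat list. circle"
    using prob_space_circle by (simp add: product_prob_space_def product_prob_space_axioms_def
      product_sigma_finite_def prob_space_imp_sigma_finite)
  let ?T = "gauge_links N" and ?C = "cells N 1 - gauge_links N"
  let ?P = "\<Pi>\<^sub>M c\<in>?C. circle"
  let ?h = "\<lambda>m A. ennreal (exp (- (\<beta> / 2) * shifted_action N p m A))"
  have CT: "?C \<inter> ?T = {}" "finite ?C" "?C \<union> ?T = cells N 1"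
    using gauge_links_subset finite_cells by auto
  interpret PC: prob_space ?P by (rule prob_space_PiM) (rule prob_space_circle)
  interpret PT: prob_space "link_circle N" by (rule prob_space_PiM) (rule prob_space_circle)
  have G: "gauge_measure N = (\<Pi>\<^sub>M c\<in>?C \<union> ?T. circle)" unfolding CT(3) gauge_measure_def ..
  have [measurable]: "shifted_action N p m \<in> borel_measurable (\<Pi>\<^sub>M c\<in>?C \<union> ?T. circle)" for m
    using measurable_shifted_action[OF N] unfolding G .
  have hm: "?h m \<in> borel_measurable (\<Pi>\<^sub>M c\<in>?C \<union> ?T. circle)" for m by measurable
  have [measurable]: "(\<lambda>z. ?h m (merge ?C ?T z)) \<in> borel_measurable (?P \<Otimes>\<^sub>M link_circle N)" for m
    by (rule measurable_compose[OF measurable_merge hm])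
  have T: "countable (?T \<rightarrow>\<^sub>E (UNIV :: int set))"
    by (rule countable_PiE[OF finite_gauge_links]) simp
  have shift: "shifted_action N p m (merge ?C ?T (u, y)) =
      gauge_action N (\<lambda>c. y c + 2 * pi * of_int (m c) + gauge_shift N u p c)"
    if u: "u \<in> space ?P" for m u y
  proof -
    have "fixed_field N (merge ?C ?T (u, y)) = fixed_field N u"
    proof (intro ext)
      fix \<mu> x
      show "fixed_field N (merge ?C ?T (u, y)) \<mu> x = fixed_field N u \<mu> x"
      proof (cases "axial_fixed N \<mu> x")
        case True
        then have nT: "(x, [\<mu>]) \<notin> ?T" by (simp add: mem_gauge_links)
        \<comment> \<open>For arguments outside the lattice both sides are \<open>undefined\<close>:
          \<open>merge\<close> by definition, \<open>u\<close> because points of the product space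
          are extensional.\<close>
        have "u (x, [\<mu>]) = undefined" if "(x, [\<mu>]) \<notin> ?C"
          using u that by (auto simp: space_PiM PiE_iff extensional_def)
        then show ?thesis using nT by (auto simp: fixed_field_def merge_def)
      qed (simp add: fixed_field_def)
    qed
    then have "gauge_shift N (merge ?C ?T (u, y)) p = gauge_shift N u p" by (simp add: gauge_shift_def)
    then show ?thesis unfolding shifted_action_def by (intro gauge_action_cong) (simp add: merge_def)
  qed
  have "(\<integral>\<^sup>+m. \<integral>\<^sup>+A. ?h m A \<partial>gauge_measure N \<partial>count_space (?T \<rightarrow>\<^sub>E (UNIV :: int set))) =
     (\<integral>\<^sup>+m. \<integral>\<^sup>+u. \<integral>\<^sup>+y. ?h m (merge ?C ?T (u, y)) \<partial>link_circle N \<partial>?P \<partial>count_space (?T \<rightarrow>\<^sub>E (UNIV :: int set)))"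
    unfolding G
    by (intro nn_integral_cong U.product_nn_integral_fold[OF CT(1,2) finite_gauge_links] hm)
  also have "\<dots> = (\<integral>\<^sup>+u. \<integral>\<^sup>+m. \<integral>\<^sup>+y. ?h m (merge ?C ?T (u, y)) \<partial>link_circle N
      \<partial>count_space (?T \<rightarrow>\<^sub>E (UNIV :: int set)) \<partial>?P)"
    by (rule nn_integral_count_space_nn_integral[OF T, symmetric]) measurable
  also have "\<dots> = (\<integral>\<^sup>+u. ennreal (gauge_weight N \<beta>) \<partial>?P)"
  proof (rule nn_integral_cong)
    fix u assume "u \<in> space ?P"
    then show "(\<integral>\<^sup>+m. \<integral>\<^sup>+y. ?h m (merge ?C ?T (u, y)) \<partial>link_circle N \<partial>count_space (?T \<rightarrow>\<^sub>E (UNIV :: int set)))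
        = ennreal (gauge_weight N \<beta>)"
      by (simp only: shift sum_link_circle[OF N b])
  qed
  also have "\<dots> = ennreal (gauge_weight N \<beta>)" by (simp only: nn_integral_const PC.emeasure_space_1 mult_1_right)
  finally show ?thesis .
qed

section \<open>Theta constants and the sum over fluxes\<close>

lemma norm_summable_on_product:
  fixes f :: "'a \<Rightarrow> complex" and g :: "'b \<Rightarrow> complex"
  assumes f: "(\<lambda>x. norm (f x)) summable_on A" and g: "(\<lambda>y. norm (g y)) summable_on B"
  shows "(\<lambda>z. norm (f (fst z) * g (snd z))) summable_on A \<times> B"
proof -
  have "(\<lambda>y. norm (f x) * norm (g y)) summable_on B" for x
    using g by (rule summable_on_cmult_right)
  moreover have "(\<lambda>x. norm (f x) * infsum (\<lambda>y. norm (g y)) B) summable_on A"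
    using f by (rule summable_on_cmult_left)
  moreover have "infsum (\<lambda>y. norm (g y)) B \<ge> 0" by (intro infsum_nonneg) auto
  ultimately show ?thesis
    using Infinite_Sum.abs_summable_on_Sigma_iff[of "\<lambda>z. f (fst z) * g (snd z)" A "\<lambda>_. B"]
    by (simp add: norm_mult infsum_cmult_right')
qed

lemma infsum_product:
  fixes f :: "'a \<Rightarrow> complex" and g :: "'b \<Rightarrow> complex"
  assumes "(\<lambda>x. norm (f x)) summable_on A" "(\<lambda>y. norm (g y)) summable_on B"
  shows "(\<Sum>\<^sub>\<infinity>z\<in>A \<times> B. f (fst z) * g (snd z)) = infsum f A * infsum g B"
proof -
  have "(\<lambda>z. f (fst z) * g (snd z)) summable_on A \<times> B"
    by (rule abs_summable_summable[OF norm_summable_on_product[OF assms]])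
  from infsum_Sigma_banach[OF this] show ?thesis
    by (simp add: infsum_cmult_right' infsum_cmult_left')
qed

text \<open>Comparison with a geometric series through
  \<open>\<bar>n\<bar> - 1 \<le> (n + \<alpha>)\<^sup>2\<close>, valid for the two characteristics
  that occur.\<close>

lemma gaussian_summable_on_int:
  fixes c \<alpha> :: real
  assumes c: "c > 0" and \<alpha>: "\<alpha> \<in> {0, 1 / 2}"
  shows "(\<lambda>n::int. exp (- c * (of_int n + \<alpha>)\<^sup>2)) summable_on (UNIV :: int set)"
proof -
  let ?e = "\<lambda>n::int. exp (- c * \<bar>real_of_int n\<bar>)"
  have "summable (\<lambda>n::nat. exp (- c) ^ n)" using c by (intro summable_geometric) simp
  then have s: "(\<lambda>n::nat. exp (- c * real n)) summable_on UNIV"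
    by (subst summable_on_UNIV_nonneg_real_iff) (simp_all add: exp_of_nat_mult[symmetric] mult.commute)
  have 1: "?e summable_on range int"
    using s by (subst summable_on_reindex) (simp_all add: o_def)
  have 2: "?e summable_on range (\<lambda>n. - int n)"
    using s by (subst summable_on_reindex) (simp_all add: o_def inj_on_def)
  have "?e summable_on (range int \<union> (range (\<lambda>n. - int n) - range int))"
    by (rule summable_on_Un_disjoint[OF 1 summable_on_subset_banach[OF 2]]) auto
  moreover have "range int \<union> (range (\<lambda>n. - int n) - range int) = UNIV"
    by (auto simp: image_def) (metis int_cases2)
  ultimately have "?e summable_on UNIV" by simp
  then have "(\<lambda>n. exp c * ?e n) summable_on UNIV" by (rule summable_on_cmult_right)
  then show ?thesis
  proof (rule summable_on_comparison_test)
    fix n :: int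
    have "\<bar>n\<bar> - 1 \<le> n\<^sup>2" "\<bar>n\<bar> - 1 \<le> n\<^sup>2 + n"
    proof -
      have "0 \<le> (\<bar>n\<bar> - 1)\<^sup>2" "n\<^sup>2 = \<bar>n\<bar>\<^sup>2" by simp_all
      then show "\<bar>n\<bar> - 1 \<le> n\<^sup>2" "\<bar>n\<bar> - 1 \<le> n\<^sup>2 + n"
        by (simp_all add: power2_eq_square algebra_simps)
    qed
    then have "real_of_int (\<bar>n\<bar> - 1) \<le> real_of_int (n\<^sup>2)" "real_of_int (\<bar>n\<bar> - 1) \<le> real_of_int (n\<^sup>2 + n)"
      by (simp_all only: of_int_le_iff)
    then have "\<bar>real_of_int n\<bar> - 1 \<le> (of_int n + \<alpha>)\<^sup>2"
    proof (cases "\<alpha> = 0")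
      case False
      then have "\<alpha> = 1 / 2" using \<alpha> by simp
      then have "(of_int n + \<alpha>)\<^sup>2 = real_of_int (n\<^sup>2 + n) + 1 / 4"
        by (simp only:) (simp add: power2_eq_square algebra_simps)
      then show ?thesis
        using \<open>real_of_int (\<bar>n\<bar> - 1) \<le> real_of_int (n\<^sup>2 + n)\<close> by simp
    qed (use \<open>real_of_int (\<bar>n\<bar> - 1) \<le> real_of_int (n\<^sup>2)\<close> in simp)
    then have "c * (\<bar>real_of_int n\<bar> - 1) \<le> c * (of_int n + \<alpha>)\<^sup>2" using c by (intro mult_left_mono) auto
    then have "- c * (of_int n + \<alpha>)\<^sup>2 \<le> c + - c * \<bar>of_int n\<bar>" by (simp add: algebra_simps)
    then show "exp (- c * (of_int n + \<alpha>)\<^sup>2) \<le> exp c * ?e n" by (simp add: exp_add[symmetric])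
  qed simp
qed

text \<open>The exponent is \<open>2 * pi * \<i> * u\<^sup>2 * \<tau>\<close> at
  \<open>u = n + \<alpha>\<close>, split into real and imaginary part.\<close>

definition theta_term :: "real \<Rightarrow> real \<Rightarrow> real \<Rightarrow> int \<Rightarrow> complex" where
  "theta_term \<beta> \<theta> \<alpha> n = exp (Complex (- (4 * pi\<^sup>2 * \<beta>) * (of_int n + \<alpha>)\<^sup>2) (\<theta> * (of_int n + \<alpha>)\<^sup>2))"

text \<open>The weight of the fluxes through one pair of complementary planes;
  \<open>2 * pi\<^sup>2 * \<beta>\<close> is \<open>\<beta> / 2\<close> times the
  \<open>4 * pi\<^sup>2\<close> of the flux energy.\<close>

definition charge_term :: "real \<Rightarrow> real \<Rightarrow> int \<times> int \<Rightarrow> complex" where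
  "charge_term \<beta> \<theta> = (\<lambda>(a, b). exp (Complex (- (2 * pi\<^sup>2 * \<beta>) * ((of_int a)\<^sup>2 + (of_int b)\<^sup>2)) (- \<theta> * of_int (a * b))))"

lemma norm_theta_term: "norm (theta_term \<beta> \<theta> \<alpha> n) = exp (- (4 * pi\<^sup>2 * \<beta>) * (of_int n + \<alpha>)\<^sup>2)"
  by (simp add: theta_term_def norm_exp_eq_Re)

lemma theta_char_eq:
  "theta_char \<alpha> 0 0 (2 * (of_real (\<theta> / (2 * pi)) + 2 * of_real pi * \<i> * of_real \<beta>)) =
    (\<Sum>\<^sub>\<infinity>n. theta_term \<beta> \<theta> \<alpha> n)"
  unfolding theta_char_def
proof (rule infsum_cong)
  fix n :: int
  have "\<i> * of_real pi * (of_int n + of_real \<alpha>)\<^sup>2 * (2 * (of_real (\<theta> / (2 * pi)) + 2 * of_real pi * \<i> * of_real \<beta>)) +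
      2 * of_real pi * \<i> * (of_int n + of_real \<alpha>) * (0 + of_real 0) =
      Complex (- (4 * pi\<^sup>2 * \<beta>) * (of_int n + \<alpha>)\<^sup>2) (\<theta> * (of_int n + \<alpha>)\<^sup>2)"
    (is "?l = ?r")
  proof -
    have sq: "(of_int n + of_real \<alpha>)\<^sup>2 = (of_real ((of_int n + \<alpha>)\<^sup>2) :: complex)" by simp
    have "?l = of_real ((of_int n + \<alpha>)\<^sup>2) * (\<i> * of_real (pi * 2 * (\<theta> / (2 * pi))) - of_real (4 * pi\<^sup>2 * \<beta>))"
      unfolding sq by (simp add: algebra_simps power2_eq_square del: of_real_power)
    also have "pi * 2 * (\<theta> / (2 * pi)) = \<theta>" by simp
    also have "of_real ((of_int n + \<alpha>)\<^sup>2) * (\<i> * of_real \<theta> - of_real (4 * pi\<^sup>2 * \<beta>)) = ?r"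
      by (simp add: complex_eq_iff algebra_simps del: of_real_power)
    finally show ?thesis .
  qed
  then show "exp (\<i> * of_real pi * (of_int n + of_real \<alpha>)\<^sup>2 * (2 * (of_real (\<theta> / (2 * pi)) + 2 * of_real pi * \<i> * of_real \<beta>)) +
      2 * of_real pi * \<i> * (of_int n + of_real \<alpha>) * (0 + of_real 0)) = theta_term \<beta> \<theta> \<alpha> n"
    by (simp only: theta_term_def)
qed

lemma norm_theta_term_summable:
  assumes "\<beta> > 0" "\<alpha> \<in> {0, 1 / 2}"
  shows "(\<lambda>n. norm (theta_term \<beta> \<theta> \<alpha> n)) summable_on UNIV"
  unfolding norm_theta_term using gaussian_summable_on_int[of "4 * pi\<^sup>2 * \<beta>" \<alpha>] assms by simp

lemma norm_charge_term_summable: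
  assumes "\<beta> > 0"
  shows "(\<lambda>p. norm (charge_term \<beta> \<theta> p)) summable_on UNIV"
proof -
  let ?g = "\<lambda>n::int. complex_of_real (exp (- (2 * pi\<^sup>2 * \<beta>) * (of_int n + 0)\<^sup>2))"
  have s: "(\<lambda>n. norm (?g n)) summable_on UNIV"
    using gaussian_summable_on_int[of "2 * pi\<^sup>2 * \<beta>" 0] assms by simp
  have "norm (charge_term \<beta> \<theta> p) = norm (?g (fst p) * ?g (snd p))" for p
    by (cases p) (simp add: charge_term_def norm_exp_eq_Re norm_mult exp_add[symmetric] algebra_simps
      flip: of_real_mult)
  then show ?thesis using norm_summable_on_product[OF s s] by simp
qed

text \<open>
  In terms of \<open>u = n + \<alpha>\<close> and \<open>v = m + \<alpha>\<close>, the substitution \<open>a = u + v\<close>, \<open>b = v - u\<close> gives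
  \<open>a\<^sup>2 + b\<^sup>2 = 2 (u\<^sup>2 + v\<^sup>2)\<close> and \<open>a b = v\<^sup>2 - u\<^sup>2\<close>.
\<close>

lemma theta_term_product:
  assumes "2 * \<alpha> = of_int k"
  shows "theta_term \<beta> \<theta> \<alpha> n * cnj (theta_term \<beta> \<theta> \<alpha> m) = charge_term \<beta> \<theta> (n + m + k, m - n)"
proof -
  let ?u = "of_int n + \<alpha>" and ?v = "of_int m + \<alpha>"
  have ab: "real_of_int (n + m + k) = ?u + ?v" "real_of_int (m - n) = ?v - ?u" using assms by simp_all
  have "theta_term \<beta> \<theta> \<alpha> n * cnj (theta_term \<beta> \<theta> \<alpha> m) =
      exp (Complex (- (4 * pi\<^sup>2 * \<beta>) * ?u\<^sup>2) (\<theta> * ?u\<^sup>2) + Complex (- (4 * pi\<^sup>2 * \<beta>) * ?v\<^sup>2) (- (\<theta> * ?v\<^sup>2)))"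
    by (simp add: theta_term_def exp_add exp_cnj complex_cnj)
  also have "Complex (- (4 * pi\<^sup>2 * \<beta>) * ?u\<^sup>2) (\<theta> * ?u\<^sup>2) + Complex (- (4 * pi\<^sup>2 * \<beta>) * ?v\<^sup>2) (- (\<theta> * ?v\<^sup>2)) =
      Complex (- (2 * pi\<^sup>2 * \<beta>) * ((?u + ?v)\<^sup>2 + (?v - ?u)\<^sup>2)) (- \<theta> * ((?u + ?v) * (?v - ?u)))"
    by (simp add: complex_eq_iff power2_eq_square algebra_simps)
  also have "exp \<dots> = charge_term \<beta> \<theta> (n + m + k, m - n)"
    unfolding charge_term_def prod.case of_int_mult ab ..
  finally show ?thesis .
qed

text \<open>The squared modulus is a double sum over \<open>n\<close> and \<open>m\<close>, and the
  substitution of \<open>theta_term_product\<close> carries it bijectively onto one parity class of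
  \<open>a + b\<close>, even for \<open>k = 0\<close> and odd for \<open>k = 1\<close>.\<close>

lemma theta_norm_square:
  assumes b: "\<beta> > 0" and \<alpha>: "\<alpha> \<in> {0, 1 / 2}" and k: "2 * \<alpha> = of_int k"
  shows "of_real ((norm (\<Sum>\<^sub>\<infinity>n. theta_term \<beta> \<theta> \<alpha> n))\<^sup>2) =
    (\<Sum>\<^sub>\<infinity>p\<in>{(a, b). even (a + b + k)}. charge_term \<beta> \<theta> p)"
proof -
  let ?t = "theta_term \<beta> \<theta> \<alpha>"
  have s: "(\<lambda>n. norm (?t n)) summable_on UNIV" by (rule norm_theta_term_summable[OF b \<alpha>])
  then have s': "(\<lambda>n. norm (cnj (?t n))) summable_on UNIV" by simp
  have "of_real ((norm (infsum ?t UNIV))\<^sup>2) = infsum ?t UNIV * infsum (\<lambda>n. cnj (?t n)) UNIV"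
    unfolding complex_norm_square infsum_cnj ..
  also have "\<dots> = (\<Sum>\<^sub>\<infinity>z\<in>UNIV \<times> UNIV. ?t (fst z) * cnj (?t (snd z)))"
    by (rule infsum_product[OF s s', symmetric])
  also have "\<dots> = (\<Sum>\<^sub>\<infinity>z\<in>UNIV \<times> UNIV. charge_term \<beta> \<theta> ((\<lambda>z. (fst z + snd z + k, snd z - fst z)) z))"
    by (simp only: theta_term_product[OF k])
  also have "\<dots> = (\<Sum>\<^sub>\<infinity>p\<in>{(a, b). even (a + b + k)}. charge_term \<beta> \<theta> p)"
  proof (rule infsum_reindex_bij_betw)
    show "bij_betw (\<lambda>z. (fst z + snd z + k, snd z - fst z)) (UNIV \<times> UNIV) {(a, b). even (a + b + k)}"
      unfolding bij_betw_def
    proof (intro conjI equalityI subsetI)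
      fix p :: "int \<times> int" assume "p \<in> {(a, b). even (a + b + k)}"
      then obtain a b where p: "p = (a, b)" and "even (a + b + k)" by blast
      then obtain c where "a + b + k = 2 * c" by (elim evenE)
      \<comment> \<open>Solves \<open>n + m + k = a\<close> and \<open>m - n = b\<close> for
        \<open>n\<close> and \<open>m\<close>, given \<open>a + b + k = 2 * c\<close>.\<close>
      then have "p = (\<lambda>z. (fst z + snd z + k, snd z - fst z)) (c - b - k, c - k)" using p by simp
      then show "p \<in> (\<lambda>z. (fst z + snd z + k, snd z - fst z)) ` (UNIV \<times> UNIV)" by blast
    qed (auto simp: inj_on_def)
  qed
  finally show ?thesis .
qed

lemma sum_charge_term:
  assumes b: "\<beta> > 0"
  shows "(\<Sum>\<^sub>\<infinity>p. charge_term \<beta> \<theta> p) = of_real ((norm (\<Sum>\<^sub>\<infinity>n. theta_term \<beta> \<theta> 0 n))\<^sup>2 +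
    (norm (\<Sum>\<^sub>\<infinity>n. theta_term \<beta> \<theta> (1 / 2) n))\<^sup>2)"
proof -
  have s: "charge_term \<beta> \<theta> summable_on A" for A
    using summable_on_subset_banach[OF abs_summable_summable[OF norm_charge_term_summable[OF b]]] by blast
  have U: "{(a::int, b). even (a + b + 0)} \<union> {(a, b). even (a + b + 1)} = UNIV" by auto
  have "(\<Sum>\<^sub>\<infinity>p\<in>{(a, b). even (a + b + 0)} \<union> {(a, b). even (a + b + 1)}. charge_term \<beta> \<theta> p) =
      (\<Sum>\<^sub>\<infinity>p\<in>{(a, b). even (a + b + 0)}. charge_term \<beta> \<theta> p) + (\<Sum>\<^sub>\<infinity>p\<in>{(a, b). even (a + b + 1)}. charge_term \<beta> \<theta> p)"
    by (rule infsum_Un_disjoint[OF s s]) auto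
  then show ?thesis
    unfolding U using theta_norm_square[OF b, of 0 0 \<theta>] theta_norm_square[OF b, of "1 / 2" 1 \<theta>] by simp
qed

section \<open>Fluxes through all six planes\<close>

definition flux_term :: "real \<Rightarrow> real \<Rightarrow> flux6 \<Rightarrow> complex" where
  "flux_term \<beta> \<theta> p = exp (Complex (- (2 * pi\<^sup>2 * \<beta>) * of_int (flux_norm2 p)) (- \<theta> * of_int (flux_charge p)))"

lemma flux_term_eq:
  "flux_term \<beta> \<theta> = (\<lambda>p. charge_term \<beta> \<theta> (fst p) *
     (\<lambda>z. charge_term \<beta> \<theta> (fst z) * charge_term \<beta> \<theta> (snd z)) (snd p))"
proof
  fix p :: flux6
  obtain a a' b b' c c' where p: "p = ((a, a'), (b, b'), (c, c'))" by (cases p rule: flux_norm2.cases)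
  show "flux_term \<beta> \<theta> p = charge_term \<beta> \<theta> (fst p) *
     (\<lambda>z. charge_term \<beta> \<theta> (fst z) * charge_term \<beta> \<theta> (snd z)) (snd p)"
    unfolding p flux_term_def charge_term_def
    by (simp only: fst_conv snd_conv prod.case exp_add[symmetric] flux_norm2.simps flux_charge.simps,
        rule arg_cong[where f = exp], simp add: complex_eq_iff algebra_simps)
qed

lemma
  assumes b: "\<beta> > 0"
  shows norm_flux_term_summable: "(\<lambda>p. norm (flux_term \<beta> \<theta> p)) summable_on UNIV"
    and sum_flux_term: "(\<Sum>\<^sub>\<infinity>p. flux_term \<beta> \<theta> p) = (\<Sum>\<^sub>\<infinity>p. charge_term \<beta> \<theta> p) ^ 3"
proof -
  note s = norm_charge_term_summable[OF b, of \<theta>]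
  note s2 = norm_summable_on_product[OF s s, unfolded UNIV_Times_UNIV]
  show "(\<lambda>p. norm (flux_term \<beta> \<theta> p)) summable_on UNIV"
    unfolding flux_term_eq using norm_summable_on_product[OF s s2] by simp
  show "(\<Sum>\<^sub>\<infinity>p. flux_term \<beta> \<theta> p) = (\<Sum>\<^sub>\<infinity>p. charge_term \<beta> \<theta> p) ^ 3"
    unfolding flux_term_eq using infsum_product[OF s s2] infsum_product[OF s s]
    by (simp add: power3_eq_cube mult.assoc)
qed

section \<open>The partition function\<close>

text \<open>Both sides are 0 when \<open>f\<close> is not summable.\<close>

lemma infsum_eq_integral_count_space:
  fixes f :: "'a \<Rightarrow> complex"
  shows "infsum f A = (LINT x|count_space A. f x)"
proof (cases "f summable_on A")
  case True
  then have "Infinite_Set_Sum.abs_summable_on f A" by (simp add: summable_on_iff_abs_summable_on_complex abs_summable_equivalent)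
  from infsetsum_infsum[OF this] show ?thesis by (simp add: infsetsum_def)
next
  case False
  then have "\<not> integrable (count_space A) f"
    by (simp add: summable_on_iff_abs_summable_on_complex abs_summable_equivalent Infinite_Set_Sum.abs_summable_on_def)
  then show ?thesis using False by (simp add: infsum_not_exists not_integrable_integral_eq)
qed

lemma integrable_count_space_iff:
  fixes f :: "'a \<Rightarrow> complex"
  shows "integrable (count_space A) f \<longleftrightarrow> (\<lambda>x. norm (f x)) summable_on A"
  using abs_summable_equivalent[of f A] by (simp add: Infinite_Set_Sum.abs_summable_on_def)

lemma closed_form_indicator:
  "(\<Prod>x\<in>sites N. \<Prod>\<mu>s\<in>increasing_indices 3. of_bool (ext_deriv N n (x, \<mu>s) = 0)) =
    (of_bool (\<forall>x\<in>sites N. \<forall>\<mu>s\<in>increasing_indices 3. ext_deriv N n (x, \<mu>s) = 0) :: complex)"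
proof (cases "\<forall>x\<in>sites N. \<forall>\<mu>s\<in>increasing_indices 3. ext_deriv N n (x, \<mu>s) = 0")
  case True
  then show ?thesis by simp
next
  case False
  then obtain x \<mu>s where x: "x \<in> sites N" "\<mu>s \<in> increasing_indices 3" "ext_deriv N n (x, \<mu>s) \<noteq> 0" by blast
  have "finite (increasing_indices 3)" by (simp add: increasing_indices_3)
  then have "(\<Prod>\<mu>s\<in>increasing_indices 3. of_bool (ext_deriv N n (x, \<mu>s) = 0)) = (0 :: complex)"
    using x by (intro prod_zero bexI[of _ \<mu>s]) auto
  then show ?thesis using False x finite_sites[of N] by (subst prod_zero) auto
qed

text \<open>Phase and flux energy form a prefactor; \<open>A\<close> and \<open>m\<close> enter only
  through one positive real factor.\<close>

definition boltzmann :: "nat \<Rightarrow> real \<Rightarrow> real \<Rightarrow> int lattice_form \<times> flux6 \<Rightarrow> real lattice_form \<Rightarrow> complex" where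
  "boltzmann N \<beta> \<theta> = (\<lambda>(m, p) A. flux_term \<beta> \<theta> p * of_real (exp (- (\<beta> / 2) * shifted_action N p m A)))"

text \<open>Holds for every fixed \<open>A\<close>, since reindexing along the bijection respects
  \<open>infsum\<close> whether or not the sum converges.\<close>

lemma sum_forms_eq:
  assumes N: "N \<ge> 1"
  shows "(\<Sum>\<^sub>\<infinity>n\<in>forms N 2.
        (let F = field_strength N A n in
         exp (- of_real (\<beta> / 2 * (\<Sum>x\<in>sites N. \<Sum>\<mu>s\<in>increasing_indices 2. (F (x, \<mu>s))\<^sup>2))
              - \<i> * of_real \<theta> * of_real (top_charge N F))) *
        (\<Prod>x\<in>sites N. \<Prod>\<mu>s\<in>increasing_indices 3. of_bool (ext_deriv N n (x, \<mu>s) = 0))) =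
    (\<Sum>\<^sub>\<infinity>i\<in>(gauge_links N \<rightarrow>\<^sub>E UNIV) \<times> UNIV. boltzmann N \<beta> \<theta> i A)"
proof -
  let ?W = "\<lambda>n. exp (- of_real (\<beta> / 2 * (\<Sum>x\<in>sites N. \<Sum>\<mu>s\<in>increasing_indices 2. (field_strength N A n (x, \<mu>s))\<^sup>2))
              - \<i> * of_real \<theta> * of_real (top_charge N (field_strength N A n)))"
  have "(\<Sum>\<^sub>\<infinity>n\<in>forms N 2. ?W n *
        (\<Prod>x\<in>sites N. \<Prod>\<mu>s\<in>increasing_indices 3. of_bool (ext_deriv N n (x, \<mu>s) = 0))) = infsum ?W (closed_forms N)"
    unfolding closed_form_indicator by (rule infsum_cong_neutral) (auto simp: closed_forms_def)
  also have "\<dots> = (\<Sum>\<^sub>\<infinity>i\<in>(gauge_links N \<rightarrow>\<^sub>E UNIV) \<times> UNIV. ?W ((\<lambda>(m, p). int_form N m p) i))"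
    by (rule infsum_reindex_bij_betw[OF bij_betw_int_form[OF N], symmetric])
  also have "\<dots> = (\<Sum>\<^sub>\<infinity>i\<in>(gauge_links N \<rightarrow>\<^sub>E UNIV) \<times> UNIV. boltzmann N \<beta> \<theta> i A)"
  proof (rule infsum_cong, clarify)
    fix m p
    have "- of_real (\<beta> / 2 * (shifted_action N p m A + 4 * pi\<^sup>2 * of_int (flux_norm2 p)))
        - \<i> * of_real \<theta> * of_real (of_int (flux_charge p)) =
      Complex (- (2 * pi\<^sup>2 * \<beta>) * of_int (flux_norm2 p)) (- \<theta> * of_int (flux_charge p)) +
        of_real (- (\<beta> / 2) * shifted_action N p m A)"
      by (simp add: complex_eq_iff algebra_simps)
    then have "?W (int_form N m p) = exp (Complex (- (2 * pi\<^sup>2 * \<beta>) * of_int (flux_norm2 p)) (- \<theta> * of_int (flux_charge p)) +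
        of_real (- (\<beta> / 2) * shifted_action N p m A))"
      unfolding plaquette_energy_field_strength[OF N] top_charge_field_strength[OF N]
        gauge_action_def[symmetric] shifted_action_def[symmetric] by (simp only:)
    then show "?W (int_form N m p) = boltzmann N \<beta> \<theta> (m, p) A"
      by (simp only: boltzmann_def prod.case flux_term_def exp_add exp_of_real)
  qed
  finally show ?thesis unfolding Let_def .
qed

text \<open>Fubini is applied on integer forms, fluxes and gauge field jointly. In absolute value
  the phase disappears and the sum over \<open>m\<close> is a constant, so integrability reduces to
  the absolutely convergent flux sum; the same computation with the phase gives the value.\<close>

lemma partition_function_eq:
  assumes N: "N \<ge> 1" and b: "\<beta> > 0"
  shows "partition_function N \<beta> \<theta> = of_real (gauge_weight N \<beta>) * (\<Sum>\<^sub>\<infinity>p. flux_term \<beta> \<theta> p)"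
proof -
  let ?G = "gauge_measure N" and ?M = "count_space (gauge_links N \<rightarrow>\<^sub>E (UNIV :: int set))"
  let ?P = "count_space (UNIV :: flux6 set)" and ?I = "count_space ((gauge_links N \<rightarrow>\<^sub>E (UNIV :: int set)) \<times> (UNIV :: flux6 set))"
  have cM: "countable (gauge_links N \<rightarrow>\<^sub>E (UNIV :: int set))"
    by (rule countable_PiE[OF finite_gauge_links]) simp
  have cP: "countable (UNIV :: flux6 set)" by simp
  have cI: "countable ((gauge_links N \<rightarrow>\<^sub>E (UNIV :: int set)) \<times> (UNIV :: flux6 set))"
    using cM cP by (rule countable_SIGMA)
  interpret G: prob_space ?G
    unfolding gauge_measure_def by (rule prob_space_PiM) (rule prob_space_circle)
  interpret M: sigma_finite_measure ?M by (rule sigma_finite_measure_count_space_countable[OF cM])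
  interpret P: sigma_finite_measure ?P by (rule sigma_finite_measure_count_space_countable[OF cP])
  interpret I: sigma_finite_measure ?I by (rule sigma_finite_measure_count_space_countable[OF cI])
  interpret IG: pair_sigma_finite ?I ?G ..
  interpret MP: pair_sigma_finite ?M ?P ..
  have I_eq: "?I = ?M \<Otimes>\<^sub>M ?P" by (rule pair_measure_countable[OF cM cP, symmetric])
  define E where "E m p A = exp (- (\<beta> / 2) * shifted_action N p m A)" for m p A
  define J where "J m p = (LINT A|?G. E m p A)" for m p
  have E[measurable]: "E m p \<in> borel_measurable ?G" for m p
    unfolding E_def using measurable_shifted_action[OF N, measurable] by measurable
  have E1: "0 \<le> E m p A" "E m p A \<le> 1" for m p A
    using b gauge_action_nonneg by (simp_all add: E_def shifted_action_def)
  have Ei: "integrable ?G (E m p)" for m p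
    by (rule G.integrable_const_bound[where B = 1]) (use E1 in auto)
  have J0: "0 \<le> J m p" for m p unfolding J_def using E1 by (intro integral_nonneg_AE) auto
  have J_nn: "(\<integral>\<^sup>+A. ennreal (E m p A) \<partial>?G) = ennreal (J m p)" for m p
    unfolding J_def using Ei E1 by (intro nn_integral_eq_integral) auto
  \<comment> \<open>The value is the same for all \<open>p\<close>, although each
    \<open>J m p\<close> depends on \<open>p\<close> through the gauge shift; hence the double sum
    factors.\<close>
  have J_sum: "(\<integral>\<^sup>+m. ennreal (J m p) \<partial>?M) = ennreal (gauge_weight N \<beta>)" for p
    using sum_gauge_measure[OF N b, of p] unfolding E_def[symmetric] J_nn .
  have w: "gauge_weight N \<beta> \<ge> 0" using gauge_weight_positive[OF N b] by simp
  have J_int: "(LINT m|?M. J m p) = gauge_weight N \<beta>" for p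
    by (rule integral_eq_nn_integral[of "\<lambda>m. J m p" ?M, THEN trans]) (use J0 J_sum w in auto)
  let ?B = "boltzmann N \<beta> \<theta>"
  have B: "?B (m, p) A = flux_term \<beta> \<theta> p * of_real (E m p A)" for m p A
    by (simp add: boltzmann_def E_def)
  have Bm[measurable]: "case_prod ?B \<in> borel_measurable (?I \<Otimes>\<^sub>M ?G)"
  proof (rule measurable_pair_measure_countable1[OF cI])
    fix i :: "int lattice_form \<times> flux6"
    show "(\<lambda>A. case_prod ?B (i, A)) \<in> borel_measurable ?G"
      by (cases i) (simp add: B)
  qed
  have "(\<integral>\<^sup>+z. ennreal (norm (case_prod ?B z)) \<partial>(?I \<Otimes>\<^sub>M ?G)) =
      (\<integral>\<^sup>+i. \<integral>\<^sup>+A. ennreal (norm (?B i A)) \<partial>?G \<partial>?I)"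
    using G.nn_integral_fst[of "\<lambda>z. ennreal (norm (case_prod ?B z))" ?I] Bm by simp
  also have "\<dots> = (\<integral>\<^sup>+i. (case i of (m, p) \<Rightarrow> ennreal (norm (flux_term \<beta> \<theta> p)) * ennreal (J m p)) \<partial>?I)"
  proof (rule nn_integral_cong, clarsimp)
    fix m p
    show "(\<integral>\<^sup>+A. ennreal (norm (?B (m, p) A)) \<partial>?G) = ennreal (norm (flux_term \<beta> \<theta> p)) * ennreal (J m p)"
      using E1 by (simp add: B norm_mult ennreal_mult nn_integral_cmult J_nn)
  qed
  also have "\<dots> = (\<integral>\<^sup>+p. \<integral>\<^sup>+m. ennreal (norm (flux_term \<beta> \<theta> p)) * ennreal (J m p) \<partial>?M \<partial>?P)"
    unfolding I_eq by (subst MP.nn_integral_snd[symmetric]) (simp_all add: pair_measure_countable cM)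
  also have "\<dots> = (\<integral>\<^sup>+p. ennreal (norm (flux_term \<beta> \<theta> p)) * ennreal (gauge_weight N \<beta>) \<partial>?P)"
    by (simp add: nn_integral_cmult J_sum)
  also have "\<dots> = (\<integral>\<^sup>+p. ennreal (norm (flux_term \<beta> \<theta> p)) \<partial>?P) * ennreal (gauge_weight N \<beta>)"
    by (rule nn_integral_multc) simp
  also have "\<dots> < \<infinity>"
    using integrable_count_space_iff[of UNIV "flux_term \<beta> \<theta>"] norm_flux_term_summable[OF b]
    by (simp add: integrable_iff_bounded ennreal_mult_less_top)
  finally have Bi: "integrable (?I \<Otimes>\<^sub>M ?G) (case_prod ?B)"
    unfolding integrable_iff_bounded using Bm by simp
  have BJ: "(LINT A|?G. ?B i A) = (case i of (m, p) \<Rightarrow> flux_term \<beta> \<theta> p * of_real (J m p))" for i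
    by (cases i) (simp add: B J_def)
  have "integrable ?I (\<lambda>i. LINT A|?G. ?B i A)"
    using IG.integrable_fst'[OF Bi] by simp
  then have Ji: "integrable (?M \<Otimes>\<^sub>M ?P) (\<lambda>(m, p). flux_term \<beta> \<theta> p * of_real (J m p))"
    unfolding BJ I_eq .
  have "partition_function N \<beta> \<theta> = (LINT A|?G. LINT i|?I. ?B i A)"
    unfolding partition_function_def sum_forms_eq[OF N] by (simp only: infsum_eq_integral_count_space)
  also have "\<dots> = (LINT i|?I. LINT A|?G. ?B i A)" by (rule IG.Fubini_integral[OF Bi])
  also have "\<dots> = (LINT z|(?M \<Otimes>\<^sub>M ?P). (\<lambda>(m, p). flux_term \<beta> \<theta> p * of_real (J m p)) z)"
    unfolding BJ I_eq ..
  also have "\<dots> = (LINT p|?P. LINT m|?M. flux_term \<beta> \<theta> p * of_real (J m p))"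
    by (rule MP.integral_snd[symmetric]) (use Ji in simp)
  also have "\<dots> = (LINT p|?P. flux_term \<beta> \<theta> p * of_real (gauge_weight N \<beta>))"
    by (simp add: J_int)
  also have "\<dots> = (\<Sum>\<^sub>\<infinity>p. flux_term \<beta> \<theta> p) * of_real (gauge_weight N \<beta>)"
    unfolding infsum_eq_integral_count_space by simp
  finally show ?thesis by (simp add: mult.commute)
qed

theorem mainTheorem2:
  fixes N :: nat
  assumes "N \<ge> 1"
  shows "\<exists>C::real. C > 0 \<and> (\<forall>\<beta> \<theta> :: real. \<beta> > 0 \<longrightarrow>
    (let \<tau> = of_real (\<theta> / (2 * pi)) + 2 * of_real pi * \<i> * of_real \<beta> in
     partition_function N \<beta> \<theta> =
       of_real (C / sqrt \<beta> ^ (3 * (N ^ 4 - 1)) *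
         ((cmod (theta_char 0 0 0 (2 * \<tau>)))\<^sup>2 +
          (cmod (theta_char (1 / 2) 0 0 (2 * \<tau>)))\<^sup>2) ^ 3)))"
proof (intro exI[of _ "gauss_const N / (2 * pi) ^ (3 * (N ^ 4 - 1))"] conjI allI impI)
  show "gauss_const N / (2 * pi) ^ (3 * (N ^ 4 - 1)) > 0"
    using gauss_const(1)[OF assms] by simp
  fix \<beta> \<theta> :: real assume b: "\<beta> > 0"
  \<comment> \<open>The witness is the part of \<open>gauge_weight\<close> free of
    \<open>\<beta>\<close>: the Gaussian integral at \<open>\<beta> = 1\<close> and one factor
    \<open>1 / (2 * pi)\<close> per free link.\<close>
  have "gauge_weight N \<beta> = gauss_const N / (2 * pi) ^ (3 * (N ^ 4 - 1)) / sqrt \<beta> ^ (3 * (N ^ 4 - 1))"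
    by (simp add: gauge_weight_def card_gauge_links[OF assms] power_mult_distrib)
  then show "let \<tau> = of_real (\<theta> / (2 * pi)) + 2 * of_real pi * \<i> * of_real \<beta> in
     partition_function N \<beta> \<theta> =
       of_real (gauss_const N / (2 * pi) ^ (3 * (N ^ 4 - 1)) / sqrt \<beta> ^ (3 * (N ^ 4 - 1)) *
         ((cmod (theta_char 0 0 0 (2 * \<tau>)))\<^sup>2 +
          (cmod (theta_char (1 / 2) 0 0 (2 * \<tau>)))\<^sup>2) ^ 3)"
    unfolding Let_def theta_char_eq partition_function_eq[OF assms b] sum_flux_term[OF b] sum_charge_term[OF b]
    by (simp only: of_real_mult of_real_power)
qed

end
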